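(* Let $p$ be a prime and $n\ge 1$. Let $A_1,A_2,\ldots\in \mathrm{GL}_n(\mathbb{Q}_p)$ be i.i.d. random matrices whose distribution is invariant under both left- and right-multiplication by $\mathrm{GL}_n(\mathbb{Z}_p)$. Let $\lambda(k)=(\lambda_1(k),\ldots,\lambda_n(k))=\mathrm{SN}(A_1\cdots A_k)$. For every $1\le i\le n$, let $A_1^{(i)}\in \mathrm{Mat}_{(n-i+1)\times n}(\mathbb{Q}_p)$ denote the submatrix of $A_1$ consisting of the last $n-i+1$ rows and all $n$ columns. (1) (Strong law of large numbers) Suppose that for all $1\le i\le n$ the integer-valued random variable $|\mathrm{SN}(A_1^{(i)})|$ has a finite expectation $\mathbb{E}|\mathrm{SN}(A_1^{(i)})|$. Then, almost surely as $k\to\infty$, $$\Big(\frac{\lambda_1(k)}{k},\ldots,\frac{\lambda_n(k)}{k}\Big)\to\Big(\mathbb{E}|\mathrm{SN}(A_1^{(1)})|-\mathbb{E}|\mathrm{SN}(A_1^{(2)})|,\ldots,\mathbb{E}|\mathrm{SN}(A_1^{(n-1)})|-\mathbb{E}|\mathrm{SN}(A_1^{(n)})|,\ \mathbb{E}|\mathrm{SN}(A_1^{(n)})|\Big).$$ (2) (Central limit theorem) In addition, suppose that for all $1\le i\le n$ the random variable $|\mathrm{SN}(A_1^{(i)})|$ has a finite second moment. Then, as $k\to\infty$, the random vector $$\frac{\big(\lambda_1(k)-k\,\mathbb{E}|\mathrm{SN}(A_1^{(1)})|+k\,\mathbb{E}|\mathrm{SN}(A_1^{(2)})|,\ \ldots,\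 \lambda_{n-1}(k)-k\,\mathbb{E}|\mathrm{SN}(A_1^{(n-1)})|+k\,\mathbb{E}|\mathrm{SN}(A_1^{(n)})|,\ \lambda_n(k)-k\,\mathbb{E}|\mathrm{SN}(A_1^{(n)})|\big)}{\sqrt{k}}$$ converges weakly to the (possibly degenerate) centered Gaussian $N(0,L\Sigma L^T)$, where $L$ is the $n\times n$ matrix with $L_{i,i}=1$ for $1\le i\le n$, $L_{i,i+1}=-1$ for $1\le i\le n-1$, and all other entries $0$, and $\Sigma=\big(\mathrm{Cov}(|\mathrm{SN}(A_1^{(i)})|,|\mathrm{SN}(A_1^{(j)})|)\big)_{1\le i,j\le n}$.
   Context: For $n\le m$, a matrix $A\in\mathrm{Mat}_{n\times m}(\mathbb{Q}_p)$ is called nonsingular if it has rank $n$. By Cartan decomposition (Smith normal form), such an $A$ can be written $A=U\,\mathrm{diag}_{n\times m}(p^{\lambda_1},\ldots,p^{\lambda_n})V$ with $U\in\mathrm{GL}_n(\mathbb{Z}_p)$, $V\in\mathrm{GL}_m(\mathbb{Z}_p)$ and unique integers $\lambda_1\ge\cdots\ge\lambda_n$ (possibly negative). These are the singular numbers of $A$, written $\mathrm{SN}(A)=(\lambda_1,\ldots,\lambda_n)$. For an integer tuple $\lambda=(\lambda_1,\ldots,\lambda_n)$, $|\lambda|:=\lambda_1+\cdots+\lambda_n$ is its weight (a sum of signed integers, not an absolute value), so $|\mathrm{SN}(A_1^{(i)})|$ denotes the sum of the singular numbers of $A_1^{(i)}$. The entries of $A_1$ are not assumed independent. *)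

theory Defs
  imports
    "HOL-Probability.Probability"
    "HOL-Computational_Algebra.Fraction_Field"
    "Berlekamp_Zassenhaus.Finite_Field"
    "Jordan_Normal_Form.Matrix"
begin

unbundle no vec_syntax

section \<open>The p-adic integers\<close>

text \<open>
  The prime is the cardinality of a type of class \<^class>\<open>prime_card\<close>, so that the \<open>p\<close>-adic integers
  and the \<open>p\<close>-adic numbers are types of class \<^class>\<open>idom\<close> and \<^class>\<open>field\<close>.  The \<open>p\<close>-adic integers are
  the inverse limit of the rings \<open>\<int>/p\<^sup>n\<int>\<close>, a residue class being represented by its least
  nonnegative element (the condition below forces \<open>0 \<le> x n < p\<^sup>n\<close>).
\<close>

typedef ('p :: prime_card) padic_int =
  "{x :: nat \<Rightarrow> int. \<forall>n. x (Suc n) mod int CARD('p) ^ n = x n}"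
  by (rule exI[of _ "\<lambda>_. 0"]) simp

setup_lifting type_definition_padic_int

lemma prime_CARD: "prime (int CARD('p :: prime_card))"
  using prime_card[where 'a = 'p] by simp

lemma CARD_gt_1: "int CARD('p :: prime_card) > 1"
  using prime_CARD[where 'p = 'p] prime_gt_1_int by blast

lemma coherent_mod:
  assumes "\<forall>n. (x :: nat \<Rightarrow> int) (Suc n) mod q ^ n = x n"
  shows "x n mod q ^ n = x n"
  using assms by (metis mod_mod_trivial)

lemma coherent_mod_le:
  assumes x: "\<forall>n. (x :: nat \<Rightarrow> int) (Suc n) mod q ^ n = x n" and "m \<le> n"
  shows "x n mod q ^ m = x m"
  using \<open>m \<le> n\<close>
proof (induction n rule: dec_induct)
  case base
  then show ?case using coherent_mod[OF x] .
next
  case (step n)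
  have "x (Suc n) mod q ^ m = (x (Suc n) mod q ^ n) mod q ^ m"
    using step.hyps by (simp add: mod_mod_cancel le_imp_power_dvd)
  then show ?case using x step.IH by simp
qed

lemma coherentI:
  assumes "f (Suc n) mod (q :: int) ^ n = f n mod q ^ n"
  shows "(f (Suc n) mod q ^ Suc n) mod q ^ n = f n mod q ^ n"
  using assms by (simp add: mod_mod_cancel le_imp_power_dvd del: power_Suc)

instantiation padic_int :: (prime_card) comm_ring_1
begin

lift_definition zero_padic_int :: "'a padic_int" is "\<lambda>_. 0" by simp

lift_definition one_padic_int :: "'a padic_int" is "\<lambda>n. 1 mod int CARD('a) ^ n"
  by (rule coherentI) simp

lift_definition plus_padic_int :: "'a padic_int \<Rightarrow> 'a padic_int \<Rightarrow> 'a padic_int"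
  is "\<lambda>x y n. (x n + y n) mod int CARD('a) ^ n"
  by (rule coherentI) (metis mod_add_eq mod_mod_trivial)

lift_definition minus_padic_int :: "'a padic_int \<Rightarrow> 'a padic_int \<Rightarrow> 'a padic_int"
  is "\<lambda>x y n. (x n - y n) mod int CARD('a) ^ n"
  by (rule coherentI) (metis mod_diff_eq mod_mod_trivial)

lift_definition uminus_padic_int :: "'a padic_int \<Rightarrow> 'a padic_int"
  is "\<lambda>x n. (- x n) mod int CARD('a) ^ n"
  by (rule coherentI) (metis mod_minus_eq mod_mod_trivial)

lift_definition times_padic_int :: "'a padic_int \<Rightarrow> 'a padic_int \<Rightarrow> 'a padic_int"
  is "\<lambda>x y n. (x n * y n) mod int CARD('a) ^ n"
  by (rule coherentI) (metis mod_mult_eq mod_mod_trivial)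

instance
proof
  show "(0 :: 'a padic_int) \<noteq> 1"
  proof transfer
    have "(1 :: int) mod int CARD('a) ^ 1 = 1"
      using CARD_gt_1[where 'p = 'a] by simp
    then show "(\<lambda>_. 0) \<noteq> (\<lambda>n. 1 mod int CARD('a) ^ n)" by (metis zero_neq_one)
  qed
qed (transfer, auto simp: fun_eq_iff mod_simps algebra_simps coherent_mod)+

end

text \<open>
  \<open>padic_res x n\<close> is \<open>x mod p\<^sup>n\<close>; the valuation is the largest \<open>n\<close> with \<open>x \<equiv> 0 mod p\<^sup>n\<close>, and it
  is meaningful only for \<open>x \<noteq> 0\<close>.
\<close>

lift_definition padic_res :: "'p :: prime_card padic_int \<Rightarrow> nat \<Rightarrow> int" is "\<lambda>x. x" .

definition padic_int_val :: "'p :: prime_card padic_int \<Rightarrow> nat" where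
  "padic_int_val x = (LEAST n. padic_res x (Suc n) \<noteq> 0)"

definition padic_int_norm :: "'p :: prime_card padic_int \<Rightarrow> real" where
  "padic_int_norm x = (if x = 0 then 0 else 1 / real CARD('p) ^ padic_int_val x)"

lemma padic_res_mod_le:
  "m \<le> n \<Longrightarrow> padic_res (x :: 'p :: prime_card padic_int) n mod int CARD('p) ^ m = padic_res x m"
  by transfer (rule coherent_mod_le)

lemma padic_res_mult:
  "padic_res (x * y) n = (padic_res x n * padic_res y n) mod int CARD('p) ^ n"
  for x y :: "'p :: prime_card padic_int"
  by transfer simp

lemma padic_res_add:
  "padic_res (x + y) n = (padic_res x n + padic_res y n) mod int CARD('p) ^ n"
  for x y :: "'p :: prime_card padic_int"
  by transfer simp

lemma padic_res_uminus:
  "padic_res (- x) n = (- padic_res x n) mod int CARD('p) ^ n"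
  for x :: "'p :: prime_card padic_int"
  by transfer simp

lemma padic_res_zero [simp]: "padic_res 0 n = 0"
  by transfer simp

lemma padic_res_at_0 [simp]: "padic_res x 0 = 0"
  for x :: "'p :: prime_card padic_int"
  using padic_res_mod_le[of 0 0 x] by simp

lemma padic_res_eq_0_iff:
  assumes "x \<noteq> (0 :: 'p :: prime_card padic_int)"
  shows "padic_res x n = 0 \<longleftrightarrow> n \<le> padic_int_val x"
proof -
  have "\<exists>n. padic_res x n \<noteq> 0"
    using assms by transfer auto
  then obtain k where "padic_res x k \<noteq> 0" by blast
  then obtain m where "padic_res x (Suc m) \<noteq> 0" by (cases k) auto
  then have *: "padic_res x (Suc (padic_int_val x)) \<noteq> 0"
    unfolding padic_int_val_def by (rule LeastI)
  have mono: "padic_res x b \<noteq> 0" if "padic_res x a \<noteq> 0" "a \<le> b" for a b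
    using that padic_res_mod_le[of a b x] by auto
  show ?thesis
  proof
    assume "padic_res x n = 0"
    then show "n \<le> padic_int_val x" using mono[OF *, of n] by (meson not_less_eq_eq)
  next
    assume le: "n \<le> padic_int_val x"
    show "padic_res x n = 0"
    proof (cases n)
      case (Suc k)
      then have "k < (LEAST n. padic_res x (Suc n) \<noteq> 0)"
        using le unfolding padic_int_val_def by simp
      then show ?thesis using not_less_Least Suc by blast
    qed simp
  qed
qed

lemma padic_res_eq_0_iff_dvd:
  fixes x :: "'p :: prime_card padic_int"
  assumes "n \<le> N"
  shows "padic_res x n = 0 \<longleftrightarrow> int CARD('p) ^ n dvd padic_res x N"
  using padic_res_mod_le[OF assms, of x] by (simp add: mod_eq_0_iff_dvd[symmetric])

lemma padic_int_mult_nonzero_val: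
  fixes x y :: "'p :: prime_card padic_int"
  assumes "x \<noteq> 0" "y \<noteq> 0"
  shows "x * y \<noteq> 0 \<and> padic_int_val (x * y) = padic_int_val x + padic_int_val y"
proof -
  define p where "p = int CARD('p)"
  define a where "a = padic_int_val x"
  define b where "b = padic_int_val y"
  define N where "N = Suc (a + b)"
  define X where "X = padic_res x N"
  define Y where "Y = padic_res y N"
  have p: "prime p" unfolding p_def by (rule prime_CARD)
  have X: "p ^ n dvd X \<longleftrightarrow> n \<le> a" if "n \<le> N" for n
    using padic_res_eq_0_iff[OF assms(1), of n] padic_res_eq_0_iff_dvd[OF that, of x]
    by (simp add: p_def X_def a_def)
  have Y: "p ^ n dvd Y \<longleftrightarrow> n \<le> b" if "n \<le> N" for n
    using padic_res_eq_0_iff[OF assms(2), of n] padic_res_eq_0_iff_dvd[OF that, of y]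
    by (simp add: p_def Y_def b_def)
  obtain X' where X': "X = p ^ a * X'" using X[of a] by (auto simp: N_def)
  obtain Y' where Y': "Y = p ^ b * Y'" using Y[of b] by (auto simp: N_def)
  have p0: "p \<noteq> 0" using p by auto
  have nX: "\<not> p dvd X'" using X[of "Suc a"] p0 by (auto simp: N_def X')
  have nY: "\<not> p dvd Y'" using Y[of "Suc b"] p0 by (auto simp: N_def Y')
  have XY: "X * Y = p ^ (a + b) * (X' * Y')" by (simp add: X' Y' power_add)
  have "\<not> p dvd X' * Y'" using nX nY p prime_dvd_mult_iff by blast
  then have nd: "\<not> p ^ N dvd X * Y" using p0 by (simp add: XY N_def)
  have res: "padic_res (x * y) N = (X * Y) mod p ^ N"
    by (simp add: padic_res_mult X_def Y_def p_def)
  have nz: "padic_res (x * y) N \<noteq> 0" using nd res by (simp add: mod_eq_0_iff_dvd)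
  then have xy: "x * y \<noteq> 0" by auto
  have "padic_res (x * y) (a + b) = 0"
  proof -
    have "p ^ (a + b) dvd padic_res (x * y) N"
      unfolding res by (rule dvd_mod) (auto simp: N_def XY)
    then show ?thesis using padic_res_eq_0_iff_dvd[of "a + b" N "x * y"] by (simp add: N_def p_def)
  qed
  then have "a + b \<le> padic_int_val (x * y)" using padic_res_eq_0_iff[OF xy] by blast
  moreover have "\<not> N \<le> padic_int_val (x * y)" using padic_res_eq_0_iff[OF xy] nz by blast
  ultimately show ?thesis using xy by (simp add: N_def a_def b_def)
qed

instance padic_int :: (prime_card) idom
  by standard (use padic_int_mult_nonzero_val in blast)

lemma padic_int_norm_mult: "padic_int_norm (x * y) = padic_int_norm x * padic_int_norm y"
  by (auto simp: padic_int_norm_def padic_int_mult_nonzero_val power_add)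

lemma padic_int_norm_eq_0_iff [simp]: "padic_int_norm x = 0 \<longleftrightarrow> x = 0"
  for x :: "'p :: prime_card padic_int"
  using CARD_gt_1[where 'p = 'p] by (auto simp: padic_int_norm_def)

lemma padic_int_norm_nonneg: "padic_int_norm x \<ge> 0"
  by (simp add: padic_int_norm_def)

lemma padic_int_norm_pos: "x \<noteq> 0 \<Longrightarrow> padic_int_norm x > 0"
  for x :: "'p :: prime_card padic_int"
  using padic_int_norm_nonneg[of x] padic_int_norm_eq_0_iff[of x] by linarith

lemma padic_int_val_uminus: "padic_int_val (- x) = padic_int_val x"
  for x :: "'p :: prime_card padic_int"
proof -
  have "padic_res (- x) n = 0 \<longleftrightarrow> padic_res x n = 0" for n
    using padic_res_mod_le[of n n x]
    by (simp add: padic_res_uminus) (metis dvd_minus_iff mod_0_imp_dvd mod_eq_0_iff_dvd)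
  then show ?thesis by (simp add: padic_int_val_def)
qed

lemma padic_int_norm_uminus: "padic_int_norm (- x) = padic_int_norm x"
  by (simp add: padic_int_norm_def padic_int_val_uminus)

lemma padic_int_norm_add: "padic_int_norm (x + y) \<le> max (padic_int_norm x) (padic_int_norm y)"
  for x y :: "'p :: prime_card padic_int"
proof (cases "x = 0 \<or> y = 0 \<or> x + y = 0")
  case True
  then show ?thesis using padic_int_norm_nonneg[of x] padic_int_norm_nonneg[of y]
    by (auto simp: padic_int_norm_def le_max_iff_disj)
next
  case False
  define m where "m = min (padic_int_val x) (padic_int_val y)"
  have "padic_res x m = 0" "padic_res y m = 0"
    using False padic_res_eq_0_iff[of x m] padic_res_eq_0_iff[of y m] by (auto simp: m_def)
  then have "padic_res (x + y) m = 0" by (simp add: padic_res_add)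
  then have "m \<le> padic_int_val (x + y)" using False padic_res_eq_0_iff by blast
  then have "1 / real CARD('p) ^ padic_int_val (x + y) \<le> 1 / real CARD('p) ^ m"
    using CARD_gt_1[where 'p = 'p] by (intro divide_left_mono power_increasing) auto
  then show ?thesis using False
    by (cases "padic_int_val x \<le> padic_int_val y") (auto simp: padic_int_norm_def m_def)
qed


lifting_forget padic_int.lifting

section \<open>The field of p-adic numbers\<close>

text \<open>
  A type of its own rather than a synonym for the fraction field, so that it can carry the
  \<open>p\<close>-adic metric as an instance of \<^class>\<open>metric_space\<close>.
\<close>

typedef ('p :: prime_card) padic = "UNIV :: 'p padic_int fract set" ..

setup_lifting type_definition_padic

instantiation padic :: (prime_card) field
begin

lift_definition zero_padic :: "'a padic" is 0 .
lift_definition one_padic :: "'a padic" is 1 .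
lift_definition plus_padic :: "'a padic \<Rightarrow> 'a padic \<Rightarrow> 'a padic" is "(+)" .
lift_definition minus_padic :: "'a padic \<Rightarrow> 'a padic \<Rightarrow> 'a padic" is "(-)" .
lift_definition uminus_padic :: "'a padic \<Rightarrow> 'a padic" is uminus .
lift_definition times_padic :: "'a padic \<Rightarrow> 'a padic \<Rightarrow> 'a padic" is "(*)" .
lift_definition inverse_padic :: "'a padic \<Rightarrow> 'a padic" is inverse .
lift_definition divide_padic :: "'a padic \<Rightarrow> 'a padic \<Rightarrow> 'a padic" is "(/)" .

instance
  by standard (transfer, simp add: algebra_simps field_class.field_divide_inverse)+

end

lift_definition of_padic_int :: "'p :: prime_card padic_int \<Rightarrow> 'p padic" is "\<lambda>x. Fract x 1" .

definition fract_norm :: "'p :: prime_card padic_int fract \<Rightarrow> real" where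
  "fract_norm x =
     (THE r. \<exists>a b. b \<noteq> 0 \<and> x = Fract a b \<and> r = padic_int_norm a / padic_int_norm b)"

lemma fract_norm_Fract:
  fixes a b :: "'p :: prime_card padic_int"
  assumes "b \<noteq> 0"
  shows "fract_norm (Fract a b) = padic_int_norm a / padic_int_norm b"
  unfolding fract_norm_def
proof (rule the_equality)
  fix r
  assume "\<exists>c d. d \<noteq> 0 \<and> Fract a b = Fract c d \<and> r = padic_int_norm c / padic_int_norm d"
  then obtain c d where cd: "d \<noteq> 0" "a * d = c * b" "r = padic_int_norm c / padic_int_norm d"
    using assms by (auto simp: eq_fract)
  have "padic_int_norm a * padic_int_norm d = padic_int_norm c * padic_int_norm b"
    using cd by (simp add: padic_int_norm_mult[symmetric])
  then show "r = padic_int_norm a / padic_int_norm b"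
    using cd assms by (simp add: frac_eq_eq)
qed (use assms in blast)

lift_definition padic_norm :: "'p :: prime_card padic \<Rightarrow> real" is fract_norm .

lemma fract_norm_eq_0_iff: "fract_norm x = 0 \<longleftrightarrow> x = 0"
  by (cases x) (simp add: fract_norm_Fract Zero_fract_def eq_fract)

lemma fract_norm_nonneg: "fract_norm x \<ge> 0"
  by (cases x) (simp add: fract_norm_Fract padic_int_norm_nonneg)

lemma fract_norm_uminus: "fract_norm (- x) = fract_norm x"
  by (cases x) (simp add: fract_norm_Fract padic_int_norm_uminus)

lemma fract_norm_add: "fract_norm (x + y) \<le> max (fract_norm x) (fract_norm y)"
proof (cases x; cases y)
  fix a b c d :: "'a padic_int"
  assume x: "x = Fract a b" "b \<noteq> 0" and y: "y = Fract c d" "d \<noteq> 0"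
  have pos: "padic_int_norm b > 0" "padic_int_norm d > 0"
    using x y by (auto intro: padic_int_norm_pos)
  have "fract_norm (x + y) = padic_int_norm (a * d + c * b) / (padic_int_norm b * padic_int_norm d)"
    using x y by (simp add: fract_norm_Fract padic_int_norm_mult)
  also have "\<dots> \<le> max (padic_int_norm a * padic_int_norm d) (padic_int_norm c * padic_int_norm b)
      / (padic_int_norm b * padic_int_norm d)"
    using padic_int_norm_add[of "a * d" "c * b"] pos
    by (intro divide_right_mono) (auto simp: padic_int_norm_mult)
  also have "\<dots> = max (fract_norm x) (fract_norm y)"
    using pos x y by (simp add: fract_norm_Fract max_divide_distrib_right)
  finally show ?thesis .
qed

lemma padic_norm_eq_0_iff [simp]: "padic_norm x = 0 \<longleftrightarrow> x = 0"
  by transfer (rule fract_norm_eq_0_iff)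

lemma padic_norm_nonneg: "padic_norm x \<ge> 0"
  by transfer (rule fract_norm_nonneg)

lemma padic_norm_uminus: "padic_norm (- x) = padic_norm x"
  by transfer (rule fract_norm_uminus)

lemma padic_norm_add: "padic_norm (x + y) \<le> max (padic_norm x) (padic_norm y)"
  by transfer (rule fract_norm_add)

instantiation padic :: (prime_card) metric_space
begin

definition dist_padic :: "'a padic \<Rightarrow> 'a padic \<Rightarrow> real" where
  "dist_padic x y = padic_norm (x - y)"

definition uniformity_padic :: "('a padic \<times> 'a padic) filter" where
  "uniformity_padic = (INF e\<in>{0<..}. principal {(x, y). dist x y < e})"

definition open_padic :: "'a padic set \<Rightarrow> bool" where
  "open_padic U \<longleftrightarrow> (\<forall>x\<in>U. eventually (\<lambda>(x', y). x' = x \<longrightarrow> y \<in> U) uniformity)"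

instance
proof
  fix x y z :: "'a padic"
  show "dist x y = 0 \<longleftrightarrow> x = y" by (simp add: dist_padic_def)
  have "padic_norm ((x - z) + - (y - z)) \<le> max (padic_norm (x - z)) (padic_norm (y - z))"
    using padic_norm_add[of "x - z" "- (y - z)"] by (simp only: padic_norm_uminus)
  then show "dist x y \<le> dist x z + dist y z"
    using padic_norm_nonneg[of "x - z"] padic_norm_nonneg[of "y - z"]
    by (simp add: dist_padic_def)
qed (simp_all only: uniformity_padic_def open_padic_def)

end


section \<open>Matrices and singular numbers\<close>

definition GL :: "nat \<Rightarrow> 'a :: semiring_1 mat set" where
  "GL n = {A \<in> carrier_mat n n. invertible_mat A}"

text \<open>\<open>GL\<^sub>n(\<int>\<^sub>p)\<close> as a subgroup of \<open>GL\<^sub>n(\<rat>\<^sub>p)\<close>; invertibility is over \<open>\<int>\<^sub>p\<close>.\<close>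

definition GL_Zp :: "nat \<Rightarrow> 'p :: prime_card padic mat set" where
  "GL_Zp n = map_mat of_padic_int ` GL n"

definition diag_powers :: "nat \<Rightarrow> nat \<Rightarrow> int list \<Rightarrow> 'p :: prime_card padic mat" where
  "diag_powers n m ls =
     mat n m (\<lambda>(r, c). if r = c then of_nat CARD('p) powi (ls ! r) else 0)"

text \<open>
  For \<open>A\<close> of full row rank the list is unique (Smith normal form); on other matrices \<open>SN\<close> is
  unspecified.  Lists are indexed from 0: \<open>SN A ! i\<close> is the \<open>(i+1)\<close>-st singular number.
\<close>

definition is_SN :: "'p :: prime_card padic mat \<Rightarrow> int list \<Rightarrow> bool" where
  "is_SN A ls \<longleftrightarrow> length ls = dim_row A \<and> sorted_wrt (\<ge>) ls \<and>
     (\<exists>U \<in> GL_Zp (dim_row A). \<exists>V \<in> GL_Zp (dim_col A).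
        A = U * diag_powers (dim_row A) (dim_col A) ls * V)"

definition SN :: "'p :: prime_card padic mat \<Rightarrow> int list" where
  "SN A = (THE ls. is_SN A ls)"

definition drop_rows :: "nat \<Rightarrow> 'a mat \<Rightarrow> 'a mat" where
  "drop_rows i A = mat (dim_row A - i) (dim_col A) (\<lambda>(r, c). A $$ (r + i, c))"

text \<open>\<open>A 0 * \<dots> * A (k - 1)\<close> for \<open>n \<times> n\<close> matrices.\<close>

primrec mat_prod :: "nat \<Rightarrow> (nat \<Rightarrow> 'a :: semiring_1 mat) \<Rightarrow> nat \<Rightarrow> 'a mat" where
  "mat_prod n A 0 = 1\<^sub>m n"
| "mat_prod n A (Suc k) = mat_prod n A k * A k"


section \<open>Random matrices\<close>

text \<open>
  The Borel \<open>\<sigma>\<close>-algebra on the space of \<open>n \<times> m\<close> matrices: the product of the Borel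
  \<open>\<sigma>\<close>-algebras of the entries (\<open>\<rat>\<^sub>p\<close> is second countable).
\<close>

definition borel_mat :: "nat \<Rightarrow> nat \<Rightarrow> 'a :: topological_space mat measure" where
  "borel_mat n m = vimage_algebra (carrier_mat n m)
     (\<lambda>A. \<lambda>ij \<in> {..<n} \<times> {..<m}. A $$ ij) (Pi\<^sub>M ({..<n} \<times> {..<m}) (\<lambda>_. borel))"

definition borel_GL :: "nat \<Rightarrow> 'a :: {topological_space, semiring_1} mat measure" where
  "borel_GL n = restrict_space (borel_mat n n) (GL n)"

definition covariance :: "'w measure \<Rightarrow> ('w \<Rightarrow> real) \<Rightarrow> ('w \<Rightarrow> real) \<Rightarrow> real" where
  "covariance M X Y =
     (\<integral>\<omega>. (X \<omega> - (\<integral>\<omega>. X \<omega> \<partial>M)) * (Y \<omega> - (\<integral>\<omega>. Y \<omega> \<partial>M)) \<partial>M)"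


section \<open>Weak convergence and Gaussian measures on Euclidean space\<close>

text \<open>\<open>\<real>\<^sup>n\<close> is the set of extensional functions on \<open>{..<n}\<close>.\<close>

abbreviation borel_Rn :: "nat \<Rightarrow> (nat \<Rightarrow> real) measure" where
  "borel_Rn n \<equiv> Pi\<^sub>M {..<n} (\<lambda>_. borel)"

abbreviation top_Rn :: "nat \<Rightarrow> (nat \<Rightarrow> real) topology" where
  "top_Rn n \<equiv> product_topology (\<lambda>_. euclideanreal) {..<n}"

definition weakly_converges ::
  "'a topology \<Rightarrow> (nat \<Rightarrow> 'a measure) \<Rightarrow> 'a measure \<Rightarrow> bool" where
  "weakly_converges T \<mu> \<nu> \<longleftrightarrow>
     (\<forall>f. continuous_map T euclideanreal f \<and> bounded (f ` topspace T) \<longrightarrow>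
        (\<lambda>k. \<integral>x. f x \<partial>\<mu> k) \<longlonglongrightarrow> (\<integral>x. f x \<partial>\<nu>))"

text \<open>The law \<open>N(0, v)\<close> on \<open>\<real>\<close>, which for \<open>v = 0\<close> is the point mass at 0.\<close>

definition normal_law :: "real \<Rightarrow> real measure" where
  "normal_law v = (if v = 0 then return borel 0 else density lborel (normal_density 0 (sqrt v)))"

text \<open>
  The possibly degenerate Gaussian \<open>N(0, C)\<close> on \<open>\<real>\<^sup>n\<close>: every linear functional \<open>t\<close> has law
  \<open>N(0, t C t\<^sup>T)\<close>.  This determines the measure (Cramer-Wold).
\<close>

definition is_centered_gaussian :: "nat \<Rightarrow> real mat \<Rightarrow> (nat \<Rightarrow> real) measure \<Rightarrow> bool" where
  "is_centered_gaussian n C \<nu> \<longleftrightarrow> prob_space \<nu> \<and> sets \<nu> = sets (borel_Rn n) \<and>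
     (\<forall>t :: nat \<Rightarrow> real.
        distr \<nu> borel (\<lambda>x. \<Sum>i<n. t i * x i)
        = normal_law (\<Sum>i<n. \<Sum>j<n. t i * C $$ (i, j) * t j))"

definition L_mat :: "nat \<Rightarrow> real mat" where
  "L_mat n = mat n n (\<lambda>(i, j). if i = j then 1 else if j = Suc i then - 1 else 0)"

end

theory Submission
  imports
    Defs
    "Jordan_Normal_Form.Determinant"
    "HOL-Real_Asymp.Real_Asymp"
begin

text \<open>
  Write the value of \<open>A\<close> at \<open>i\<close> for the sum of the singular numbers of \<open>A\<close> without its first \<open>i\<close>
  rows.  If \<open>B = T V\<close> with \<open>T\<close> upper triangular and \<open>V \<in> GL\<^sub>n(\<int>\<^sub>p)\<close>, then passing from \<open>B\<close> to \<open>B A\<close>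
  increases all these values at once by those of \<open>V A\<close>, which has the law of \<open>A\<close>.  Hence the vector of
  values of \<open>A\<^sub>1 \<dots> A\<^sub>k\<close> is exactly a random walk whose steps have the law of the values of
  \<open>A\<^sub>1\<close>, and the law of large numbers and the central limit theorem apply to it.  The values bound the
  sums of the smallest singular numbers from above; by left invariance, averaging over the matrices
  congruent to the identity modulo \<open>p\<close>, the difference has exponential tails uniformly in \<open>k\<close>, so it
  is negligible on both scales.  The vector-valued central limit theorem follows from the scalar one
  through trigonometric polynomials.
\<close>

section \<open>The p-adic absolute value\<close>

text \<open>Single singular numbers do not add up under products, and tail sums in general only
  satisfy an inequality. The volume of the last rows behaves better: an upper triangular
  \<open>T\<close> produces the last rows of \<open>T * X\<close> from those of \<open>X\<close>
  through a square block, whose determinant splits off. The factor \<open>V\<close> depends on the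
  whole past, so independence of the increments is not inherited directly from the matrices; it
  holds because the conditional law of an increment given the past is constant. All valuations are
  expressed by maxima of norms of determinants over finitely many matrices of digits modulo
  \<open>p\<close>. An error divisible by \<open>p\<close> cannot destroy a determinant of maximal
  norm, so these maxima equal the suprema over integral matrices, and attainment, uniqueness and
  measurability come without choosing a factorisation. Haar measure is avoided as well: a finite
  sample of the congruence subgroup turns the tail estimate into counting, with probability at most
  \<open>q / p ^ t\<close> for a deviation above \<open>q * (t + 1)\<close>.\<close>

lemma padic_int_eqI: "(\<And>n. padic_res x n = padic_res y n) \<Longrightarrow> x = y"
  by (metis Rep_padic_int_inject ext padic_res.rep_eq)

lemma padic_int_of_coherent:
  assumes "\<And>n. f (Suc n) mod int CARD('p) ^ n = f n"
  shows "\<exists>x :: 'p :: prime_card padic_int. \<forall>n. padic_res x n = f n"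
  by (rule exI[of _ "Abs_padic_int f"])
    (use assms in \<open>simp add: padic_res.rep_eq Abs_padic_int_inverse\<close>)

lemma padic_res_one: "padic_res (1 :: 'p :: prime_card padic_int) n = 1 mod int CARD('p) ^ n"
  by (simp add: padic_res.rep_eq one_padic_int.rep_eq)

lemma padic_res_of_nat:
  "padic_res (of_nat c :: 'p :: prime_card padic_int) n = int c mod int CARD('p) ^ n"
  by (induction c) (auto simp: padic_res_one padic_res_add mod_simps)

lemma padic_res_of_int:
  "padic_res (of_int c :: 'p :: prime_card padic_int) n = c mod int CARD('p) ^ n"
  by (cases c) (auto simp: padic_res_of_nat padic_res_uminus mod_simps simp del: of_nat_Suc)

lemma padic_res_diff:
  "padic_res (x - y) n = (padic_res x n - padic_res y n) mod int CARD('p) ^ n"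
  for x y :: "'p :: prime_card padic_int"
  unfolding diff_conv_add_uminus padic_res_add padic_res_uminus by (simp add: mod_simps)

text \<open>A nonzero residue modulo \<open>p\<close> makes every residue modulo
  \<open>p ^ n\<close> with \<open>n \<ge> 1\<close> a unit. Inverses modulo \<open>p ^ n\<close>
  are unique, so each one reduces to its predecessor, and the sequence glues to an element of the
  inverse limit.\<close>

lemma padic_int_unit:
  fixes x :: "'p :: prime_card padic_int"
  assumes "padic_res x 1 \<noteq> 0"
  shows "\<exists>y. x * y = 1"
proof -
  define p where "p = int CARD('p)"
  have p: "prime p" unfolding p_def by (rule prime_CARD)
  have cop: "coprime (padic_res x n) (p ^ n)" for n
  proof (cases n)
    case (Suc k)
    have "\<not> p dvd padic_res x n"
      using assms padic_res_eq_0_iff_dvd[of 1 n x] Suc by (simp add: p_def)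
    then show ?thesis
      by (metis p prime_imp_coprime coprime_commute coprime_power_left_iff)
  qed simp
  have "\<exists>y. [padic_res x n * y = 1] (mod p ^ n)" for n
    using cop cong_solve_coprime_int by blast
  then obtain g where g: "\<And>n. [padic_res x n * g n = 1] (mod p ^ n)" by metis
  define f where "f n = g n mod p ^ n" for n
  have fx: "[padic_res x n * f n = 1] (mod p ^ n)" for n
    using g[of n] unfolding f_def cong_def by (simp add: mod_simps)
  have "f (Suc n) mod p ^ n = f n" for n
  proof -
    have "[padic_res x (Suc n) * f (Suc n) = 1] (mod p ^ n)"
      using fx[of "Suc n"] by (rule cong_dvd_modulus) (simp add: le_imp_power_dvd)
    moreover have "[padic_res x n = padic_res x (Suc n)] (mod p ^ n)"
      using padic_res_mod_le[of n "Suc n" x] padic_res_mod_le[of n n x]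
      unfolding cong_def p_def by simp
    ultimately have "[padic_res x n * f (Suc n) = 1] (mod p ^ n)"
      by (meson cong_scalar_right cong_trans)
    then have "[padic_res x n * f (Suc n) = padic_res x n * f n] (mod p ^ n)"
      using fx[of n] cong_sym cong_trans by blast
    then have "[f (Suc n) = f n] (mod p ^ n)"
      using cop[of n] cong_mult_lcancel by blast
    then show ?thesis by (simp add: cong_def f_def)
  qed
  then obtain y :: "'p padic_int" where y: "\<And>n. padic_res y n = f n"
    using padic_int_of_coherent[of f] unfolding p_def by metis
  have "x * y = 1"
    by (rule padic_int_eqI) (use fx in \<open>simp add: padic_res_mult padic_res_one y cong_def p_def\<close>)
  then show ?thesis by blast
qed

text \<open>The unit part is read off \<open>v\<close> levels higher: the residue at level
  \<open>n + v\<close> is divisible by \<open>p ^ v\<close>, and the quotient is well defined modulo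
  \<open>p ^ n\<close>. Its first residue is nonzero because \<open>v\<close> is the exact
  valuation.\<close>

lemma padic_int_val_decomp:
  fixes x :: "'p :: prime_card padic_int"
  assumes "x \<noteq> 0"
  shows "\<exists>u w. x = of_nat CARD('p) ^ padic_int_val x * u \<and> u * w = 1"
proof -
  define p where "p = int CARD('p)"
  define v where "v = padic_int_val x"
  have p: "prime p" unfolding p_def by (rule prime_CARD)
  have p0: "p > 0" using prime_gt_0_int[OF p] .
  define f where "f n = padic_res x (n + v) div p ^ v" for n
  have dvd: "p ^ v dvd padic_res x (n + v)" for n
    using padic_res_eq_0_iff_dvd[of v "n + v" x] padic_res_eq_0_iff[OF assms, of v]
    by (simp add: v_def p_def)
  have res: "padic_res x (n + v) = p ^ v * f n" for n
    using dvd[of n] by (simp add: f_def)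
  have "f (Suc n) mod p ^ n = f n" for n
  proof -
    have "padic_res x (Suc n + v) mod p ^ (n + v) = padic_res x (n + v)"
      using padic_res_mod_le[of "n + v" "Suc n + v" x] by (simp add: p_def)
    then have "(p ^ v * f (Suc n)) mod (p ^ v * p ^ n) = p ^ v * f n"
      unfolding res by (simp add: power_add mult.commute)
    then show ?thesis using p0 by (simp add: mult_mod_right[symmetric])
  qed
  then obtain u :: "'p padic_int" where u: "\<And>n. padic_res u n = f n"
    using padic_int_of_coherent[of f] unfolding p_def by metis
  have xu: "x = of_nat CARD('p) ^ v * u"
  proof (rule padic_int_eqI)
    fix n
    have "padic_res x n = padic_res x (n + v) mod p ^ n"
      using padic_res_mod_le[of n "n + v" x] by (simp add: p_def)
    also have "\<dots> = (p ^ v * f n) mod p ^ n" by (simp add: res)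
    also have "\<dots> = padic_res (of_nat (CARD('p) ^ v) * u) n"
      unfolding padic_res_mult padic_res_of_nat u by (simp add: p_def mod_simps)
    finally show "padic_res x n = padic_res (of_nat CARD('p) ^ v * u) n" by simp
  qed
  have "padic_res u 1 \<noteq> 0"
  proof
    assume "padic_res u 1 = 0"
    then have "padic_res x (Suc v) = 0" using res[of 1] by (simp add: u)
    then show False using padic_res_eq_0_iff[OF assms, of "Suc v"] by (simp add: v_def)
  qed
  then show ?thesis using padic_int_unit[of u] xu unfolding v_def by blast
qed

section \<open>Multiplicativity, ultrametric inequality and unit ball of the norm\<close>

lemma padic_norm_mult: "padic_norm (x * y) = padic_norm x * padic_norm y"
proof -
  have "fract_norm (a * b) = fract_norm a * fract_norm b" for a b :: "'a padic_int fract"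
    by (cases a; cases b) (simp add: fract_norm_Fract padic_int_norm_mult)
  then show ?thesis by transfer
qed

lemma padic_norm_zero [simp]: "padic_norm 0 = 0"
  by simp

lemma of_padic_int_hom: "comm_ring_hom (of_padic_int :: 'p :: prime_card padic_int \<Rightarrow> 'p padic)"
  by unfold_locales (transfer, simp add: Zero_fract_def One_fract_def)+

interpretation of_padic_int: comm_ring_hom "of_padic_int :: 'p :: prime_card padic_int \<Rightarrow> 'p padic"
  by (rule of_padic_int_hom)

lemma padic_int_norm_one [simp]: "padic_int_norm 1 = 1"
proof -
  have "padic_int_norm (1 :: 'a padic_int) * padic_int_norm (1 :: 'a padic_int) = padic_int_norm (1 :: 'a padic_int)"
    by (simp flip: padic_int_norm_mult)
  moreover have "padic_int_norm (1 :: 'a padic_int) \<noteq> 0" by simp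
  ultimately show ?thesis by (metis mult_cancel_right1)
qed

lemma padic_norm_of_padic_int: "padic_norm (of_padic_int x) = padic_int_norm x"
  by transfer (simp add: fract_norm_Fract)

lemma padic_norm_one [simp]: "padic_norm 1 = 1"
  using padic_norm_of_padic_int[of 1] by (metis of_padic_int.hom_one padic_int_norm_one)

lemma padic_int_norm_le_1: "padic_int_norm (x :: 'p :: prime_card padic_int) \<le> 1"
  using CARD_gt_1[where 'p = 'p] by (auto simp: padic_int_norm_def)

lemma padic_int_norm_le_iff:
  "padic_int_norm (x :: 'p :: prime_card padic_int) \<le> 1 / real CARD('p) ^ n \<longleftrightarrow> padic_res x n = 0"
proof (cases "x = 0")
  case False
  have p: "real CARD('p) > 1" using CARD_gt_1[where 'p = 'p] by linarith
  have "1 / real CARD('p) ^ padic_int_val x \<le> 1 / real CARD('p) ^ n \<longleftrightarrow> n \<le> padic_int_val x"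
    using p by (simp add: field_simps power_increasing_iff)
  with False padic_res_eq_0_iff[OF False, of n] show ?thesis
    by (simp add: padic_int_norm_def)
qed (simp add: padic_int_norm_def)

lemma of_padic_int_eq_iff: "of_padic_int x = of_padic_int y \<longleftrightarrow> x = y"
  by transfer (simp add: eq_fract)

lemma padic_norm_of_nat_CARD: "padic_norm (of_nat CARD('p) :: 'p :: prime_card padic) = 1 / real CARD('p)"
proof -
  define x :: "'p padic_int" where "x = of_nat CARD('p)"
  have "1 < int CARD('p)" by (rule CARD_gt_1)
  then have c: "int CARD('p) mod int CARD('p) ^ 2 \<noteq> 0"
    by (simp add: power2_eq_square)
  have "padic_res x 1 = 0" "padic_res x 2 \<noteq> 0"
    unfolding x_def padic_res_of_nat using c by auto
  moreover have "x \<noteq> 0" using \<open>padic_res x 2 \<noteq> 0\<close> by auto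
  ultimately have "padic_int_val x = 1"
    using padic_res_eq_0_iff[of x 1] padic_res_eq_0_iff[of x 2] by auto
  then have "padic_int_norm x = 1 / real CARD('p)"
    using \<open>x \<noteq> 0\<close> by (simp add: padic_int_norm_def)
  moreover have "of_padic_int x = of_nat CARD('p)"
    unfolding x_def by (rule of_padic_int.hom_of_nat)
  ultimately show ?thesis by (metis padic_norm_of_padic_int)
qed

lemma padic_norm_inverse: "padic_norm (inverse x) = inverse (padic_norm x)"
proof (cases "x = 0")
  case False
  then have "padic_norm x * padic_norm (inverse x) = 1"
    by (simp flip: padic_norm_mult)
  then show ?thesis by (metis inverse_unique)
qed simp

lemma padic_norm_divide: "padic_norm (x / y) = padic_norm x / padic_norm y"
  by (simp add: divide_inverse padic_norm_mult padic_norm_inverse)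

lemma padic_norm_power: "padic_norm (x ^ n) = padic_norm x ^ n"
  by (induction n) (auto simp: padic_norm_mult)

lemma padic_norm_powi: "padic_norm (x powi n) = padic_norm x powi n"
  by (auto simp: power_int_def padic_norm_power padic_norm_inverse)

lemma padic_norm_prod: "padic_norm (prod f A) = (\<Prod>i\<in>A. padic_norm (f i))"
  by (induction A rule: infinite_finite_induct) (auto simp: padic_norm_mult)

lemma padic_norm_pos: "x \<noteq> 0 \<Longrightarrow> padic_norm x > 0"
  using padic_norm_nonneg[of x] padic_norm_eq_0_iff[of x] by linarith

lemma padic_norm_pos_iff: "padic_norm x > 0 \<longleftrightarrow> x \<noteq> 0"
  using padic_norm_pos[of x] by auto

lemma padic_norm_diff: "padic_norm (x - y) \<le> max (padic_norm x) (padic_norm y)"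
  using padic_norm_add[of x "- y"] by (simp add: padic_norm_uminus)

lemma padic_norm_sum_le:
  "(\<And>i. i \<in> A \<Longrightarrow> padic_norm (f i) \<le> c) \<Longrightarrow> 0 \<le> c \<Longrightarrow> padic_norm (sum f A) \<le> c"
proof (induction A rule: infinite_finite_induct)
  case (insert x A)
  then show ?case using padic_norm_add[of "f x" "sum f A"] by fastforce
qed auto

text \<open>A term of smaller norm cannot change the norm of a sum, since
  \<open>x = (x + y) - y\<close>. This is what allows matrices to be rounded without changing the
  valuation of a determinant.\<close>

lemma padic_norm_add_eq:
  assumes "padic_norm y < padic_norm x"
  shows "padic_norm (x + y) = padic_norm x"
  using padic_norm_add[of x y] padic_norm_diff[of "x + y" y] assms by simp

lemma padic_eq_quotient:
  "\<exists>a b. b \<noteq> 0 \<and> (x :: 'p :: prime_card padic) = of_padic_int a / of_padic_int b"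
proof (cases "Rep_padic x")
  case (Fract a b)
  then have "Rep_padic x = Rep_padic (of_padic_int a / of_padic_int b)"
    by (simp add: divide_padic.rep_eq of_padic_int.rep_eq)
  then show ?thesis using Fract by (metis Rep_padic_inject)
qed

text \<open>In a quotient \<open>a / b\<close> the powers of \<open>p\<close> are split off. Norm at
  most 1 says that the exponent of \<open>b\<close> does not exceed that of \<open>a\<close>, so
  what remains is a power of \<open>p\<close> times a unit; \<open>w'\<close> is the inverse of the
  unit part of \<open>b\<close>.\<close>

lemma padic_norm_le_1_iff:
  "padic_norm (x :: 'p :: prime_card padic) \<le> 1 \<longleftrightarrow> x \<in> range of_padic_int"
proof
  assume le: "padic_norm x \<le> 1"
  obtain a b :: "'p padic_int" where ab: "b \<noteq> 0" "x = of_padic_int a / of_padic_int b"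
    using padic_eq_quotient by blast
  show "x \<in> range of_padic_int"
  proof (cases "a = 0")
    case True
    then have "x = of_padic_int 0" using ab by simp
    then show ?thesis by blast
  next
    case False
    have p: "real CARD('p) > 1" using CARD_gt_1[where 'p = 'p] by linarith
    obtain u w where u: "a = of_nat CARD('p) ^ padic_int_val a * u" "u * w = 1"
      using padic_int_val_decomp[OF False] by blast
    obtain u' w' where u': "b = of_nat CARD('p) ^ padic_int_val b * u'" "u' * w' = 1"
      using padic_int_val_decomp[OF ab(1)] by blast
    have "padic_int_norm a / padic_int_norm b \<le> 1"
      using le unfolding ab padic_norm_divide padic_norm_of_padic_int .
    then have "padic_int_norm a \<le> padic_int_norm b"
      using padic_int_norm_pos[OF ab(1)] by simp
    then have "padic_int_val b \<le> padic_int_val a"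
      using p False ab(1) by (simp add: padic_int_norm_def field_simps)
    then have "b * (of_nat CARD('p) ^ (padic_int_val a - padic_int_val b) * u * w') =
        of_nat CARD('p) ^ padic_int_val a * u * (u' * w')"
      by (subst (1) u'(1)) (simp add: mult.assoc mult.left_commute flip: power_add)
    then have "b * (of_nat CARD('p) ^ (padic_int_val a - padic_int_val b) * u * w') = a"
      using u u'(2) by simp
    then obtain c where "b * c = a" by blast
    then have "of_padic_int a = of_padic_int c * of_padic_int b"
      by (metis of_padic_int.hom_mult mult.commute)
    moreover have "of_padic_int b \<noteq> 0" using ab(1) of_padic_int_eq_iff[of b 0] by simp
    ultimately have "x = of_padic_int c" unfolding ab by simp
    then show ?thesis by blast
  qed
qed (auto simp: padic_norm_of_padic_int padic_int_norm_le_1)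

lemma padic_norm_of_int_le_1: "padic_norm (of_int c) \<le> 1"
  unfolding padic_norm_le_1_iff by (metis of_padic_int.hom_of_int rangeI)

lemma padic_norm_of_nat_le_1: "padic_norm (of_nat c) \<le> 1"
  using padic_norm_of_int_le_1[of "int c"] by simp

text \<open>The counting argument uses this to turn a norm bound on a difference of two parameters
  into divisibility, and from there into equality.\<close>

lemma padic_norm_of_int_le_iff:
  "padic_norm (of_int c :: 'p :: prime_card padic) \<le> 1 / real CARD('p) ^ n \<longleftrightarrow> int CARD('p) ^ n dvd c"
proof -
  have "padic_norm (of_int c :: 'p padic) = padic_int_norm (of_int c :: 'p padic_int)"
    by (metis of_padic_int.hom_of_int padic_norm_of_padic_int)
  then show ?thesis
    by (simp add: padic_int_norm_le_iff padic_res_of_int mod_eq_0_iff_dvd)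
qed

text \<open>The approximation is the residue at level \<open>n\<close>. For \<open>n = 1\<close> it
  supplies the digits of the finite test matrices, for large \<open>n\<close> the density needed for
  second countability.\<close>

lemma padic_approx_nat:
  assumes "padic_norm (x :: 'p :: prime_card padic) \<le> 1"
  shows "\<exists>c < CARD('p) ^ n. padic_norm (x - of_nat c) \<le> 1 / real CARD('p) ^ n"
proof -
  obtain y where y: "x = of_padic_int y" using assms unfolding padic_norm_le_1_iff by blast
  have p: "int CARD('p) ^ n > 0" using CARD_gt_1[where 'p = 'p] by simp
  define r where "r = padic_res y n"
  have r: "r mod int CARD('p) ^ n = r" unfolding r_def by (rule padic_res_mod_le) simp
  then have r0: "0 \<le> r" "r < int CARD('p) ^ n"
    by (metis p pos_mod_sign, metis p pos_mod_bound)
  have "padic_res (y - of_nat (nat r)) n = 0"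
    unfolding padic_res_diff padic_res_of_nat using r0 r by (simp add: r_def)
  then have "padic_norm (x - of_nat (nat r)) \<le> 1 / real CARD('p) ^ n"
    unfolding y by (metis padic_int_norm_le_iff padic_norm_of_padic_int of_padic_int.hom_minus of_padic_int.hom_of_nat)
  moreover have "nat r < CARD('p) ^ n" using r0 by (simp add: nat_less_iff)
  ultimately show ?thesis by blast
qed

lemma padic_norm_values:
  assumes "(x :: 'p :: prime_card padic) \<noteq> 0"
  shows "\<exists>z :: int. padic_norm x = real CARD('p) powi z"
proof -
  obtain a b :: "'p padic_int" where ab: "b \<noteq> 0" "x = of_padic_int a / of_padic_int b"
    using padic_eq_quotient by blast
  have p: "real CARD('p) \<noteq> 0" using CARD_gt_1[where 'p = 'p] by linarith
  have a: "a \<noteq> 0" using assms ab by auto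
  have "padic_norm x = real CARD('p) ^ padic_int_val b / real CARD('p) ^ padic_int_val a"
    using a ab by (simp add: padic_norm_divide padic_norm_of_padic_int padic_int_norm_def)
  also have "\<dots> = real CARD('p) powi (int (padic_int_val b) - int (padic_int_val a))"
    using p by (simp add: power_int_diff)
  finally show ?thesis by blast
qed

section \<open>Integral matrices and unimodular matrices\<close>

text \<open>Integrality is phrased by norms inside the field; by \<open>padic_norm_le_1_iff\<close>
  the entries are exactly the images of p-adic integers. Ultrametric estimates then apply without
  transporting matrices between two types.\<close>

definition integral_mat :: "'p :: prime_card padic mat \<Rightarrow> bool" where
  "integral_mat X \<longleftrightarrow> (\<forall>i<dim_row X. \<forall>j<dim_col X. padic_norm (X $$ (i, j)) \<le> 1)"

lemma integral_matD:
  "integral_mat X \<Longrightarrow> i < dim_row X \<Longrightarrow> j < dim_col X \<Longrightarrow> padic_norm (X $$ (i, j)) \<le> 1"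
  by (simp add: integral_mat_def)

lemma padic_norm_mult_le_1:
  "padic_norm x \<le> 1 \<Longrightarrow> padic_norm y \<le> 1 \<Longrightarrow> padic_norm (x * y) \<le> 1"
  by (simp add: padic_norm_mult mult_le_one padic_norm_nonneg)

lemma index_mult_mat_sum:
  "A \<in> carrier_mat n m \<Longrightarrow> B \<in> carrier_mat m l \<Longrightarrow> i < n \<Longrightarrow> j < l \<Longrightarrow>
    (A * B) $$ (i, j) = (\<Sum>k<m. A $$ (i, k) * B $$ (k, j))"
  by (auto simp: scalar_prod_def lessThan_atLeast0 intro!: sum.cong)

lemma integral_mat_mult:
  assumes "A \<in> carrier_mat n m" "B \<in> carrier_mat m l" "integral_mat A" "integral_mat B"
  shows "integral_mat (A * B)"
  unfolding integral_mat_def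
proof (intro allI impI)
  fix i j
  assume ij: "i < dim_row (A * B)" "j < dim_col (A * B)"
  have "(A * B) $$ (i, j) = (\<Sum>k<m. A $$ (i, k) * B $$ (k, j))"
    using assms ij by (intro index_mult_mat_sum) auto
  moreover have "padic_norm (\<Sum>k<m. A $$ (i, k) * B $$ (k, j)) \<le> 1"
    using assms ij by (intro padic_norm_sum_le padic_norm_mult_le_1 integral_matD) auto
  ultimately show "padic_norm ((A * B) $$ (i, j)) \<le> 1" by simp
qed

lemma integral_mat_one [simp]: "integral_mat (1\<^sub>m n)"
  by (auto simp: integral_mat_def)

section \<open>Determinants of integral matrices are 1-Lipschitz\<close>

lemma padic_norm_signof [simp]: "padic_norm (of_int (sign p)) = 1"
  by (auto simp: sign_def padic_norm_uminus)

lemma permutes_less: "p permutes {0..<n} \<Longrightarrow> i < n \<Longrightarrow> p i < n" for i n :: nat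
  using permutes_in_image[of p "{0..<n}" i] by simp

lemma padic_norm_det_le_1:
  assumes "A \<in> carrier_mat n n" "integral_mat A"
  shows "padic_norm (det A) \<le> 1"
  unfolding det_def'[OF assms(1)]
  by (intro padic_norm_sum_le padic_norm_mult_le_1)
     (use assms in \<open>auto simp: padic_norm_prod padic_norm_nonneg permutes_less
        intro!: prod_le_1 integral_matD\<close>)

text \<open>Factors are exchanged one at a time: each exchange contributes a difference of norm at
  most \<open>r\<close> times integral factors, and the ultrametric inequality does not accumulate
  the errors.\<close>

lemma padic_norm_prod_diff_le:
  assumes "\<And>i. i \<in> A \<Longrightarrow> padic_norm (f i) \<le> 1" "\<And>i. i \<in> A \<Longrightarrow> padic_norm (g i) \<le> 1"
    and "\<And>i. i \<in> A \<Longrightarrow> padic_norm (f i - g i) \<le> r" "0 \<le> r"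
  shows "padic_norm (prod f A - prod g A) \<le> r"
  using assms
proof (induction A rule: infinite_finite_induct)
  case (insert x A)
  have "prod f (insert x A) - prod g (insert x A) =
      f x * (prod f A - prod g A) + (f x - g x) * prod g A"
    using insert by (simp add: algebra_simps)
  moreover have "padic_norm (f x * (prod f A - prod g A)) \<le> 1 * r"
    unfolding padic_norm_mult using insert by (intro mult_mono) (auto simp: padic_norm_nonneg)
  moreover have "padic_norm ((f x - g x) * prod g A) \<le> r * 1"
    unfolding padic_norm_mult padic_norm_prod using insert
    by (intro mult_mono prod_le_1) (auto simp: padic_norm_nonneg prod_nonneg)
  ultimately show ?case 
    using padic_norm_add[of "f x * (prod f A - prod g A)" "(f x - g x) * prod g A"] by simp
qed auto

lemma padic_norm_mult_diff_le:
  assumes "padic_norm a \<le> 1" "padic_norm b' \<le> 1" "padic_norm (a - a') \<le> r" "padic_norm (b - b') \<le> r"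
  shows "padic_norm (a * b - a' * b') \<le> r"
proof -
  have r: "0 \<le> r" using padic_norm_nonneg assms(3) order_trans by blast
  have "a * b - a' * b' = a * (b - b') + (a - a') * b'" by (simp add: algebra_simps)
  moreover have "padic_norm (a * (b - b')) \<le> 1 * r"
    unfolding padic_norm_mult using assms by (intro mult_mono) (auto simp: padic_norm_nonneg)
  moreover have "padic_norm ((a - a') * b') \<le> r * 1"
    unfolding padic_norm_mult using assms r by (intro mult_mono) (auto simp: padic_norm_nonneg)
  ultimately show ?thesis using padic_norm_add[of "a * (b - b')" "(a - a') * b'"] by simp
qed

text \<open>In the Leibniz formula every signed product moves by at most \<open>r\<close>, and the
  number of terms is irrelevant for an ultrametric norm.\<close>

lemma padic_norm_det_diff_le:
  assumes A: "A \<in> carrier_mat n n" "integral_mat A" and B: "B \<in> carrier_mat n n" "integral_mat B"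
    and diff: "\<And>i j. i < n \<Longrightarrow> j < n \<Longrightarrow> padic_norm (A $$ (i, j) - B $$ (i, j)) \<le> r" and "0 \<le> r"
  shows "padic_norm (det A - det B) \<le> r"
proof -
  have "padic_norm (signof p * (\<Prod>i = 0..<n. A $$ (i, p i)) - signof p * (\<Prod>i = 0..<n. B $$ (i, p i))) \<le> r"
    if p: "p permutes {0..<n}" for p
  proof -
    have "padic_norm (signof p * ((\<Prod>i = 0..<n. A $$ (i, p i)) - (\<Prod>i = 0..<n. B $$ (i, p i)))) =
        padic_norm ((\<Prod>i = 0..<n. A $$ (i, p i)) - (\<Prod>i = 0..<n. B $$ (i, p i)))"
      by (simp add: padic_norm_mult)
    also have "\<dots> \<le> r"
      using assms p by (intro padic_norm_prod_diff_le) (auto intro!: integral_matD simp: permutes_less)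
    finally show ?thesis by (simp add: right_diff_distrib)
  qed
  then show ?thesis
    unfolding det_def'[OF A(1)] det_def'[OF B(1)] sum_subtractf[symmetric]
    using \<open>0 \<le> r\<close> by (intro padic_norm_sum_le) auto
qed

lemma padic_norm_le_1_eq_1:
  "padic_norm x \<le> 1 \<Longrightarrow> padic_norm y \<le> 1 \<Longrightarrow> x * y = 1 \<Longrightarrow> padic_norm x = 1"
  by (metis dual_order.antisym mult.right_neutral mult_left_mono padic_norm_mult padic_norm_nonneg padic_norm_one)

lemma invertible_mat_padic_int:
  fixes G :: "'p :: prime_card padic_int mat"
  assumes G: "G \<in> carrier_mat n n" and "c * det G = 1"
  shows "invertible_mat G"
proof -
  have "G * (c \<cdot>\<^sub>m adj_mat G) = 1\<^sub>m n" "(c \<cdot>\<^sub>m adj_mat G) * G = 1\<^sub>m n"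
    using adj_mat[OF G] G assms(2)
    by (auto simp: mult_smult_distrib[OF G adj_mat(1)[OF G]] mult_smult_assoc_mat[OF adj_mat(1)[OF G] G]
        intro!: eq_matI)
  then show ?thesis
    using G adj_mat(1)[OF G] unfolding invertible_mat_def inverts_mat_def
    by (auto intro!: exI[of _ "c \<cdot>\<^sub>m adj_mat G"])
qed

lemma integral_mat_lift:
  assumes "integral_mat X"
  obtains G where "G \<in> carrier_mat (dim_row X) (dim_col X)" "X = map_mat of_padic_int G"
proof -
  have "\<forall>i j. \<exists>g. i < dim_row X \<longrightarrow> j < dim_col X \<longrightarrow> X $$ (i, j) = of_padic_int g"
    using assms unfolding integral_mat_def padic_norm_le_1_iff by blast
  then obtain g where g: "\<And>i j. i < dim_row X \<Longrightarrow> j < dim_col X \<Longrightarrow> X $$ (i, j) = of_padic_int (g i j)"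
    by metis
  show ?thesis
    by (rule that[of "mat (dim_row X) (dim_col X) (\<lambda>(i, j). g i j)"]) (auto simp: g)
qed

text \<open>A determinant of norm 1 is a unit of the ring of integers, and then a multiple of the
  adjugate is an integral inverse. This replaces invertibility over the ring of integers by a
  condition on norms.\<close>

lemma GL_Zp_iff:
  "U \<in> GL_Zp n \<longleftrightarrow> U \<in> carrier_mat n n \<and> integral_mat U \<and> padic_norm (det U) = 1"
proof
  assume "U \<in> GL_Zp n"
  then obtain G where G: "G \<in> carrier_mat n n" "invertible_mat G" "U = map_mat of_padic_int G"
    by (auto simp: GL_Zp_def GL_def)
  obtain H where H: "G * H = 1\<^sub>m n" "H * G = 1\<^sub>m (dim_row H)"
    using G unfolding invertible_mat_def inverts_mat_def by auto
  have Hc: "H \<in> carrier_mat n n"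
    using H G by (metis carrier_matD(2) carrier_mat_triv index_mult_mat(3) index_one_mat(3))
  have "det G * det H = 1"
    using H(1) det_mult[OF G(1) Hc] by simp
  then have "of_padic_int (det G) * of_padic_int (det H) = 1"
    by (metis of_padic_int.hom_mult of_padic_int.hom_one)
  then have "padic_norm (of_padic_int (det G)) = 1"
    by (intro padic_norm_le_1_eq_1[of _ "of_padic_int (det H)"]) (auto simp: padic_norm_le_1_iff)
  then show "U \<in> carrier_mat n n \<and> integral_mat U \<and> padic_norm (det U) = 1"
    using G by (auto simp: integral_mat_def padic_norm_le_1_iff)
next
  assume U: "U \<in> carrier_mat n n \<and> integral_mat U \<and> padic_norm (det U) = 1"
  then obtain G where G: "G \<in> carrier_mat n n" "U = map_mat of_padic_int G"
    by (elim integral_mat_lift conjE) auto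
  then have d: "padic_norm (of_padic_int (det G)) = 1" using U by simp
  then have "padic_norm (inverse (of_padic_int (det G))) \<le> 1" by (simp add: padic_norm_inverse)
  then obtain c where "inverse (of_padic_int (det G)) = of_padic_int c"
    unfolding padic_norm_le_1_iff by blast
  moreover have "of_padic_int (det G) \<noteq> 0" using d by auto
  ultimately have "of_padic_int (c * det G) = of_padic_int 1"
    by (metis left_inverse of_padic_int.hom_mult of_padic_int.hom_one)
  then have "c * det G = 1" by (simp only: of_padic_int_eq_iff)
  then show "U \<in> GL_Zp n"
    using invertible_mat_padic_int[OF G(1)] G by (auto simp: GL_Zp_def GL_def)
qed

lemma GL_ZpD:
  assumes "U \<in> GL_Zp n"
  shows "U \<in> carrier_mat n n" "integral_mat U" "padic_norm (det U) = 1"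
  using assms by (auto simp: GL_Zp_iff)

lemma GL_ZpI:
  assumes "U \<in> carrier_mat n n" "V \<in> carrier_mat n n" "integral_mat U" "integral_mat V" "U * V = 1\<^sub>m n"
  shows "U \<in> GL_Zp n"
proof -
  have "det U * det V = 1" using assms det_mult[of U n V] by simp
  then have "padic_norm (det U) = 1"
    using assms by (intro padic_norm_le_1_eq_1[of _ "det V"] padic_norm_det_le_1) auto
  then show ?thesis using assms by (simp add: GL_Zp_iff)
qed

lemma GL_Zp_one: "1\<^sub>m n \<in> GL_Zp n"
  by (simp add: GL_Zp_iff)

lemma GL_Zp_mult:
  assumes "U \<in> GL_Zp n" "V \<in> GL_Zp n"
  shows "U * V \<in> GL_Zp n"
  using assms integral_mat_mult[of U n n V n] det_mult[of U n V]
  by (auto simp: GL_Zp_iff padic_norm_mult)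

lemma GL_Zp_inverse:
  assumes "U \<in> GL_Zp n"
  obtains V where "V \<in> GL_Zp n" "U * V = 1\<^sub>m n" "V * U = 1\<^sub>m n"
proof -
  obtain G where G: "G \<in> carrier_mat n n" "invertible_mat G" "U = map_mat of_padic_int G"
    using assms by (auto simp: GL_Zp_def GL_def)
  obtain H where H: "G * H = 1\<^sub>m n" "H * G = 1\<^sub>m (dim_row H)"
    using G unfolding invertible_mat_def inverts_mat_def by auto
  have Hc: "H \<in> carrier_mat n n"
    using H G by (metis carrier_matD(2) carrier_mat_triv index_mult_mat(3) index_one_mat(3))
  define V :: "'a padic mat" where "V = map_mat of_padic_int H"
  have one: "map_mat of_padic_int (1\<^sub>m n) = (1\<^sub>m n :: 'a padic mat)"
    by (rule eq_matI) auto
  have V: "V \<in> carrier_mat n n" "U * V = 1\<^sub>m n" "V * U = 1\<^sub>m n"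
    using G(1) Hc H one
    by (auto simp: V_def G(3) simp flip: of_padic_int.mat_hom_mult[OF G(1) Hc] of_padic_int.mat_hom_mult[OF Hc G(1)])
  have "integral_mat V" using Hc by (auto simp: integral_mat_def V_def padic_norm_le_1_iff)
  then have "V \<in> GL_Zp n" using V GL_ZpD[OF assms] by (intro GL_ZpI[of V n U]) auto
  then show ?thesis using that V by blast
qed

lemma GL_iff_det: "B \<in> GL n \<longleftrightarrow> B \<in> carrier_mat n n \<and> det B \<noteq> 0" for B :: "'a :: field mat"
proof
  assume "B \<in> GL n"
  then have B: "B \<in> carrier_mat n n" "invertible_mat B" by (auto simp: GL_def)
  obtain H where H: "B * H = 1\<^sub>m n" "H * B = 1\<^sub>m (dim_row H)"
    using B unfolding invertible_mat_def inverts_mat_def by auto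
  have Hc: "H \<in> carrier_mat n n"
    using H B by (metis carrier_matD(2) carrier_mat_triv index_mult_mat(3) index_one_mat(3))
  have "det B * det H = 1" using H(1) det_mult[OF B(1) Hc] by simp
  then show "B \<in> carrier_mat n n \<and> det B \<noteq> 0" using B by auto
next
  assume B: "B \<in> carrier_mat n n \<and> det B \<noteq> 0"
  then have Bc: "B \<in> carrier_mat n n" by simp
  define c where "c = inverse (det B)"
  have "B * (c \<cdot>\<^sub>m adj_mat B) = 1\<^sub>m n" "(c \<cdot>\<^sub>m adj_mat B) * B = 1\<^sub>m n"
    using adj_mat[OF Bc] B
    by (auto simp: c_def mult_smult_distrib[OF Bc adj_mat(1)[OF Bc]] mult_smult_assoc_mat[OF adj_mat(1)[OF Bc] Bc]
        intro!: eq_matI)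
  then have "invertible_mat B"
    using Bc adj_mat(1)[OF Bc] unfolding invertible_mat_def inverts_mat_def
    by (auto intro!: exI[of _ "c \<cdot>\<^sub>m adj_mat B"])
  then show "B \<in> GL n" using Bc by (simp add: GL_def)
qed

lemma GL_Zp_subset_GL: "U \<in> GL_Zp n \<Longrightarrow> U \<in> GL n"
  unfolding GL_iff_det GL_Zp_iff by auto

lemma GL_mult: "A \<in> GL n \<Longrightarrow> B \<in> GL n \<Longrightarrow> A * B \<in> GL n" for A :: "'a :: field mat"
  unfolding GL_iff_det using det_mult[of A n B] by auto

lemma GL_one: "1\<^sub>m n \<in> (GL n :: 'a :: field mat set)"
  by (simp add: GL_iff_det)

section \<open>Singular numbers and determinants of compressions\<close>

text \<open>Representatives of the integral matrices modulo \<open>p\<close>. The set is finite, so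
  maxima over it are attained and measurable, and precision \<open>1 / p\<close> is enough to
  recognise the largest norm of a minor.\<close>

definition residue_mats :: "nat \<Rightarrow> nat \<Rightarrow> 'p :: prime_card padic mat set" where
  "residue_mats r c = (\<lambda>f. mat r c (\<lambda>ij. of_nat (f ij))) ` (({..<r} \<times> {..<c}) \<rightarrow>\<^sub>E {..<CARD('p)})"

lemma finite_residue_mats: "finite (residue_mats r c)"
  unfolding residue_mats_def by (intro finite_imageI finite_PiE) auto

lemma residue_mats_carrier: "X \<in> residue_mats r c \<Longrightarrow> X \<in> carrier_mat r c"
  by (auto simp: residue_mats_def)

lemma residue_mats_integral: "X \<in> residue_mats r c \<Longrightarrow> integral_mat X"
  by (auto simp: residue_mats_def integral_mat_def padic_norm_of_nat_le_1)

lemma residue_mats_approx: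
  assumes "X \<in> carrier_mat r c" "integral_mat (X :: 'p :: prime_card padic mat)"
  obtains X' where "X' \<in> residue_mats r c"
    "\<And>i j. i < r \<Longrightarrow> j < c \<Longrightarrow> padic_norm (X $$ (i, j) - X' $$ (i, j)) \<le> 1 / real CARD('p)"
proof -
  have "\<forall>i j. \<exists>f. i < r \<longrightarrow> j < c \<longrightarrow> f < CARD('p) \<and>
      padic_norm (X $$ (i, j) - of_nat f) \<le> 1 / real CARD('p)"
    using padic_approx_nat[of "X $$ (i, j)" 1 for i j] assms unfolding integral_mat_def by force
  then obtain f where f: "\<And>i j. i < r \<Longrightarrow> j < c \<Longrightarrow> f i j < CARD('p) \<and>
      padic_norm (X $$ (i, j) - of_nat (f i j)) \<le> 1 / real CARD('p)" by metis
  define f' where "f' = restrict (\<lambda>(i, j). f i j) ({..<r} \<times> {..<c})"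
  have "f' \<in> ({..<r} \<times> {..<c}) \<rightarrow>\<^sub>E {..<CARD('p)}" using f by (auto simp: f'_def)
  then have "mat r c (\<lambda>ij. of_nat (f' ij)) \<in> (residue_mats r c :: 'p padic mat set)"
    unfolding residue_mats_def by blast
  then show ?thesis
    by (rule that) (use f in \<open>simp add: f'_def\<close>)
qed

lemma residue_mats_nonempty: "(residue_mats r c :: 'p :: prime_card padic mat set) \<noteq> {}"
proof -
  have "integral_mat (0\<^sub>m r c :: 'p padic mat)" by (simp add: integral_mat_def)
  then obtain X where "X \<in> (residue_mats r c :: 'p padic mat set)"
    by (rule residue_mats_approx[OF zero_carrier_mat])
  then show ?thesis by blast
qed

text \<open>For a decreasing list these are the \<open>q\<close> smallest entries; for singular
  numbers their sum is the least valuation of a \<open>q\<close> by \<open>q\<close> minor.\<close>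

definition tail_sum :: "nat \<Rightarrow> int list \<Rightarrow> int" where
  "tail_sum q ls = (\<Sum>i<q. ls ! (length ls - q + i))"

lemma tail_sum_length: "tail_sum (length ls) ls = sum_list ls"
  by (simp add: tail_sum_def sum_list_sum_nth lessThan_atLeast0)

lemma tail_sum_Suc:
  assumes "q < length ls"
  shows "tail_sum (Suc q) ls = ls ! (length ls - Suc q) + tail_sum q ls"
proof -
  have "tail_sum (Suc q) ls = ls ! (length ls - Suc q) + (\<Sum>i<q. ls ! (length ls - Suc q + Suc i))"
    unfolding tail_sum_def by (subst sum.lessThan_Suc_shift) simp
  also have "(\<Sum>i<q. ls ! (length ls - Suc q + Suc i)) = tail_sum q ls"
    unfolding tail_sum_def using assms by (intro sum.cong refl arg_cong[of _ _ "(!) ls"]) auto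
  finally show ?thesis .
qed

text \<open>
  Compare both sides with the constant list of value \<open>ls ! (length ls - q)\<close>, the largest of the
  last \<open>q\<close> entries.
\<close>
lemma tail_sum_le:
  assumes sorted: "sorted_wrt (\<ge>) ls" and S: "S \<subseteq> {..<length ls}" "card S = q"
  shows "tail_sum q ls \<le> (\<Sum>j\<in>S. ls ! j)"
proof (cases "q = 0")
  case True
  then show ?thesis using S finite_subset[OF S(1)] by (simp add: tail_sum_def)
next
  case False
  define m where "m = length ls"
  define c where "c = ls ! (m - q)"
  define T where "T = {m - q..<m}"
  have qm: "q \<le> m" using S card_mono[OF _ S(1)] by (simp add: m_def)
  have fS: "finite S" using S(1) finite_subset by blast
  have le: "ls ! j \<le> ls ! i" if "i \<le> j" "j < m" for i j
    using sorted that sorted_wrt_nth_less[OF sorted, of i j] by (cases "i = j") (auto simp: m_def)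
  have cT: "card T = q" using qm by (simp add: T_def)
  have tail: "tail_sum q ls = (\<Sum>j\<in>T. ls ! j)"
    unfolding tail_sum_def T_def m_def[symmetric]
    by (rule sum.reindex_bij_witness[of _ "\<lambda>j. j - (m - q)" "\<lambda>i. m - q + i"]) (use qm in auto)
  have "(\<Sum>j\<in>T. ls ! j - c) \<le> (\<Sum>j\<in>S \<inter> T. ls ! j - c)"
  proof -
    have "(\<Sum>j\<in>T. ls ! j - c) = (\<Sum>j\<in>S \<inter> T. ls ! j - c) + (\<Sum>j\<in>T - S. ls ! j - c)"
      by (subst sum.union_disjoint[symmetric]) (auto simp: T_def intro!: sum.cong)
    moreover have "(\<Sum>j\<in>T - S. ls ! j - c) \<le> 0"
      by (intro sum_nonpos) (use le in \<open>auto simp: T_def c_def\<close>)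
    ultimately show ?thesis by simp
  qed
  also have "\<dots> \<le> (\<Sum>j\<in>S. ls ! j - c)"
  proof (rule sum_mono2)
    fix j assume "j \<in> S - S \<inter> T"
    then have "j \<le> m - q" using S(1) by (auto simp: T_def m_def)
    then show "0 \<le> ls ! j - c" using le[of j "m - q"] False qm by (auto simp: c_def)
  qed (use fS in auto)
  finally show ?thesis using S(2) cT tail by (simp add: sum_subtractf)
qed

section \<open>Determinants of compressions of a diagonal matrix\<close>

lemma diag_powers_carrier [simp]: "diag_powers m n ls \<in> carrier_mat m n"
  "dim_row (diag_powers m n ls) = m" "dim_col (diag_powers m n ls) = n"
  by (auto simp: diag_powers_def)

text \<open>A form of Cauchy-Binet left unsorted: each row of the product is a combination of the
  rows of \<open>D * X\<close>, and multilinearity gives a sum over all choices \<open>f\<close> of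
  one row for each index. The requirement \<open>f i = i\<close> outside the range keeps each choice
  from being counted more than once.\<close>

lemma det_compression_expand:
  fixes Y X :: "'p :: prime_card padic mat"
  assumes Y: "Y \<in> carrier_mat q m" and X: "X \<in> carrier_mat n q" and "m \<le> n"
  shows "det (Y * diag_powers m n ls * X) =
    (\<Sum>f\<in>{f. (\<forall>i\<in>{0..<q}. f i \<in> {0..<m}) \<and> (\<forall>i. i \<notin> {0..<q} \<longrightarrow> f i = i)}.
      (\<Prod>i = 0..<q. Y $$ (i, f i)) * det (mat q q (\<lambda>(i, j). X $$ (f i, j))) *
      (\<Prod>i = 0..<q. of_nat CARD('p) powi (ls ! f i)))"
proof -
  define D where "D = (diag_powers m n ls :: 'p padic mat)"
  define P where "P j = (of_nat CARD('p) powi (ls ! j) :: 'p padic)" for j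
  have D: "D \<in> carrier_mat m n" by (simp add: D_def)
  have DX: "D * X \<in> carrier_mat m q" using D X by auto
  have row: "row (D * X) k = P k \<cdot>\<^sub>v row X k" if "k < m" for k
  proof (rule eq_vecI)
    fix j assume "j < dim_vec (P k \<cdot>\<^sub>v row X k)"
    then have j: "j < q" using X by simp
    have "row (D * X) k $ j = (\<Sum>l<n. D $$ (k, l) * X $$ (l, j))"
      using index_mult_mat_sum[OF D X that j] that j DX by (simp del: index_mult_mat)
    also have "\<dots> = (\<Sum>l<n. if l = k then P k * X $$ (k, j) else 0)"
      using that \<open>m \<le> n\<close> by (intro sum.cong) (auto simp: D_def diag_powers_def P_def)
    also have "\<dots> = P k * X $$ (k, j)" using that \<open>m \<le> n\<close> by simp
    finally show "row (D * X) k $ j = (P k \<cdot>\<^sub>v row X k) $ j"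
      using j that \<open>m \<le> n\<close> X by simp
  qed (use X DX in auto)
  have cv: "Y $$ (i, k) \<cdot>\<^sub>v row (D * X) k \<in> carrier_vec q" for i k
    using row_carrier[of "D * X" k] carrier_matD(2)[OF DX] by (metis smult_carrier_vec)
  have "Y * D * X = Y * (D * X)" using Y D X by (simp add: assoc_mult_mat)
  also have "\<dots> = mat\<^sub>r q q (\<lambda>i. finsum_vec TYPE('p padic) q (\<lambda>k. Y $$ (i, k) \<cdot>\<^sub>v row (D * X) k) {0..<m})"
    by (rule mat_mul_finsum_alt[OF Y DX])
  finally have "det (Y * D * X) = det (mat\<^sub>r q q (\<lambda>i. finsum_vec TYPE('p padic) q (\<lambda>k. Y $$ (i, k) \<cdot>\<^sub>v row (D * X) k) {0..<m}))"
    by (rule arg_cong)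
  also have "\<dots> = (\<Sum>f\<in>{f. (\<forall>i\<in>{0..<q}. f i \<in> {0..<m}) \<and> (\<forall>i. i \<notin> {0..<q} \<longrightarrow> f i = i)}.
      det (mat\<^sub>r q q (\<lambda>i. Y $$ (i, f i) \<cdot>\<^sub>v row (D * X) (f i))))"
    by (rule det_linear_rows_sum[where a = "\<lambda>i k. Y $$ (i, k) \<cdot>\<^sub>v row (D * X) k"])
      (auto intro!: cv)
  also have "\<dots> = (\<Sum>f\<in>{f. (\<forall>i\<in>{0..<q}. f i \<in> {0..<m}) \<and> (\<forall>i. i \<notin> {0..<q} \<longrightarrow> f i = i)}.
      (\<Prod>i = 0..<q. Y $$ (i, f i)) * det (mat q q (\<lambda>(i, j). X $$ (f i, j))) * (\<Prod>i = 0..<q. P (f i)))"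
  proof (rule sum.cong[OF refl])
    fix f :: "nat \<Rightarrow> nat"
    assume f: "f \<in> {f. (\<forall>i\<in>{0..<q}. f i \<in> {0..<m}) \<and> (\<forall>i. i \<notin> {0..<q} \<longrightarrow> f i = i)}"
    have fm: "f i < m" if "i < q" for i using f that by simp
    have fn: "f i < n" if "i < q" for i using fm[OF that] \<open>m \<le> n\<close> by simp
    have "mat\<^sub>r q q (\<lambda>i. Y $$ (i, f i) \<cdot>\<^sub>v row (D * X) (f i)) =
        mat\<^sub>r q q (\<lambda>i. (Y $$ (i, f i) * P (f i)) \<cdot>\<^sub>v row X (f i))"
      by (rule eq_rowI) (use row[OF fm] carrier_matD(2)[OF X] in \<open>simp_all add: smult_smult_assoc\<close>)
    then have "det (mat\<^sub>r q q (\<lambda>i. Y $$ (i, f i) \<cdot>\<^sub>v row (D * X) (f i))) =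
        det (mat\<^sub>r q q (\<lambda>i. (Y $$ (i, f i) * P (f i)) \<cdot>\<^sub>v row X (f i)))" by (rule arg_cong)
    also have "\<dots> = (\<Prod>i = 0..<q. Y $$ (i, f i) * P (f i)) * det (mat\<^sub>r q q (\<lambda>i. row X (f i)))"
      by (rule det_rows_mul) (use X in auto)
    also have "mat\<^sub>r q q (\<lambda>i. row X (f i)) = mat q q (\<lambda>(i, j). X $$ (f i, j))"
      by (rule eq_rowI) (use fn X in \<open>auto intro!: eq_vecI\<close>)
    finally show "det (mat\<^sub>r q q (\<lambda>i. Y $$ (i, f i) \<cdot>\<^sub>v row (D * X) (f i))) =
      (\<Prod>i = 0..<q. Y $$ (i, f i)) * det (mat q q (\<lambda>(i, j). X $$ (f i, j))) * (\<Prod>i = 0..<q. P (f i))"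
      by (simp add: prod.distrib mult_ac)
  qed
  finally show ?thesis by (simp add: D_def P_def)
qed

lemma det_rows_not_inj:
  fixes X :: "'a :: comm_ring_1 mat"
  assumes "\<not> inj_on f {0..<q}"
  shows "det (mat q q (\<lambda>(i, j). X $$ (f i, j))) = 0"
proof -
  obtain i i' where i: "i < q" "i' < q" "i \<noteq> i'" "f i = f i'"
    using assms by (auto simp: inj_on_def)
  show ?thesis
    by (rule det_identical_rows[OF _ i(3,1,2)]) (use i in auto)
qed

lemma CARD_real_gt_1: "real CARD('p :: prime_card) > 1"
  using CARD_gt_1[where 'p = 'p] by linarith

lemma padic_norm_powi_CARD:
  "padic_norm ((of_nat CARD('p) :: 'p :: prime_card padic) powi z) = real CARD('p) powi (- z)"
  by (simp add: padic_norm_powi padic_norm_of_nat_CARD power_int_minus power_int_divide_distrib divide_inverse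
      flip: power_int_inverse)

lemma power_int_sum: "x \<noteq> 0 \<Longrightarrow> (\<Prod>i\<in>A. x powi f i) = x powi (\<Sum>i\<in>A. f i)"
  for x :: "'a :: field"
  by (induction A rule: infinite_finite_induct) (auto simp: power_int_add)

text \<open>An injective \<open>f\<close> picks \<open>q\<close> different exponents, and by
  \<open>tail_sum_le\<close> their sum is at least that of the \<open>q\<close> smallest.\<close>

lemma padic_norm_diag_term_le:
  assumes ls: "length ls = m" "sorted_wrt (\<ge>) ls" and f: "f ` {0..<q} \<subseteq> {0..<m}" "inj_on f {0..<q}"
  shows "padic_norm (\<Prod>i = 0..<q. (of_nat CARD('p) :: 'p :: prime_card padic) powi (ls ! f i))
    \<le> real CARD('p) powi (- tail_sum q ls)"
proof -
  have "padic_norm (\<Prod>i = 0..<q. (of_nat CARD('p) :: 'p padic) powi (ls ! f i)) =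
      real CARD('p) powi (- (\<Sum>i = 0..<q. ls ! f i))"
    by (simp add: padic_norm_prod padic_norm_powi_CARD power_int_sum flip: sum_negf)
  also have "(\<Sum>i = 0..<q. ls ! f i) = (\<Sum>j\<in>f ` {0..<q}. ls ! j)"
    using f(2) by (simp add: sum.reindex)
  also have "tail_sum q ls \<le> (\<Sum>j\<in>f ` {0..<q}. ls ! j)"
    using f ls by (intro tail_sum_le) (auto simp: card_image)
  then have "real CARD('p) powi (- (\<Sum>j\<in>f ` {0..<q}. ls ! j)) \<le> real CARD('p) powi (- tail_sum q ls)"
    using CARD_real_gt_1[where 'p = 'p] by (intro power_int_increasing) auto
  finally show ?thesis .
qed

text \<open>The bound holds term by term in the expansion: choices that repeat a row contribute 0,
  and for injective ones all factors other than the powers of \<open>p\<close> are integral.\<close>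

lemma det_compression_diag_le:
  fixes Y X :: "'p :: prime_card padic mat"
  assumes Y: "Y \<in> carrier_mat q m" "integral_mat Y" and X: "X \<in> carrier_mat n q" "integral_mat X"
    and "m \<le> n" and ls: "length ls = m" "sorted_wrt (\<ge>) ls"
  shows "padic_norm (det (Y * diag_powers m n ls * X)) \<le> real CARD('p) powi (- tail_sum q ls)"
  unfolding det_compression_expand[OF Y(1) X(1) \<open>m \<le> n\<close>]
proof (intro padic_norm_sum_le)
  fix f assume f: "f \<in> {f. (\<forall>i\<in>{0..<q}. f i \<in> {0..<m}) \<and> (\<forall>i. i \<notin> {0..<q} \<longrightarrow> f i = i)}"
  let ?d = "det (mat q q (\<lambda>(i, j). X $$ (f i, j)))"
  let ?P = "(\<Prod>i = 0..<q. (of_nat CARD('p) :: 'p padic) powi (ls ! f i))"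
  have fn: "f i < n" if "i < q" for i using f that \<open>m \<le> n\<close> by force
  have int: "integral_mat (mat q q (\<lambda>(i, j). X $$ (f i, j)))"
    using fn X by (auto simp: integral_mat_def)
  show "padic_norm ((\<Prod>i = 0..<q. Y $$ (i, f i)) * ?d * ?P) \<le> real CARD('p) powi (- tail_sum q ls)"
  proof (cases "inj_on f {0..<q}")
    case True
    have "padic_norm ((\<Prod>i = 0..<q. Y $$ (i, f i)) * ?d) \<le> 1"
      by (intro padic_norm_mult_le_1 padic_norm_det_le_1[OF _ int])
        (use f Y in \<open>auto simp: padic_norm_prod padic_norm_nonneg intro!: prod_le_1 integral_matD\<close>)
    moreover have "padic_norm ?P \<le> real CARD('p) powi (- tail_sum q ls)"
      using f ls True by (intro padic_norm_diag_term_le[of ls m]) auto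
    ultimately have "padic_norm ((\<Prod>i = 0..<q. Y $$ (i, f i)) * ?d * ?P) \<le> 1 * real CARD('p) powi (- tail_sum q ls)"
      unfolding padic_norm_mult[of _ ?P] by (intro mult_mono) (auto simp: padic_norm_nonneg)
    then show ?thesis by simp
  qed (simp add: det_rows_not_inj)
qed simp

text \<open>A relative estimate: the error carries the factor
  \<open>real CARD('p) powi (- tail_sum q ls)\<close>, the largest norm that such a determinant can
  have. With \<open>r = 1 / p\<close> a maximal determinant therefore survives the rounding of both
  test matrices, however large or small the diagonal entries are.\<close>

lemma det_compression_diag_diff_le:
  fixes Y X :: "'p :: prime_card padic mat"
  assumes Y: "Y \<in> carrier_mat q m" "integral_mat Y" and X: "X \<in> carrier_mat n q" "integral_mat X"
    and Y': "Y' \<in> carrier_mat q m" "integral_mat Y'" and X': "X' \<in> carrier_mat n q" "integral_mat X'"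
    and dY: "\<And>i j. i < q \<Longrightarrow> j < m \<Longrightarrow> padic_norm (Y $$ (i, j) - Y' $$ (i, j)) \<le> r"
    and dX: "\<And>i j. i < n \<Longrightarrow> j < q \<Longrightarrow> padic_norm (X $$ (i, j) - X' $$ (i, j)) \<le> r"
    and "m \<le> n" and ls: "length ls = m" "sorted_wrt (\<ge>) ls" and "0 \<le> r"
  shows "padic_norm (det (Y * diag_powers m n ls * X) - det (Y' * diag_powers m n ls * X'))
    \<le> r * real CARD('p) powi (- tail_sum q ls)"
  unfolding det_compression_expand[OF Y(1) X(1) \<open>m \<le> n\<close>] det_compression_expand[OF Y'(1) X'(1) \<open>m \<le> n\<close>]
    sum_subtractf[symmetric]
proof (intro padic_norm_sum_le)
  fix f assume f: "f \<in> {f. (\<forall>i\<in>{0..<q}. f i \<in> {0..<m}) \<and> (\<forall>i. i \<notin> {0..<q} \<longrightarrow> f i = i)}"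
  let ?d = "\<lambda>X. det (mat q q (\<lambda>(i, j). X $$ (f i, j)))"
  let ?P = "(\<Prod>i = 0..<q. (of_nat CARD('p) :: 'p padic) powi (ls ! f i))"
  let ?Y = "\<lambda>Y. \<Prod>i = 0..<q. Y $$ (i, f i)"
  have fn: "f i < n" if "i < q" for i using f that \<open>m \<le> n\<close> by force
  have int: "integral_mat (mat q q (\<lambda>(i, j). X $$ (f i, j)))" "integral_mat (mat q q (\<lambda>(i, j). X' $$ (f i, j)))"
    using fn X X' by (auto simp: integral_mat_def)
  show "padic_norm (?Y Y * ?d X * ?P - ?Y Y' * ?d X' * ?P) \<le> r * real CARD('p) powi (- tail_sum q ls)"
  proof (cases "inj_on f {0..<q}")
    case True
    have "padic_norm (?Y Y * ?d X - ?Y Y' * ?d X') \<le> r"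
    proof (rule padic_norm_mult_diff_le)
      show "padic_norm (?Y Y) \<le> 1"
        using f Y by (auto simp: padic_norm_prod padic_norm_nonneg intro!: prod_le_1 integral_matD)
      show "padic_norm (?d X') \<le> 1" by (rule padic_norm_det_le_1[OF mat_carrier int(2)])
      show "padic_norm (?Y Y - ?Y Y') \<le> r"
        using f Y Y' dY \<open>0 \<le> r\<close> by (intro padic_norm_prod_diff_le) (auto intro!: integral_matD)
      show "padic_norm (?d X - ?d X') \<le> r"
        using fn X X' dX \<open>0 \<le> r\<close> int by (intro padic_norm_det_diff_le) auto
    qed
    moreover have "padic_norm ?P \<le> real CARD('p) powi (- tail_sum q ls)"
      using f ls True by (intro padic_norm_diag_term_le[of ls m]) auto
    ultimately have "padic_norm ((?Y Y * ?d X - ?Y Y' * ?d X') * ?P) \<le> r * real CARD('p) powi (- tail_sum q ls)"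
      unfolding padic_norm_mult using \<open>0 \<le> r\<close> by (intro mult_mono) (auto simp: padic_norm_nonneg)
    then show ?thesis by (simp add: left_diff_distrib)
  qed (simp add: det_rows_not_inj \<open>0 \<le> r\<close>)
qed (use \<open>0 \<le> r\<close> in simp)

section \<open>Coordinate projections and inclusions\<close>

definition coord_cols :: "nat \<Rightarrow> nat \<Rightarrow> nat \<Rightarrow> 'a :: zero_neq_one mat" where
  "coord_cols n s q = mat n q (\<lambda>(i, j). if i = s + j then 1 else 0)"

definition coord_rows :: "nat \<Rightarrow> nat \<Rightarrow> nat \<Rightarrow> 'a :: zero_neq_one mat" where
  "coord_rows q s n = mat q n (\<lambda>(i, j). if j = s + i then 1 else 0)"

lemma coord_carrier [simp]:
  "coord_cols n s q \<in> carrier_mat n q" "coord_rows q s n \<in> carrier_mat q n"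
  "dim_row (coord_cols n s q) = n" "dim_col (coord_cols n s q) = q"
  "dim_row (coord_rows q s n) = q" "dim_col (coord_rows q s n) = n"
  by (auto simp: coord_cols_def coord_rows_def)

lemma coord_integral [simp]: "integral_mat (coord_cols n s q)" "integral_mat (coord_rows q s n)"
  by (auto simp: coord_cols_def coord_rows_def integral_mat_def)

lemma mult_coord_cols:
  fixes C :: "'a :: field mat"
  assumes "C \<in> carrier_mat m n" "s + q \<le> n"
  shows "C * coord_cols n s q = mat m q (\<lambda>(i, j). C $$ (i, s + j))"
proof (rule eq_matI)
  fix i j assume "i < dim_row (mat m q (\<lambda>(i, j). C $$ (i, s + j)))"
    "j < dim_col (mat m q (\<lambda>(i, j). C $$ (i, s + j)))"
  then have ij: "i < m" "j < q" by auto
  have "(C * coord_cols n s q) $$ (i, j) = (\<Sum>k<n. C $$ (i, k) * coord_cols n s q $$ (k, j))"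
    by (rule index_mult_mat_sum[OF assms(1) _ ij]) simp
  also have "\<dots> = (\<Sum>k<n. if k = s + j then C $$ (i, s + j) else 0)"
    using ij by (intro sum.cong) (auto simp: coord_cols_def)
  finally show "(C * coord_cols n s q) $$ (i, j) = mat m q (\<lambda>(i, j). C $$ (i, s + j)) $$ (i, j)"
    using ij assms(2) by simp
qed (use assms in auto)

lemma coord_rows_mult:
  fixes C :: "'a :: field mat"
  assumes "C \<in> carrier_mat n m" "s + q \<le> n"
  shows "coord_rows q s n * C = mat q m (\<lambda>(i, j). C $$ (s + i, j))"
proof (rule eq_matI)
  fix i j assume "i < dim_row (mat q m (\<lambda>(i, j). C $$ (s + i, j)))"
    "j < dim_col (mat q m (\<lambda>(i, j). C $$ (s + i, j)))"
  then have ij: "i < q" "j < m" by auto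
  have "(coord_rows q s n * C) $$ (i, j) = (\<Sum>k<n. coord_rows q s n $$ (i, k) * C $$ (k, j))"
    by (rule index_mult_mat_sum[OF _ assms(1) ij]) simp
  also have "\<dots> = (\<Sum>k<n. if k = s + i then C $$ (s + i, j) else 0)"
    using ij by (intro sum.cong) (auto simp: coord_rows_def)
  finally show "(coord_rows q s n * C) $$ (i, j) = mat q m (\<lambda>(i, j). C $$ (s + i, j)) $$ (i, j)"
    using ij assms(2) by simp
qed (use assms in auto)

lemma drop_rows_eq_mult:
  fixes B :: "'a :: field mat"
  assumes "B \<in> carrier_mat n m" "i \<le> n"
  shows "drop_rows i B = coord_rows (n - i) i n * B"
  using assms by (subst coord_rows_mult) (auto simp: drop_rows_def add.commute)

text \<open>The compression to the last \<open>q\<close> diagonal entries gives equality in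
  \<open>det_compression_diag_le\<close>. The column offset is \<open>m - q\<close> and not
  \<open>n - q\<close>, since the diagonal of a wide matrix ends in column \<open>m\<close>.\<close>

lemma det_compression_diag_tail:
  fixes ls :: "int list"
  assumes "length ls = m" "m \<le> n" "q \<le> m"
  shows "padic_norm (det (coord_rows q (m - q) m * diag_powers m n ls * coord_cols n (m - q) q :: 'p :: prime_card padic mat))
    = real CARD('p) powi (- tail_sum q ls)"
proof -
  let ?D = "diag_powers m n ls :: 'p padic mat"
  define E where "E = (coord_rows q (m - q) m * ?D * coord_cols n (m - q) q)"
  have "coord_rows q (m - q) m * ?D = mat q n (\<lambda>(i, j). ?D $$ (m - q + i, j))"
    by (rule coord_rows_mult) (use assms in auto)
  then have "E = mat q q (\<lambda>(i, j). ?D $$ (m - q + i, m - q + j))"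
    unfolding E_def using assms by (subst mult_coord_cols) auto
  then have E: "E = mat q q (\<lambda>(i, j). if i = j then of_nat CARD('p) powi (ls ! (m - q + i)) else 0)"
    using assms by (auto simp: diag_powers_def intro!: eq_matI)
  have "det E = prod_list (diag_mat E)"
    by (rule det_upper_triangular[of E q]) (auto simp: E upper_triangular_def)
  also have "diag_mat E = map (\<lambda>i. of_nat CARD('p) powi (ls ! (m - q + i))) [0..<q]"
    by (auto simp: diag_mat_def E)
  also have "prod_list \<dots> = (\<Prod>i<q. of_nat CARD('p) powi (ls ! (m - q + i)))"
    by (simp add: prod.list_conv_set_nth lessThan_atLeast0)
  finally show ?thesis
    using assms(1) unfolding E_def tail_sum_def
    by (simp add: padic_norm_prod padic_norm_powi_CARD power_int_sum sum_negf)
qed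

section \<open>Compressions of a general matrix and uniqueness of the singular numbers\<close>

lemma is_SND:
  assumes "is_SN C ls"
  obtains U V where "length ls = dim_row C" "sorted_wrt (\<ge>) ls" "U \<in> GL_Zp (dim_row C)" "V \<in> GL_Zp (dim_col C)"
    "C = U * diag_powers (dim_row C) (dim_col C) ls * V"
  using assms unfolding is_SN_def by blast

lemma compression_reassoc:
  fixes Y :: "'a :: comm_ring_1 mat"
  assumes "Y \<in> carrier_mat q m" "U \<in> carrier_mat m m" "D \<in> carrier_mat m n" "V \<in> carrier_mat n n"
    "X \<in> carrier_mat n l"
  shows "Y * (U * D * V) * X = (Y * U) * D * (V * X)"
  using assms by (simp add: assoc_mult_mat[of _ q m _ m] assoc_mult_mat[of _ q m _ n] assoc_mult_mat[of _ m m _ n]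
     assoc_mult_mat[of _ m n _ n] assoc_mult_mat[of _ m m _ n _ l] assoc_mult_mat[of _ q m _ n _ l]
      assoc_mult_mat[of _ q n _ n _ l] assoc_mult_mat[of _ m n _ n _ l])

text \<open>The unimodular factors are absorbed into the test matrices \<open>Y * U\<close> and
  \<open>V * X\<close>, which stay integral; this leaves the diagonal case.\<close>

lemma det_compression_le:
  fixes C :: "'p :: prime_card padic mat"
  assumes C: "is_SN C ls" "C \<in> carrier_mat m n" "m \<le> n"
    and Y: "Y \<in> carrier_mat q m" "integral_mat Y" and X: "X \<in> carrier_mat n q" "integral_mat X"
  shows "padic_norm (det (Y * C * X)) \<le> real CARD('p) powi (- tail_sum q ls)"
proof -
  obtain U V where UV: "length ls = m" "sorted_wrt (\<ge>) ls" "U \<in> GL_Zp m" "V \<in> GL_Zp n"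
    "C = U * diag_powers m n ls * V"
    using is_SND[OF C(1)] C(2) by (metis carrier_matD)
  have "Y * C * X = (Y * U) * diag_powers m n ls * (V * X)"
    unfolding UV(5) using Y X GL_ZpD(1)[OF UV(3)] GL_ZpD(1)[OF UV(4)] by (intro compression_reassoc) auto
  moreover have "padic_norm (det ((Y * U) * diag_powers m n ls * (V * X))) \<le> real CARD('p) powi (- tail_sum q ls)"
    using UV Y X GL_ZpD[OF UV(3)] GL_ZpD[OF UV(4)] C(3)
    by (intro det_compression_diag_le integral_mat_mult[of _ q m _ m] integral_mat_mult[of _ n n _ q]) auto
  ultimately show ?thesis by simp
qed

lemma integral_mat_mult_diff_le:
  assumes A: "A \<in> carrier_mat n m" "integral_mat A" and B: "B \<in> carrier_mat m l" "integral_mat B"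
    and A': "A' \<in> carrier_mat n m" "integral_mat A'" and B': "B' \<in> carrier_mat m l" "integral_mat B'"
    and "\<And>i j. i < n \<Longrightarrow> j < m \<Longrightarrow> padic_norm (A $$ (i, j) - A' $$ (i, j)) \<le> r"
    and "\<And>i j. i < m \<Longrightarrow> j < l \<Longrightarrow> padic_norm (B $$ (i, j) - B' $$ (i, j)) \<le> r"
    and "0 \<le> r" "i < n" "j < l"
  shows "padic_norm ((A * B) $$ (i, j) - (A' * B') $$ (i, j)) \<le> r"
  unfolding index_mult_mat_sum[OF A(1) B(1) \<open>i < n\<close> \<open>j < l\<close>] index_mult_mat_sum[OF A'(1) B'(1) \<open>i < n\<close> \<open>j < l\<close>]
    sum_subtractf[symmetric]
  by (intro padic_norm_sum_le padic_norm_mult_diff_le) (use assms in \<open>auto intro!: integral_matD\<close>)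

text \<open>The ideal test matrices undo \<open>U\<close> and \<open>V\<close> and select the last
  \<open>q\<close> coordinates. Rounding them to digits changes the determinant by at most
  \<open>1 / p\<close> times its norm, hence does not change the norm.\<close>

lemma det_compression_attained:
  fixes C :: "'p :: prime_card padic mat"
  assumes C: "is_SN C ls" "C \<in> carrier_mat m n" "m \<le> n" and "q \<le> m"
  shows "\<exists>Y\<in>residue_mats q m. \<exists>X\<in>residue_mats n q.
    padic_norm (det (Y * C * X)) = real CARD('p) powi (- tail_sum q ls)"
proof -
  obtain U V where UV: "length ls = m" "sorted_wrt (\<ge>) ls" "U \<in> GL_Zp m" "V \<in> GL_Zp n"
    "C = U * diag_powers m n ls * V"
    using is_SND[OF C(1)] C(2) by (metis carrier_matD)
  obtain U' where U': "U' \<in> GL_Zp m" "U' * U = 1\<^sub>m m" using GL_Zp_inverse[OF UV(3)] by blast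
  obtain V' where V': "V' \<in> GL_Zp n" "V * V' = 1\<^sub>m n" using GL_Zp_inverse[OF UV(4)] by blast
  note carr = GL_ZpD(1)[OF UV(3)] GL_ZpD(1)[OF UV(4)] GL_ZpD(1)[OF U'(1)] GL_ZpD(1)[OF V'(1)]
  note int = GL_ZpD(2)[OF UV(3)] GL_ZpD(2)[OF UV(4)] GL_ZpD(2)[OF U'(1)] GL_ZpD(2)[OF V'(1)]
  let ?D = "diag_powers m n ls :: 'p padic mat"
  define Y0 :: "'p padic mat" where "Y0 = coord_rows q (m - q) m"
  define X0 :: "'p padic mat" where "X0 = coord_cols n (m - q) q"
  have Y0: "Y0 \<in> carrier_mat q m" "integral_mat Y0" and X0: "X0 \<in> carrier_mat n q" "integral_mat X0"
    by (auto simp: Y0_def X0_def)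
  have YU': "integral_mat (Y0 * U')" "Y0 * U' \<in> carrier_mat q m"
    using Y0 carr int integral_mat_mult[of Y0 q m U' m] by auto
  have VX': "integral_mat (V' * X0)" "V' * X0 \<in> carrier_mat n q"
    using X0 carr int integral_mat_mult[of V' n n X0 q] by auto
  obtain Y where Y: "Y \<in> residue_mats q m"
    "\<And>i j. i < q \<Longrightarrow> j < m \<Longrightarrow> padic_norm ((Y0 * U') $$ (i, j) - Y $$ (i, j)) \<le> 1 / real CARD('p)"
    using residue_mats_approx[OF YU'(2,1)] by blast
  obtain X where X: "X \<in> residue_mats n q"
    "\<And>i j. i < n \<Longrightarrow> j < q \<Longrightarrow> padic_norm ((V' * X0) $$ (i, j) - X $$ (i, j)) \<le> 1 / real CARD('p)"
    using residue_mats_approx[OF VX'(2,1)] by blast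
  note Yc = residue_mats_carrier[OF Y(1)] residue_mats_integral[OF Y(1)]
  note Xc = residue_mats_carrier[OF X(1)] residue_mats_integral[OF X(1)]
  have Y0U: "Y0 * U' * U = Y0"
    using Y0 carr U'(2) by (simp add: assoc_mult_mat[of _ q m _ m])
  have VX0: "V * (V' * X0) = X0"
    using X0 carr V'(2) by (simp flip: assoc_mult_mat[of _ n n _ n _ q])
  \<comment> \<open>Multiplication by the integral matrix \<open>U\<close> does not enlarge the
    rounding error, so \<open>Y * U\<close> is as close to the coordinate projection as
    \<open>Y\<close> is to \<open>Y0 * U'\<close>.\<close>
  have dY: "padic_norm (Y0 $$ (i, j) - (Y * U) $$ (i, j)) \<le> 1 / real CARD('p)" if "i < q" "j < m" for i j
    using integral_mat_mult_diff_le[OF YU'(2,1) carr(1) int(1) Yc carr(1) int(1) Y(2) _ _ that] Y0U by simp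
  have dX: "padic_norm (X0 $$ (i, j) - (V * X) $$ (i, j)) \<le> 1 / real CARD('p)" if "i < n" "j < q" for i j
    using integral_mat_mult_diff_le[OF carr(2) int(2) VX'(2,1) carr(2) int(2) Xc _ X(2) _ that] VX0 by simp
  have YUi: "integral_mat (Y * U)" by (rule integral_mat_mult[OF Yc(1) carr(1) Yc(2) int(1)])
  have VXi: "integral_mat (V * X)" by (rule integral_mat_mult[OF carr(2) Xc(1) int(2) Xc(2)])
  let ?c = "real CARD('p) powi (- tail_sum q ls)"
  have c: "?c > 0" using CARD_real_gt_1[where 'p = 'p] by simp
  have "padic_norm (det (Y0 * ?D * X0) - det ((Y * U) * ?D * (V * X))) \<le> 1 / real CARD('p) * ?c"
    using dX dY Y0 X0 YUi VXi Yc Xc carr UV C(3) by (intro det_compression_diag_diff_le) auto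
  also have "\<dots> < 1 * ?c"
    using c CARD_real_gt_1[where 'p = 'p] by (intro mult_strict_right_mono) auto
  finally have less: "padic_norm (det ((Y * U) * ?D * (V * X)) - det (Y0 * ?D * X0)) < ?c"
    by (metis minus_diff_eq mult_1 padic_norm_uminus)
  have D0: "padic_norm (det (Y0 * ?D * X0)) = ?c"
    unfolding Y0_def X0_def using UV(1) C(3) \<open>q \<le> m\<close> by (rule det_compression_diag_tail)
  have "padic_norm (det (Y0 * ?D * X0) + (det ((Y * U) * ?D * (V * X)) - det (Y0 * ?D * X0))) = ?c"
    using padic_norm_add_eq[of "det ((Y * U) * ?D * (V * X)) - det (Y0 * ?D * X0)" "det (Y0 * ?D * X0)"] less D0
    by simp
  moreover have "Y * C * X = (Y * U) * ?D * (V * X)"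
    unfolding UV(5) using Yc Xc carr by (intro compression_reassoc) auto
  ultimately have "padic_norm (det (Y * C * X)) = ?c" by simp
  then show ?thesis using Y X by blast
qed

text \<open>A description of the tail sums that does not mention a factorisation. It yields both the
  uniqueness of the singular numbers and their measurability.\<close>

definition max_minor :: "nat \<Rightarrow> 'p :: prime_card padic mat \<Rightarrow> real" where
  "max_minor q C = Max ((\<lambda>(Y, X). padic_norm (det (Y * C * X))) `
     (residue_mats q (dim_row C) \<times> residue_mats (dim_col C) q))"

lemma max_minor_eq:
  fixes C :: "'p :: prime_card padic mat"
  assumes C: "is_SN C ls" "C \<in> carrier_mat m n" "m \<le> n" and "q \<le> m"
  shows "max_minor q C = real CARD('p) powi (- tail_sum q ls)"
  unfolding max_minor_def
proof (rule Max_eqI)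
  show "real CARD('p) powi (- tail_sum q ls) \<in> (\<lambda>(Y, X). padic_norm (det (Y * C * X))) `
     (residue_mats q (dim_row C) \<times> residue_mats (dim_col C) q)"
    using det_compression_attained[OF assms] C(2) by force
  fix y assume "y \<in> (\<lambda>(Y, X). padic_norm (det (Y * C * X))) `
     (residue_mats q (dim_row C) \<times> residue_mats (dim_col C) q)"
  then obtain Y X where YX: "Y \<in> residue_mats q m" "X \<in> residue_mats n q" "y = padic_norm (det (Y * C * X))"
    using C(2) by auto
  show "y \<le> real CARD('p) powi (- tail_sum q ls)"
    unfolding YX(3)
    by (rule det_compression_le[OF C residue_mats_carrier[OF YX(1)] residue_mats_integral[OF YX(1)]
      residue_mats_carrier[OF YX(2)] residue_mats_integral[OF YX(2)]])
qed (simp add: finite_residue_mats)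

text \<open>\<open>max_minor\<close> determines all tail sums, and the entries of the list are the
  differences of consecutive tail sums.\<close>

lemma is_SN_unique:
  fixes C :: "'p :: prime_card padic mat"
  assumes ls: "is_SN C ls" and ls': "is_SN C ls'" and "dim_row C \<le> dim_col C"
  shows "ls = ls'"
proof -
  define m where "m = dim_row C"
  have C: "C \<in> carrier_mat m (dim_col C)" by (simp add: m_def)
  have len: "length ls = m" "length ls' = m" using ls ls' by (auto simp: is_SN_def m_def)
  have tail: "tail_sum q ls = tail_sum q ls'" if "q \<le> m" for q
  proof -
    have "real CARD('p) powi (- tail_sum q ls) = real CARD('p) powi (- tail_sum q ls')"
      using max_minor_eq[OF ls C _ that] max_minor_eq[OF ls' C _ that] assms(3) by (simp add: m_def)
    then show ?thesis
      using power_int_strict_increasing[of "- tail_sum q ls" "- tail_sum q ls'" "real CARD('p)"]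
        power_int_strict_increasing[of "- tail_sum q ls'" "- tail_sum q ls" "real CARD('p)"]
        CARD_real_gt_1[where 'p = 'p]
      by (metis less_irrefl neg_equal_iff_equal not_less_iff_gr_or_eq)
  qed
  show ?thesis
  proof (rule nth_equalityI)
    fix i assume "i < length ls"
    then have i: "i < m" using len by simp
    have "m - Suc (m - Suc i) = i" using i by simp
    then show "ls ! i = ls' ! i"
      using tail_sum_Suc[of "m - Suc i" ls] tail_sum_Suc[of "m - Suc i" ls'] tail[of "m - Suc i"]
        tail[of "Suc (m - Suc i)"] i len by simp
  qed (simp add: len)
qed

lemma SN_eq: "is_SN C ls \<Longrightarrow> dim_row C \<le> dim_col C \<Longrightarrow> SN C = ls"
  unfolding SN_def using is_SN_unique by blast

section \<open>Existence of the Smith normal form and the Iwasawa decomposition\<close>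

definition perm_cols_mat :: "nat \<Rightarrow> (nat \<Rightarrow> nat) \<Rightarrow> 'a :: zero_neq_one mat" where
  "perm_cols_mat n f = mat n n (\<lambda>(i, j). if i = f j then 1 else 0)"

lemma perm_cols_mat_carrier [simp]: "perm_cols_mat n f \<in> carrier_mat n n"
  "dim_row (perm_cols_mat n f) = n" "dim_col (perm_cols_mat n f) = n"
  by (auto simp: perm_cols_mat_def)

lemma mult_perm_cols_mat:
  fixes C :: "'a :: field mat"
  assumes "C \<in> carrier_mat m n" and f: "\<And>j. j < n \<Longrightarrow> f j < n"
  shows "C * perm_cols_mat n f = mat m n (\<lambda>(i, j). C $$ (i, f j))"
proof (rule eq_matI)
  fix i j assume "i < dim_row (mat m n (\<lambda>(i, j). C $$ (i, f j)))" "j < dim_col (mat m n (\<lambda>(i, j). C $$ (i, f j)))"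
  then have ij: "i < m" "j < n" by auto
  have "(C * perm_cols_mat n f) $$ (i, j) = (\<Sum>k<n. C $$ (i, k) * perm_cols_mat n f $$ (k, j))"
    by (rule index_mult_mat_sum[OF assms(1) _ ij]) simp
  also have "\<dots> = (\<Sum>k<n. if k = f j then C $$ (i, f j) else 0)"
    using ij by (intro sum.cong) (auto simp: perm_cols_mat_def)
  finally show "(C * perm_cols_mat n f) $$ (i, j) = mat m n (\<lambda>(i, j). C $$ (i, f j)) $$ (i, j)"
    using ij f by simp
qed (use assms in auto)

lemma perm_cols_mat_mult:
  fixes C :: "'a :: field mat"
  assumes "C \<in> carrier_mat n m" and f: "\<And>j. j < n \<Longrightarrow> f j < n" and g: "\<And>j. j < n \<Longrightarrow> g j < n"
    and gf: "\<And>j. j < n \<Longrightarrow> g (f j) = j" and fg: "\<And>j. j < n \<Longrightarrow> f (g j) = j"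
  shows "perm_cols_mat n f * C = mat n m (\<lambda>(i, j). C $$ (g i, j))"
proof (rule eq_matI)
  fix i j assume "i < dim_row (mat n m (\<lambda>(i, j). C $$ (g i, j)))" "j < dim_col (mat n m (\<lambda>(i, j). C $$ (g i, j)))"
  then have ij: "i < n" "j < m" by auto
  have "(perm_cols_mat n f * C) $$ (i, j) = (\<Sum>k<n. perm_cols_mat n f $$ (i, k) * C $$ (k, j))"
    by (rule index_mult_mat_sum[OF _ assms(1) ij]) simp
  also have "\<dots> = (\<Sum>k<n. if k = g i then C $$ (g i, j) else 0)"
    using ij gf fg g by (intro sum.cong) (auto simp: perm_cols_mat_def)
  finally show "(perm_cols_mat n f * C) $$ (i, j) = mat n m (\<lambda>(i, j). C $$ (g i, j)) $$ (i, j)"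
    using ij g by simp
qed (use assms in auto)

lemma perm_cols_mat_GL_Zp:
  assumes f: "\<And>j. j < n \<Longrightarrow> f j < n" and ff: "\<And>j. j < n \<Longrightarrow> f (f j) = j"
  shows "(perm_cols_mat n f :: 'p :: prime_card padic mat) \<in> GL_Zp n"
proof (rule GL_ZpI)
  show "perm_cols_mat n f * perm_cols_mat n f = (1\<^sub>m n :: 'p padic mat)"
    by (subst mult_perm_cols_mat) (use f ff in \<open>auto simp: perm_cols_mat_def intro!: eq_matI\<close>)
qed (auto simp: integral_mat_def perm_cols_mat_def)

lemma four_block_triangular_GL_Zp:
  fixes a :: "'p :: prime_card padic"
  assumes "padic_norm a = 1" "D \<in> GL_Zp n" and B: "B \<in> carrier_mat 1 n" "integral_mat B"
    and C: "C \<in> carrier_mat n 1" "integral_mat C" and "B = 0\<^sub>m 1 n \<or> C = 0\<^sub>m n 1"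
  shows "four_block_mat (a \<cdot>\<^sub>m 1\<^sub>m 1) B C D \<in> GL_Zp (Suc n)"
proof -
  note D = GL_ZpD[OF assms(2)]
  let ?F = "four_block_mat (a \<cdot>\<^sub>m 1\<^sub>m 1) B C D"
  have "det ?F = det (a \<cdot>\<^sub>m 1\<^sub>m 1) * det D"
    using assms(7)
  proof
    assume "B = 0\<^sub>m 1 n"
    then show ?thesis by (intro det_four_block_mat_upper_right_zero[of _ 1 _ n]) (use C D in auto)
  next
    assume "C = 0\<^sub>m n 1"
    then show ?thesis by (intro det_four_block_mat_lower_left_zero[of _ 1 _ n]) (use B D in auto)
  qed
  then have "padic_norm (det ?F) = 1"
    using assms(1) D(3) by (simp add: padic_norm_mult)
  moreover have "?F \<in> carrier_mat (1 + n) (1 + n)"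
    by (rule four_block_carrier_mat) (use D in auto)
  moreover have "integral_mat ?F"
    unfolding integral_mat_def
  proof (intro allI impI)
    fix i j assume "i < dim_row ?F" "j < dim_col ?F"
    then have ij: "i < Suc n" "j < Suc n" using D by auto
    show "padic_norm (?F $$ (i, j)) \<le> 1"
      using ij D B C assms(1) by (cases i; cases j) (auto intro!: integral_matD)
  qed
  ultimately show ?thesis unfolding GL_Zp_iff by simp
qed

text \<open>One step of Gaussian elimination written as a factorisation; the lower right block in
  the middle is the Schur complement of the pivot.\<close>

lemma pivot_block_eq:
  fixes a :: "'a :: field"
  assumes "a \<noteq> 0" and b: "b \<in> carrier_mat 1 n" and c: "c \<in> carrier_mat m 1" and d: "d \<in> carrier_mat m n"
  shows "four_block_mat (1\<^sub>m 1) (0\<^sub>m 1 m) (inverse a \<cdot>\<^sub>m c) (1\<^sub>m m)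
      * four_block_mat (a \<cdot>\<^sub>m 1\<^sub>m 1) (0\<^sub>m 1 n) (0\<^sub>m m 1) (d - inverse a \<cdot>\<^sub>m (c * b))
      * four_block_mat (1\<^sub>m 1) (inverse a \<cdot>\<^sub>m b) (0\<^sub>m n 1) (1\<^sub>m n)
    = four_block_mat (a \<cdot>\<^sub>m 1\<^sub>m 1) b c d"
proof -
  have "four_block_mat (1\<^sub>m 1) (0\<^sub>m 1 m) (inverse a \<cdot>\<^sub>m c) (1\<^sub>m m)
      * four_block_mat (a \<cdot>\<^sub>m 1\<^sub>m 1) (0\<^sub>m 1 n) (0\<^sub>m m 1) (d - inverse a \<cdot>\<^sub>m (c * b))
    = four_block_mat (a \<cdot>\<^sub>m 1\<^sub>m 1) (0\<^sub>m 1 n) c (d - inverse a \<cdot>\<^sub>m (c * b))"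
    using assms by (subst mult_four_block_mat[of _ 1 1 _ m _ m _ _ 1 _ n])
      (auto intro!: cong_four_block_mat eq_matI)
  also have "\<dots> * four_block_mat (1\<^sub>m 1) (inverse a \<cdot>\<^sub>m b) (0\<^sub>m n 1) (1\<^sub>m n)
    = four_block_mat (a \<cdot>\<^sub>m 1\<^sub>m 1) b c d"
    using assms by (subst mult_four_block_mat[of _ 1 1 _ n _ m _ _ 1 _ n])
      (auto intro!: cong_four_block_mat eq_matI simp: mult_smult_distrib[of _ m 1] scalar_prod_def)
  finally show ?thesis .
qed

text \<open>Full row rank is carried through the induction as existence of a right inverse. Here
  \<open>M * (F * R)\<close> is a right inverse of the square matrix \<open>E\<close>, hence also a
  left inverse, and reassociation exhibits a right inverse of \<open>M\<close>.\<close>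

lemma right_inverse_transform:
  fixes C :: "'a :: field mat"
  assumes "E * M * F = C" "E \<in> carrier_mat m m" "M \<in> carrier_mat m n" "F \<in> carrier_mat n n"
    "R \<in> carrier_mat n m" "C * R = 1\<^sub>m m"
  shows "M * (F * R * E) = 1\<^sub>m m"
proof -
  have "E * (M * (F * R)) = 1\<^sub>m m"
    using assms(6) unfolding assms(1)[symmetric] using assms(2-5)
    by (simp add: assoc_mult_mat[of _ m m _ n] assoc_mult_mat[of _ m n _ n] assoc_mult_mat[of _ m n _ n _ m]
        assoc_mult_mat[of _ m m _ n _ m])
  then have "(M * (F * R)) * E = 1\<^sub>m m"
    using assms(2-5) by (intro mat_mult_left_right_inverse[of E m]) auto
  then show ?thesis
    using assms(2-5) by (simp add: assoc_mult_mat[of _ m n _ m])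
qed

text \<open>The column below the corner vanishes, so the first row of \<open>R\<close> does not
  enter the lower rows of the product and may be deleted.\<close>

lemma right_inverse_block:
  fixes C :: "'a :: field mat"
  assumes C: "C \<in> carrier_mat m n" and R: "R \<in> carrier_mat (Suc n) (Suc m)"
    and inv: "four_block_mat (a \<cdot>\<^sub>m 1\<^sub>m 1) (0\<^sub>m 1 n) (0\<^sub>m m 1) C * R = 1\<^sub>m (Suc m)"
  shows "C * mat n m (\<lambda>(i, j). R $$ (Suc i, Suc j)) = 1\<^sub>m m"
proof (rule eq_matI)
  let ?M = "four_block_mat (a \<cdot>\<^sub>m 1\<^sub>m 1) (0\<^sub>m 1 n) (0\<^sub>m m 1) C"
  have M: "?M \<in> carrier_mat (Suc m) (Suc n)" using four_block_carrier_mat[of "a \<cdot>\<^sub>m 1\<^sub>m 1" 1 1 C m n] C by simp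
  fix i j assume "i < dim_row (1\<^sub>m m)" "j < dim_col (1\<^sub>m m)"
  then have ij: "i < m" "j < m" by auto
  have "(C * mat n m (\<lambda>(i, j). R $$ (Suc i, Suc j))) $$ (i, j) = (\<Sum>k<n. C $$ (i, k) * R $$ (Suc k, Suc j))"
    using ij by (subst index_mult_mat_sum[OF C, of _ m]) auto
  also have "\<dots> = (\<Sum>k<Suc n. ?M $$ (Suc i, k) * R $$ (k, Suc j))"
    using ij C by (subst sum.lessThan_Suc_shift) auto
  also have "\<dots> = (?M * R) $$ (Suc i, Suc j)"
    using ij by (subst index_mult_mat_sum[OF M R]) auto
  also have "\<dots> = 1\<^sub>m m $$ (i, j)" unfolding inv using ij by simp
  finally show "(C * mat n m (\<lambda>(i, j). R $$ (Suc i, Suc j))) $$ (i, j) = 1\<^sub>m m $$ (i, j)" .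
qed (use C in auto)

lemma four_block_diag_powers:
  "four_block_mat ((of_nat CARD('p) powi z) \<cdot>\<^sub>m 1\<^sub>m 1) (0\<^sub>m 1 n) (0\<^sub>m m 1) (diag_powers m n ls)
    = (diag_powers (Suc m) (Suc n) (z # ls) :: 'p :: prime_card padic mat)"
  by (rule eq_matI) (auto simp: diag_powers_def nth_Cons')

text \<open>A transposition of rows and one of columns suffice. They are their own inverses, so the
  same two matrices also undo the move.\<close>

lemma max_entry_to_corner:
  fixes C :: "'p :: prime_card padic mat"
  assumes C: "C \<in> carrier_mat (Suc m) (Suc n)"
  obtains P Q where "P \<in> GL_Zp (Suc m)" "Q \<in> GL_Zp (Suc n)"
    "\<And>i j. i < Suc m \<Longrightarrow> j < Suc n \<Longrightarrow> padic_norm ((P * C * Q) $$ (i, j)) \<le> padic_norm ((P * C * Q) $$ (0, 0))"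
    "P * P = 1\<^sub>m (Suc m)" "Q * Q = 1\<^sub>m (Suc n)"
proof -
  define N where "N ij = padic_norm (C $$ ij)" for ij
  let ?I = "{..<Suc m} \<times> {..<Suc n}"
  have "Max (N ` ?I) \<in> N ` ?I" by (rule Max_in) auto
  then obtain i0 j0 where ij0: "i0 < Suc m" "j0 < Suc n" "N (i0, j0) = Max (N ` ?I)" by auto
  then have max: "N (i, j) \<le> N (i0, j0)" if "i < Suc m" "j < Suc n" for i j
    using that by (auto intro!: Max_ge)
  define f where "f i = (if i = 0 then i0 else if i = i0 then 0 else i)" for i
  define g where "g i = (if i = 0 then j0 else if i = j0 then 0 else i)" for i
  have f: "f i < Suc m" "f (f i) = i" if "i < Suc m" for i
    using that ij0 by (auto simp: f_def)
  have g: "g i < Suc n" "g (g i) = i" if "i < Suc n" for i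
    using that ij0 by (auto simp: g_def)
  define P :: "'p padic mat" where "P = perm_cols_mat (Suc m) f"
  define Q :: "'p padic mat" where "Q = perm_cols_mat (Suc n) g"
  have "P * C = mat (Suc m) (Suc n) (\<lambda>(i, j). C $$ (f i, j))"
    unfolding P_def by (rule perm_cols_mat_mult[OF C]) (use f in auto)
  then have PCQ: "P * C * Q = mat (Suc m) (Suc n) (\<lambda>(i, j). C $$ (f i, g j))"
    unfolding Q_def using g by (subst mult_perm_cols_mat[of _ "Suc m"]) auto
  show ?thesis
  proof (rule that[of P Q])
    show "P \<in> GL_Zp (Suc m)" unfolding P_def using f by (intro perm_cols_mat_GL_Zp) auto
    show "Q \<in> GL_Zp (Suc n)" unfolding Q_def using g by (intro perm_cols_mat_GL_Zp) auto
    show "P * P = 1\<^sub>m (Suc m)" unfolding P_def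
      by (subst mult_perm_cols_mat) (use f in \<open>auto simp: perm_cols_mat_def intro!: eq_matI\<close>)
    show "Q * Q = 1\<^sub>m (Suc n)" unfolding Q_def
      by (subst mult_perm_cols_mat) (use g in \<open>auto simp: perm_cols_mat_def intro!: eq_matI\<close>)
    fix i j assume "i < Suc m" "j < Suc n"
    then show "padic_norm ((P * C * Q) $$ (i, j)) \<le> padic_norm ((P * C * Q) $$ (0, 0))"
      unfolding PCQ using max[of "f i" "g j"] f g by (simp add: N_def) (simp add: f_def g_def)
  qed
qed

text \<open>
  The pivot is an entry of maximal norm, so the exponents come out in increasing order.
\<close>
lemma Smith_normal_form_increasing:
  fixes C :: "'p :: prime_card padic mat"
  assumes "C \<in> carrier_mat m n" "R \<in> carrier_mat n m" "C * R = 1\<^sub>m m"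
  shows "m \<le> n \<and> (\<exists>ls. length ls = m \<and> sorted ls \<and>
    (\<exists>U\<in>GL_Zp m. \<exists>V\<in>GL_Zp n. C = U * diag_powers m n ls * V))"
  using assms
proof (induction m arbitrary: n C R)
  case 0
  have "C = 1\<^sub>m 0 * diag_powers 0 n [] * 1\<^sub>m n" using 0 by (intro eq_matI) auto
  then have "\<exists>U\<in>GL_Zp 0. \<exists>V\<in>GL_Zp n. C = U * diag_powers 0 n [] * V" using GL_Zp_one by blast
  then show ?case by (intro conjI exI[of _ "[]"]) auto
next
  case (Suc m)
  have "n \<noteq> 0"
  proof
    assume "n = 0"
    then have "(C * R) $$ (0, 0) = 0" using Suc.prems(1,2) by (simp add: scalar_prod_def)
    then show False using Suc.prems(3) by simp
  qed
  then obtain k where n: "n = Suc k" by (cases n) auto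
  note C = Suc.prems(1)[unfolded n] and R = Suc.prems(2)[unfolded n] and inv = Suc.prems(3)
  obtain P Q where PQ: "P \<in> GL_Zp (Suc m)" "Q \<in> GL_Zp (Suc k)"
    and max: "\<And>i j. i < Suc m \<Longrightarrow> j < Suc k \<Longrightarrow> padic_norm ((P * C * Q) $$ (i, j)) \<le> padic_norm ((P * C * Q) $$ (0, 0))"
    and PP: "P * P = 1\<^sub>m (Suc m)" and QQ: "Q * Q = 1\<^sub>m (Suc k)"
    using max_entry_to_corner[OF C] by metis
  note P = GL_ZpD[OF PQ(1)] and Q = GL_ZpD[OF PQ(2)]
  define C' where "C' = P * C * Q"
  have C': "C' \<in> carrier_mat (Suc m) (Suc k)" using P Q C by (auto simp: C'_def)
  have CC': "C = P * C' * Q"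
  proof -
    have "P * C' * Q = (P * P) * C * (Q * Q)"
      unfolding C'_def using P(1) Q(1) C by (intro compression_reassoc) auto
    then show ?thesis using C by (simp add: PP QQ)
  qed
  define a where "a = C' $$ (0, 0)"
  define b where "b = mat 1 k (\<lambda>(i, j). C' $$ (0, Suc j))"
  define c where "c = mat m 1 (\<lambda>(i, j). C' $$ (Suc i, 0))"
  define d where "d = mat m k (\<lambda>(i, j). C' $$ (Suc i, Suc j))"
  have bcd: "b \<in> carrier_mat 1 k" "c \<in> carrier_mat m 1" "d \<in> carrier_mat m k"
    by (auto simp: b_def c_def d_def)
  have block: "C' = four_block_mat (a \<cdot>\<^sub>m 1\<^sub>m 1) b c d"
    by (rule eq_matI) (use C' in \<open>auto simp: a_def b_def c_def d_def\<close>)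
  have max': "padic_norm (C' $$ (i, j)) \<le> padic_norm a" if "i < Suc m" "j < Suc k" for i j
    using max[OF that] by (simp add: C'_def a_def)
  have "a \<noteq> 0"
  proof
    assume a: "a = 0"
    have "C' $$ (i, j) = 0" if "i < Suc m" "j < Suc k" for i j
      using max'[OF that] padic_norm_nonneg[of "C' $$ (i, j)"] by (simp add: a)
    then have "C' = 0\<^sub>m (Suc m) (Suc k)" using C' by (intro eq_matI) auto
    then have "C = 0\<^sub>m (Suc m) (Suc k)" unfolding CC' using P Q by simp
    then have "C * R = 0\<^sub>m (Suc m) (Suc m)" using R by simp
    then have "(1\<^sub>m (Suc m) :: 'p padic mat) $$ (0, 0) = 0" using inv by simp
    then show False by simp
  qed
  define d' where "d' = d - inverse a \<cdot>\<^sub>m (c * b)"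
  have d': "d' \<in> carrier_mat m k" 
    unfolding d'_def by (intro minus_carrier_mat smult_carrier_mat mult_carrier_mat[OF bcd(2,1)])
  define E where "E = four_block_mat (1\<^sub>m 1) (0\<^sub>m 1 m) (inverse a \<cdot>\<^sub>m c) (1\<^sub>m m)"
  define F where "F = four_block_mat (1\<^sub>m 1) (inverse a \<cdot>\<^sub>m b) (0\<^sub>m k 1) (1\<^sub>m k)"
  define M where "M = four_block_mat (a \<cdot>\<^sub>m 1\<^sub>m 1) (0\<^sub>m 1 k) (0\<^sub>m m 1) d'"
  have EMF: "E * M * F = C'"
    unfolding E_def M_def F_def d'_def block by (rule pivot_block_eq[OF \<open>a \<noteq> 0\<close> bcd])
  have apos: "padic_norm a > 0" using \<open>a \<noteq> 0\<close> padic_norm_pos by blast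
  \<comment> \<open>Here the maximality of the pivot is used: all multipliers are integral, which
    makes the elimination matrices unimodular.\<close>
  have ic: "integral_mat (inverse a \<cdot>\<^sub>m c)" "integral_mat (inverse a \<cdot>\<^sub>m b)"
    using max' apos by (auto simp: integral_mat_def c_def b_def padic_norm_divide field_simps)
  have one: "(1 \<cdot>\<^sub>m 1\<^sub>m 1 :: 'p padic mat) = 1\<^sub>m 1" by (rule eq_matI) auto
  have E: "E \<in> GL_Zp (Suc m)"
    unfolding E_def
    by (subst one[symmetric], rule four_block_triangular_GL_Zp)
      (use ic bcd GL_Zp_one in \<open>auto simp: integral_mat_def\<close>)
  have F: "F \<in> GL_Zp (Suc k)"
    unfolding F_def
    by (subst one[symmetric], rule four_block_triangular_GL_Zp)
      (use ic bcd GL_Zp_one in \<open>auto simp: integral_mat_def\<close>)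
  have M: "M \<in> carrier_mat (Suc m) (Suc k)" using four_block_carrier_mat[of "a \<cdot>\<^sub>m 1\<^sub>m 1" 1 1 d' m k] d' by (simp add: M_def)
  have R': "Q * R * P \<in> carrier_mat (Suc k) (Suc m)" using P Q R by auto
  have "C' * (Q * R * P) = 1\<^sub>m (Suc m)"
    by (rule right_inverse_transform[OF CC'[symmetric] P(1) C' Q(1) R inv])
  then have MR: "M * (F * (Q * R * P) * E) = 1\<^sub>m (Suc m)"
    by (rule right_inverse_transform[OF EMF GL_ZpD(1)[OF E] M GL_ZpD(1)[OF F] R'])
  have "F * (Q * R * P) * E \<in> carrier_mat (Suc k) (Suc m)"
    using R' GL_ZpD(1)[OF E] GL_ZpD(1)[OF F] by auto
  note d'R = right_inverse_block[OF d' this MR[unfolded M_def]]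
  obtain R'' where R'': "R'' \<in> carrier_mat k m" "d' * R'' = 1\<^sub>m m"
    by (rule that[OF mat_carrier d'R])
  obtain ls U V where mk: "m \<le> k" and ls: "length ls = m" "sorted ls"
    and UV: "U \<in> GL_Zp m" "V \<in> GL_Zp k" "d' = U * diag_powers m k ls * V"
    using Suc.IH[OF d' R''] by blast
  note U = GL_ZpD[OF UV(1)] and V = GL_ZpD[OF UV(2)]
  obtain z where z: "padic_norm a = real CARD('p) powi z"
    using padic_norm_values[OF \<open>a \<noteq> 0\<close>] by blast
  \<comment> \<open>The norm of the pivot is \<open>p\<close> to the power \<open>z\<close>, so its
    exponent is \<open>- z\<close>, and \<open>u\<close> is the remaining unit, which is absorbed
    into the left factor.\<close>
  define u where "u = a * of_nat CARD('p) powi z"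
  have p0: "(of_nat CARD('p) :: 'p padic) \<noteq> 0"
  proof -
    have "padic_norm (of_nat CARD('p) :: 'p padic) \<noteq> 0"
      unfolding padic_norm_of_nat_CARD using CARD_real_gt_1[where 'p = 'p] by simp
    then show ?thesis by (metis padic_norm_eq_0_iff)
  qed
  have u: "padic_norm u = 1"
    using CARD_real_gt_1[where 'p = 'p]
    by (simp add: u_def padic_norm_mult padic_norm_powi_CARD z power_int_minus)
  have au: "a = u * of_nat CARD('p) powi (- z)"
    using p0 by (simp add: u_def power_int_minus)
  \<comment> \<open>No entry of the Schur complement has larger norm than the pivot, so
    \<open>inverse a\<close> times it is integral. Multiplying by the inverses of \<open>U\<close>
    and \<open>V\<close> keeps integrality and exposes the diagonal entries divided by
    \<open>a\<close>.\<close>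
  have ge: "- z \<le> ls ! i" if i: "i < m" for i
  proof -
    obtain U' where U': "U' \<in> GL_Zp m" "U' * U = 1\<^sub>m m" using GL_Zp_inverse[OF UV(1)] by blast
    obtain V' where V': "V' \<in> GL_Zp k" "V * V' = 1\<^sub>m k" using GL_Zp_inverse[OF UV(2)] by blast
    note U'c = GL_ZpD[OF U'(1)] and V'c = GL_ZpD[OF V'(1)]
    have "U' * d' * V' = U' * U * diag_powers m k ls * (V * V')"
      unfolding UV(3) using U(1) V(1) U'c V'c by (intro compression_reassoc) auto
    then have D: "U' * d' * V' = diag_powers m k ls" by (simp add: U' V')
    have d'le: "padic_norm (d' $$ (r, s)) \<le> padic_norm a" if "r < m" "s < k" for r s
    proof -
      let ?t = "inverse a * (C' $$ (Suc r, 0) * C' $$ (0, Suc s))"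
      have "padic_norm ?t \<le> inverse (padic_norm a) * (padic_norm a * padic_norm a)"
        unfolding padic_norm_mult padic_norm_inverse using that
        by (intro mult_left_mono mult_mono max') (auto simp: padic_norm_nonneg)
      also have "\<dots> = padic_norm a"
        using less_imp_neq[OF apos] by (metis left_inverse mult.assoc mult_1)
      finally have t: "padic_norm ?t \<le> padic_norm a" .
      have "d' $$ (r, s) = C' $$ (Suc r, Suc s) - ?t"
        using that by (simp add: d'_def d_def c_def b_def scalar_prod_def)
      also have "padic_norm \<dots> \<le> padic_norm a"
        by (rule order_trans[OF padic_norm_diff]) (use t max'[of "Suc r" "Suc s"] that in simp)
      finally show ?thesis .
    qed
    define d1 where "d1 = inverse a \<cdot>\<^sub>m d'"
    have d1: "d1 \<in> carrier_mat m k" "integral_mat d1"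
      using d' d'le apos by (auto simp: d1_def integral_mat_def padic_norm_divide field_simps)
    have "integral_mat (U' * d1 * V')"
      using U'c V'c d1 by (intro integral_mat_mult[of _ m k _ k] integral_mat_mult[of _ m m _ k]) auto
    moreover have "U' * d1 * V' = inverse a \<cdot>\<^sub>m (U' * d' * V')"
      using U'c V'c d' by (simp add: d1_def mult_smult_distrib[of _ m m _ k] mult_smult_assoc_mat[of _ m k _ k])
    ultimately have "integral_mat (inverse a \<cdot>\<^sub>m (diag_powers m k ls :: 'p padic mat))" by (simp add: D)
    then have "padic_norm (inverse a * of_nat CARD('p) powi (ls ! i)) \<le> 1"
      using i mk by (auto simp: integral_mat_def diag_powers_def dest!: spec[of _ i])
    then have "inverse (real CARD('p) powi z) * real CARD('p) powi (- ls ! i) \<le> 1"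
      unfolding padic_norm_mult padic_norm_inverse padic_norm_powi_CARD z .
    then have "real CARD('p) powi (- ls ! i) \<le> real CARD('p) powi z"
      using apos[unfolded z] by (metis divide_inverse_commute mult_1 pos_divide_le_eq)
    then have "- ls ! i \<le> z"
      using power_int_strict_increasing[of z "- ls ! i" "real CARD('p)"] CARD_real_gt_1[where 'p = 'p]
      by linarith
    then show ?thesis by simp
  qed
  have sorted: "sorted (- z # ls)"
    using ls ge by (auto simp: in_set_conv_nth)
  define G where "G = four_block_mat (u \<cdot>\<^sub>m 1\<^sub>m 1) (0\<^sub>m 1 m) (0\<^sub>m m 1) U"
  define H where "H = four_block_mat (1\<^sub>m 1) (0\<^sub>m 1 k) (0\<^sub>m k 1) V"
  have G: "G \<in> GL_Zp (Suc m)" unfolding G_def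
    by (rule four_block_triangular_GL_Zp) (use u UV in \<open>auto simp: integral_mat_def\<close>)
  have H: "H \<in> GL_Zp (Suc k)"
    unfolding H_def
    by (subst one[symmetric], rule four_block_triangular_GL_Zp) (use UV in \<open>auto simp: integral_mat_def\<close>)
  let ?D = "diag_powers (Suc m) (Suc k) (- z # ls) :: 'p padic mat"
  have "M = G * ?D * H"
  proof -
    have "G * ?D = four_block_mat (a \<cdot>\<^sub>m 1\<^sub>m 1) (0\<^sub>m 1 k) (0\<^sub>m m 1) (U * diag_powers m k ls)"
      unfolding G_def four_block_diag_powers[symmetric] au using U
      by (subst mult_four_block_mat[of _ 1 1 _ m _ m _ _ 1 _ k]) (auto intro!: cong_four_block_mat eq_matI)
    also have "\<dots> * H = M"
      unfolding H_def M_def UV(3) using U V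
      by (subst mult_four_block_mat[of _ 1 1 _ k _ m _ _ 1 _ k]) (auto intro!: cong_four_block_mat eq_matI)
    finally show ?thesis by simp
  qed
  then have "C = P * (E * (G * ?D * H) * F) * Q" using CC' EMF by simp
  also have "\<dots> = (P * E) * (G * ?D * H) * (F * Q)"
    by (rule compression_reassoc) (use P(1) Q(1) GL_ZpD(1)[OF E] GL_ZpD(1)[OF F] GL_ZpD(1)[OF G] GL_ZpD(1)[OF H] in auto)
  also have "\<dots> = (P * E * G) * ?D * (H * (F * Q))"
    by (rule compression_reassoc) (use P(1) Q(1) GL_ZpD(1)[OF E] GL_ZpD(1)[OF F] GL_ZpD(1)[OF G] GL_ZpD(1)[OF H] in auto)
  finally have "C = (P * E * G) * ?D * (H * (F * Q))" .
  moreover have "P * E * G \<in> GL_Zp (Suc m)" "H * (F * Q) \<in> GL_Zp (Suc k)"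
    using PQ E F G H by (auto intro: GL_Zp_mult)
  ultimately show ?case
    using mk ls sorted n by (intro conjI exI[of _ "- z # ls"]) auto
qed

text \<open>\<open>is_SN\<close> asks for decreasing exponents, so the increasing list is reversed
  by permutation matrices. \<open>g\<close> reverses only the first \<open>m\<close> columns,
  because the diagonal ends there.\<close>

lemma ex_is_SN:
  fixes C :: "'p :: prime_card padic mat"
  assumes C: "C \<in> carrier_mat m n" "R \<in> carrier_mat n m" "C * R = 1\<^sub>m m"
  shows "m \<le> n" "\<exists>ls. is_SN C ls"
proof -
  obtain ls U V where mn: "m \<le> n" and ls: "length ls = m" "sorted ls"
    and UV: "U \<in> GL_Zp m" "V \<in> GL_Zp n" "C = U * diag_powers m n ls * V"
    using Smith_normal_form_increasing[OF assms] by blast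
  show "m \<le> n" by (rule mn)
  define f where "f i = m - Suc i" for i
  define g where "g i = (if i < m then m - Suc i else i)" for i
  have f: "f i < m" "f (f i) = i" if "i < m" for i using that by (auto simp: f_def)
  have g: "g i < n" "g (g i) = i" if "i < n" for i using that mn by (auto simp: g_def)
  define P :: "'p padic mat" where "P = perm_cols_mat m f"
  define Q :: "'p padic mat" where "Q = perm_cols_mat n g"
  let ?D = "\<lambda>ls. diag_powers m n ls :: 'p padic mat"
  have P: "P \<in> GL_Zp m" unfolding P_def using f by (intro perm_cols_mat_GL_Zp) auto
  have Q: "Q \<in> GL_Zp n" unfolding Q_def using g by (intro perm_cols_mat_GL_Zp) auto
  have "P * ?D (rev ls) = mat m n (\<lambda>(i, j). ?D (rev ls) $$ (f i, j))"
    unfolding P_def by (rule perm_cols_mat_mult) (use f in auto)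
  then have "P * ?D (rev ls) * Q = mat m n (\<lambda>(i, j). ?D (rev ls) $$ (f i, g j))"
    unfolding Q_def using g by (subst mult_perm_cols_mat[of _ m]) auto
  also have "\<dots> = ?D ls"
  proof (rule eq_matI)
    fix i j assume "i < dim_row (?D ls)" "j < dim_col (?D ls)"
    then have ij: "i < m" "j < n" by auto
    have "f i = g j \<longleftrightarrow> i = j" using ij by (auto simp: f_def g_def)
    then show "mat m n (\<lambda>(i, j). ?D (rev ls) $$ (f i, g j)) $$ (i, j) = ?D ls $$ (i, j)"
      using ij f(1)[OF ij(1)] g(1)[OF ij(2)] rev_nth[of "f i" ls] ls(1) f(2)[OF ij(1), unfolded f_def[of "f i"]]
      by (auto simp: diag_powers_def)
  qed auto
  finally have D: "?D ls = P * ?D (rev ls) * Q" by simp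
  have "C = U * (P * ?D (rev ls) * Q) * V" using UV D by simp
  also have "\<dots> = (U * P) * ?D (rev ls) * (Q * V)"
    by (rule compression_reassoc) (use GL_ZpD(1)[OF UV(1)] GL_ZpD(1)[OF UV(2)] GL_ZpD(1)[OF P] GL_ZpD(1)[OF Q] in auto)
  finally have "C = (U * P) * ?D (rev ls) * (Q * V)" .
  moreover have "U * P \<in> GL_Zp m" "Q * V \<in> GL_Zp n" using UV P Q by (auto intro: GL_Zp_mult)
  moreover have "sorted_wrt (\<ge>) (rev ls)" using ls(2) by (simp add: sorted_wrt_rev)
  ultimately have "is_SN C (rev ls)"
    unfolding is_SN_def carrier_matD[OF C(1)] using ls(1) by (intro conjI bexI[of _ "U * P"] bexI[of _ "Q * V"]) auto
  then show "\<exists>ls. is_SN C ls" by blast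
qed

section \<open>Singular numbers of truncated invertible matrices\<close>

lemma GL_inverse:
  fixes B :: "'a :: field mat"
  assumes "B \<in> GL n"
  obtains B' where "B' \<in> carrier_mat n n" "B * B' = 1\<^sub>m n" "B' * B = 1\<^sub>m n"
proof -
  obtain H where H: "B * H = 1\<^sub>m n" "H * B = 1\<^sub>m (dim_row H)" "B \<in> carrier_mat n n"
    using assms unfolding GL_def invertible_mat_def inverts_mat_def by auto
  have Hc: "H \<in> carrier_mat n n"
    using H by (metis carrier_matD(2) carrier_mat_triv index_mult_mat(3) index_one_mat(3))
  then show ?thesis using that H by simp
qed

lemma drop_rows_carrier: "B \<in> carrier_mat n m \<Longrightarrow> drop_rows i B \<in> carrier_mat (n - i) m"
  by (auto simp: drop_rows_def)

lemma coord_rows_mult_coord_cols: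
  assumes "s + q \<le> n"
  shows "coord_rows q s n * coord_cols n s q = (1\<^sub>m q :: 'a :: field mat)"
  by (subst coord_rows_mult) (use assms in \<open>auto simp: coord_cols_def intro!: eq_matI\<close>)

lemma drop_rows_mult:
  fixes B :: "'a :: field mat"
  assumes "B \<in> carrier_mat n n" "X \<in> carrier_mat n m" "i \<le> n"
  shows "drop_rows i (B * X) = drop_rows i B * X"
  unfolding drop_rows_eq_mult[OF mult_carrier_mat[OF assms(1,2)] assms(3)] drop_rows_eq_mult[OF assms(1,3)]
  by (rule assoc_mult_mat[symmetric, OF coord_carrier(2) assms(1,2)])

lemma drop_rows_right_inverse:
  fixes B :: "'a :: field mat"
  assumes "B \<in> carrier_mat n n" "B' \<in> carrier_mat n n" "B * B' = 1\<^sub>m n" "i \<le> n"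
  shows "drop_rows i B * (B' * coord_cols n i (n - i)) = 1\<^sub>m (n - i)"
proof -
  let ?K = "coord_cols n i (n - i) :: 'a mat"
  have "B * (B' * ?K) = ?K"
    using assoc_mult_mat[OF assms(1,2), of ?K "n - i"] assms(3) by simp
  moreover have "drop_rows i B * (B' * ?K) = coord_rows (n - i) i n * (B * (B' * ?K))"
    unfolding drop_rows_eq_mult[OF assms(1,4)] by (rule assoc_mult_mat) (use assms in auto)
  ultimately show ?thesis
    using assms by (simp add: coord_rows_mult_coord_cols)
qed

lemma ex_is_SN_drop_rows:
  fixes B :: "'p :: prime_card padic mat"
  assumes "B \<in> GL n" "i \<le> n"
  obtains ls where "is_SN (drop_rows i B) ls"
proof -
  have B: "B \<in> carrier_mat n n" using assms(1) by (simp add: GL_def)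
  obtain B' where B': "B' \<in> carrier_mat n n" "B * B' = 1\<^sub>m n" using GL_inverse[OF assms(1)] by blast
  have "\<exists>ls. is_SN (drop_rows i B) ls"
    by (rule ex_is_SN(2)[OF drop_rows_carrier[OF B] _ drop_rows_right_inverse[OF B B' assms(2)]]) (use B' in auto)
  then show ?thesis using that by blast
qed

lemma drop_rows_0: "drop_rows 0 B = B"
  by (rule eq_matI) (auto simp: drop_rows_def)

lemma is_SN_SN:
  assumes "B \<in> GL n" "i \<le> n"
  shows "is_SN (drop_rows i B) (SN (drop_rows i B))"
proof -
  obtain ls where ls: "is_SN (drop_rows i B) ls" using ex_is_SN_drop_rows[OF assms] .
  have "dim_row (drop_rows i B) \<le> dim_col (drop_rows i B)"
    using assms by (auto simp: GL_def drop_rows_def)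
  then show ?thesis using SN_eq[OF ls] ls by simp
qed

lemma is_SN_SN_square: "B \<in> GL n \<Longrightarrow> is_SN B (SN B)"
  using is_SN_SN[of B n 0] by (simp add: drop_rows_0)

section \<open>Volumes of row spans\<close>

text \<open>The largest norm of a maximal minor, that is, the volume of the lattice spanned by the
  rows. In contrast to \<open>max_minor\<close> the test matrices act only from the right, so that a
  square factor on the left can be pulled out.\<close>

definition row_volume :: "'p :: prime_card padic mat \<Rightarrow> real" where
  "row_volume C = Max ((\<lambda>X. padic_norm (det (C * X))) ` residue_mats (dim_col C) (dim_row C))"

lemma row_volume_ge:
  assumes "C \<in> carrier_mat m n" "X \<in> residue_mats n m"
  shows "padic_norm (det (C * X)) \<le> row_volume C"
  unfolding row_volume_def using assms by (auto intro!: Max_ge finite_imageI finite_residue_mats)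

lemma row_volume_attained:
  fixes C :: "'p :: prime_card padic mat"
  assumes "C \<in> carrier_mat m n"
  obtains X where "X \<in> residue_mats n m" "row_volume C = padic_norm (det (C * X))"
proof -
  have "row_volume C \<in> (\<lambda>X. padic_norm (det (C * X))) ` residue_mats (dim_col C) (dim_row C)"
    unfolding row_volume_def by (intro Max_in) (simp_all add: residue_mats_nonempty finite_residue_mats)
  then show ?thesis using that assms by auto
qed

text \<open>For \<open>q = m\<close> the left test matrix is square and its determinant, of norm at
  most 1, splits off. Testing from the right alone thus reaches the same maximum.\<close>

lemma row_volume_eq:
  fixes C :: "'p :: prime_card padic mat"
  assumes C: "is_SN C ls" "C \<in> carrier_mat m n" "m \<le> n"
  shows "row_volume C = real CARD('p) powi (- sum_list ls)"
proof -
  have len: "length ls = m" using C by (auto simp: is_SN_def)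
  have tail: "tail_sum m ls = sum_list ls" using tail_sum_length[of ls] len by simp
  obtain X where X: "X \<in> residue_mats n m" "row_volume C = padic_norm (det (C * X))"
    using row_volume_attained[OF C(2)] .
  have "row_volume C = padic_norm (det (1\<^sub>m m * C * X))" using X C by simp
  also have "\<dots> \<le> real CARD('p) powi (- sum_list ls)"
    unfolding tail[symmetric] by (rule det_compression_le[OF C]) (use residue_mats_carrier[OF X(1)] residue_mats_integral[OF X(1)] in auto)
  finally have le: "row_volume C \<le> real CARD('p) powi (- sum_list ls)" .
  obtain Y X' where YX: "Y \<in> residue_mats m m" "X' \<in> residue_mats n m"
    "padic_norm (det (Y * C * X')) = real CARD('p) powi (- sum_list ls)"
    using det_compression_attained[OF C, of m] tail by auto
  note Y = residue_mats_carrier[OF YX(1)] residue_mats_integral[OF YX(1)]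
  note X' = residue_mats_carrier[OF YX(2)]
  have "det (Y * C * X') = det Y * det (C * X')"
    using det_mult[OF Y(1), of "C * X'"] Y X' C by (simp add: assoc_mult_mat[of _ m m _ n])
  then have "real CARD('p) powi (- sum_list ls) = padic_norm (det Y) * padic_norm (det (C * X'))"
    using YX(3) by (simp add: padic_norm_mult)
  also have "\<dots> \<le> 1 * row_volume C"
    by (intro mult_mono padic_norm_det_le_1[OF Y] row_volume_ge[OF C(2) YX(2)]) (auto simp: padic_norm_nonneg)
  finally show ?thesis using le by simp
qed

text \<open>A logarithm of a finite maximum is visibly measurable and turns factors into summands;
  \<open>row_val_eq_sum_SN\<close> identifies it with the sum of singular numbers.\<close>

definition row_val :: "nat \<Rightarrow> 'p :: prime_card padic mat \<Rightarrow> real" where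
  "row_val i B = - log (real CARD('p)) (row_volume (drop_rows i B))"

lemma row_volume_drop_rows:
  fixes B :: "'p :: prime_card padic mat"
  assumes "B \<in> GL n" "i \<le> n"
  shows "row_volume (drop_rows i B) = real CARD('p) powi (- sum_list (SN (drop_rows i B)))"
proof -
  have B: "B \<in> carrier_mat n n" using assms(1) by (simp add: GL_def)
  show ?thesis
    by (rule row_volume_eq[OF is_SN_SN[OF assms] drop_rows_carrier[OF B]]) simp
qed

lemma row_volume_pos: "B \<in> GL n \<Longrightarrow> i \<le> n \<Longrightarrow> row_volume (drop_rows i B) > 0"
  for B :: "'p :: prime_card padic mat"
  using row_volume_drop_rows[of B n i] CARD_real_gt_1[where 'p = 'p] by simp

lemma log_powi: "b > 1 \<Longrightarrow> log b (b powi k) = real_of_int k"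
  by (simp add: powr_real_of_int' flip: powr_real_of_int')

lemma row_val_eq_sum_SN:
  fixes B :: "'p :: prime_card padic mat"
  assumes "B \<in> GL n" "i \<le> n"
  shows "row_val i B = real_of_int (sum_list (SN (drop_rows i B)))"
  unfolding row_val_def row_volume_drop_rows[OF assms]
  using CARD_real_gt_1[where 'p = 'p] by (subst log_powi) auto

text \<open>Digit matrices already realise the supremum over all integral test matrices, so the test
  matrix may be adapted to \<open>B\<close>.\<close>

lemma row_volume_integral_ge:
  fixes B :: "'p :: prime_card padic mat"
  assumes "B \<in> GL n" "i \<le> n" "X \<in> carrier_mat n (n - i)" "integral_mat X"
  shows "padic_norm (det (drop_rows i B * X)) \<le> row_volume (drop_rows i B)"
proof -
  have B: "B \<in> carrier_mat n n" using assms(1) by (simp add: GL_def)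
  note C = drop_rows_carrier[OF B, of i]
  let ?ls = "SN (drop_rows i B)"
  have len: "length ?ls = n - i" using is_SN_SN[OF assms(1,2)] C by (auto simp: is_SN_def)
  have "padic_norm (det (1\<^sub>m (n - i) * drop_rows i B * X)) \<le> real CARD('p) powi (- tail_sum (n - i) ?ls)"
    by (rule det_compression_le[OF is_SN_SN[OF assms(1,2)] C]) (use assms in auto)
  then show ?thesis
    using C tail_sum_length[of ?ls] unfolding len row_volume_drop_rows[OF assms(1,2)] by simp
qed

text \<open>Integrality bounds the volume by 1, and the last columns of the inverse, used as test
  matrix, give determinant 1.\<close>

lemma row_val_GL_Zp:
  assumes "V \<in> GL_Zp n" "i \<le> n"
  shows "row_val i V = 0"
proof -
  note V = GL_ZpD[OF assms(1)]
  obtain V' where V': "V' \<in> GL_Zp n" "V * V' = 1\<^sub>m n" using GL_Zp_inverse[OF assms(1)] by blast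
  note V'c = GL_ZpD[OF V'(1)]
  obtain X where X: "X \<in> residue_mats n (n - i)" "row_volume (drop_rows i V) = padic_norm (det (drop_rows i V * X))"
    using row_volume_attained[OF drop_rows_carrier[OF V(1)]] .
  have iV: "integral_mat (drop_rows i V)" using V by (auto simp: integral_mat_def drop_rows_def)
  have "row_volume (drop_rows i V) \<le> 1"
    unfolding X(2) using residue_mats_carrier[OF X(1)] residue_mats_integral[OF X(1)] drop_rows_carrier[OF V(1)] iV
    by (intro padic_norm_det_le_1[of _ "n - i"] integral_mat_mult[of _ _ n] mult_carrier_mat[of _ _ n]) auto
  moreover have "padic_norm (det (drop_rows i V * (V' * coord_cols n i (n - i)))) \<le> row_volume (drop_rows i V)"
    using V'c by (intro row_volume_integral_ge[OF GL_Zp_subset_GL[OF assms(1)] assms(2)] integral_mat_mult[of _ n n]) auto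
  then have "1 \<le> row_volume (drop_rows i V)"
    using drop_rows_right_inverse[OF V(1) V'c(1) V'(2) assms(2)] by simp
  ultimately have "row_volume (drop_rows i V) = 1" by simp
  then show ?thesis by (simp add: row_val_def)
qed

text \<open>The norm of \<open>det G\<close> is a common factor of all candidates in the
  maximum.\<close>

lemma row_volume_mult_left:
  fixes C :: "'p :: prime_card padic mat"
  assumes G: "G \<in> carrier_mat m m" and C: "C \<in> carrier_mat m n"
  shows "row_volume (G * C) = padic_norm (det G) * row_volume C"
proof -
  have "row_volume (G * C) = Max ((\<lambda>X. padic_norm (det G) * padic_norm (det (C * X))) ` residue_mats n m)"
    unfolding row_volume_def
  proof (intro arg_cong[of _ _ Max] image_cong)
    fix X :: "'p padic mat" assume "X \<in> residue_mats n m"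
    then have "X \<in> carrier_mat n m" by (rule residue_mats_carrier)
    then show "padic_norm (det (G * C * X)) = padic_norm (det G) * padic_norm (det (C * X))"
      using G C det_mult[OF G, of "C * X"] by (simp add: padic_norm_mult assoc_mult_mat[of _ m m _ n])
  qed (use G C in auto)
  also have "\<dots> = Max ((\<lambda>x. padic_norm (det G) * x) ` (\<lambda>X. padic_norm (det (C * X))) ` residue_mats n m)"
    by (simp add: image_image)
  also have "\<dots> = padic_norm (det G) * row_volume C"
    unfolding row_volume_def using C
    by (subst mono_Max_commute[symmetric])
      (auto intro!: monoI mult_left_mono simp: padic_norm_nonneg finite_residue_mats residue_mats_nonempty)
  finally show ?thesis .
qed

text \<open>Column operations over the ring of integers, from the bottom row upwards. In row
  \<open>r\<close> an entry of maximal norm among the columns up to \<open>r\<close> is moved to the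
  diagonal, so the multipliers are integral. Only columns up to \<open>r\<close> are changed, where
  the rows further down already vanish.\<close>

lemma ex_upper_triangular:
  fixes B :: "'p :: prime_card padic mat"
  assumes B: "B \<in> carrier_mat n n" and "q \<le> n"
  shows "\<exists>V\<in>GL_Zp n. \<forall>r c. n - q \<le> r \<longrightarrow> r < n \<longrightarrow> c < r \<longrightarrow> (B * V) $$ (r, c) = 0"
  using \<open>q \<le> n\<close>
proof (induction q)
  case 0
  then show ?case by (auto intro!: bexI[of _ "1\<^sub>m n"] GL_Zp_one)
next
  case (Suc q)
  then obtain V where V: "V \<in> GL_Zp n"
    and tri: "\<And>r c. n - q \<le> r \<Longrightarrow> r < n \<Longrightarrow> c < r \<Longrightarrow> (B * V) $$ (r, c) = 0" by auto
  define A where "A = B * V"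
  have A: "A \<in> carrier_mat n n" using B GL_ZpD(1)[OF V] by (auto simp: A_def)
  define r where "r = n - Suc q"
  have r: "r < n" "n - q = Suc r" "n - Suc q = r" using Suc.prems by (auto simp: r_def)
  define N where "N c = padic_norm (A $$ (r, c))" for c
  have "Max (N ` {..r}) \<in> N ` {..r}" by (rule Max_in) auto
  then obtain c0 where c0: "c0 \<le> r" "N c0 = Max (N ` {..r})" by (metis atMost_iff imageE)
  have max: "N c \<le> N c0" if "c \<le> r" for c using c0(2) that by (auto intro!: Max_ge)
  define f where "f c = (if c = r then c0 else if c = c0 then r else c)" for c
  have f: "f c < n" "f (f c) = c" if "c < n" for c using that c0 r by (auto simp: f_def)
  have fr: "f c \<le> r" if "c \<le> r" for c using that c0 by (auto simp: f_def)
  define P :: "'p padic mat" where "P = perm_cols_mat n f"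
  have P: "P \<in> GL_Zp n" unfolding P_def using f by (intro perm_cols_mat_GL_Zp) auto
  define A' where "A' = A * P"
  have A'_eq: "A' = mat n n (\<lambda>(i, j). A $$ (i, f j))"
    unfolding A'_def P_def using f by (intro mult_perm_cols_mat[OF A]) auto
  have A': "A' \<in> carrier_mat n n" by (simp add: A'_eq)
  have low: "A' $$ (i, j) = 0" if "r < i" "i < n" "j < i" for i j
  proof -
    have "f j < i" using that c0 by (auto simp: f_def)
    then show ?thesis using that tri[of i "f j"] r f[of j] by (simp add: A'_eq A_def)
  qed
  have piv: "padic_norm (A' $$ (r, c)) \<le> padic_norm (A' $$ (r, r))" if "c < r" for c
    using max[of "f c"] that fr[of c] r by (simp add: A'_eq N_def) (simp add: f_def)
  \<comment> \<open>If the pivot is 0, then by maximality so are the entries to its left, and the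
    convention \<open>x / 0 = 0\<close> makes the elimination trivial.\<close>
  define w where "w c = A' $$ (r, c) / A' $$ (r, r)" for c
  have w1: "padic_norm (w c) \<le> 1" if "c < r" for c
    using piv[OF that] padic_norm_nonneg[of "A' $$ (r, r)"]
    by (cases "A' $$ (r, r) = 0") (auto simp: w_def padic_norm_divide divide_le_eq_1 padic_norm_pos)
  \<comment> \<open>\<open>E (-1)\<close> performs the elimination and \<open>E 1\<close> is its
    inverse; the parameter lets one computation serve both.\<close>
  define E where "E s = mat n n (\<lambda>(i, j). if i = j then 1 else if i = r \<and> j < r then s * w j else 0)" for s :: "'p padic"
  have E: "E s \<in> carrier_mat n n" for s by (simp add: E_def)
  have mult_E: "X * E s = mat n n (\<lambda>(i, j). X $$ (i, j) + (if j < r then X $$ (i, r) * (s * w j) else 0))"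
    if X: "X \<in> carrier_mat n n" for X s
  proof (rule eq_matI)
    fix i j assume "i < dim_row (mat n n (\<lambda>(i, j). X $$ (i, j) + (if j < r then X $$ (i, r) * (s * w j) else 0)))"
      "j < dim_col (mat n n (\<lambda>(i, j). X $$ (i, j) + (if j < r then X $$ (i, r) * (s * w j) else 0)))"
    then have ij: "i < n" "j < n" by auto
    have "(X * E s) $$ (i, j) = (\<Sum>k<n. X $$ (i, k) * E s $$ (k, j))"
      by (rule index_mult_mat_sum[OF X E ij])
    also have "\<dots> = (\<Sum>k<n. (if k = j then X $$ (i, j) else 0) + (if k = r then if j < r then X $$ (i, r) * (s * w j) else 0 else 0))"
      using ij by (intro sum.cong) (auto simp: E_def)
    also have "\<dots> = X $$ (i, j) + (if j < r then X $$ (i, r) * (s * w j) else 0)"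
      using ij r by (simp add: sum.distrib)
    finally show "(X * E s) $$ (i, j) = mat n n (\<lambda>(i, j). X $$ (i, j) + (if j < r then X $$ (i, r) * (s * w j) else 0)) $$ (i, j)"
      using ij by simp
  qed (use X E in auto)
  have Eint: "integral_mat (E s)" if "padic_norm s = 1" for s
    using w1 that by (auto simp: E_def integral_mat_def padic_norm_mult)
  have "E (-1) * E 1 = 1\<^sub>m n"
    unfolding mult_E[OF E] using r by (intro eq_matI) (auto simp: E_def)
  then have EGL: "E (-1) \<in> GL_Zp n"
    using E Eint by (intro GL_ZpI[of _ n "E 1"]) (auto simp: padic_norm_uminus)
  have "B * (V * P * E (-1)) = A' * E (-1)"
    using B GL_ZpD(1)[OF V] GL_ZpD(1)[OF P] E
    by (simp add: A'_def A_def assoc_mult_mat[of _ n n _ n _ n])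
  moreover have "(A' * E (-1)) $$ (i, j) = 0" if "n - Suc q \<le> i" "i < n" "j < i" for i j
  proof (cases "i = r")
    case True
    have "A' $$ (r, j) = 0" if "A' $$ (r, r) = 0"
      using piv[of j] padic_norm_nonneg[of "A' $$ (r, j)"] that True \<open>j < i\<close> by simp
    then show ?thesis using that True unfolding mult_E[OF A'] by (auto simp: w_def)
  next
    case False
    then show ?thesis using that low[of i j] low[of i r] r unfolding mult_E[OF A'] by auto
  qed
  ultimately show ?case
    using V P EGL by (intro bexI[of _ "V * P * E (-1)"]) (auto intro: GL_Zp_mult)
qed

lemma Iwasawa_decomposition:
  fixes B :: "'p :: prime_card padic mat"
  assumes B: "B \<in> carrier_mat n n"
  obtains T V where "T \<in> carrier_mat n n" "upper_triangular T" "V \<in> GL_Zp n" "B = T * V"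
proof -
  obtain V where V: "V \<in> GL_Zp n" and tri: "\<And>r c. r < n \<Longrightarrow> c < r \<Longrightarrow> (B * V) $$ (r, c) = 0"
    using ex_upper_triangular[OF B, of n] by auto
  obtain V' where V': "V' \<in> GL_Zp n" "V * V' = 1\<^sub>m n" using GL_Zp_inverse[OF V] by blast
  have "B = B * V * V'"
    using B GL_ZpD(1)[OF V] GL_ZpD(1)[OF V'(1)] V'(2) by (simp add: assoc_mult_mat[of _ n n _ n _ n])
  moreover have "upper_triangular (B * V)" using tri B by auto
  moreover have "B * V \<in> carrier_mat n n" using B GL_ZpD(1)[OF V] by auto
  ultimately show ?thesis using that V'(1) by blast
qed

text \<open>For \<open>k \<ge> i\<close>, row \<open>k\<close> of \<open>T * X\<close> involves only
  rows of \<open>X\<close> with index at least \<open>k\<close>, all of which survive the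
  truncation.\<close>

lemma drop_rows_triangular_mult:
  fixes T :: "'a :: field mat"
  assumes T: "T \<in> carrier_mat n n" "upper_triangular T" and X: "X \<in> carrier_mat n m" and i: "i \<le> n"
  shows "drop_rows i (T * X) = mat (n - i) (n - i) (\<lambda>(r, c). T $$ (r + i, c + i)) * drop_rows i X"
proof (rule eq_matI)
  let ?Ti = "mat (n - i) (n - i) (\<lambda>(r, c). T $$ (r + i, c + i))"
  fix r c assume "r < dim_row (?Ti * drop_rows i X)" "c < dim_col (?Ti * drop_rows i X)"
  then have rc: "r < n - i" "c < m" using X by (auto simp: drop_rows_def)
  have "drop_rows i (T * X) $$ (r, c) = (T * X) $$ (r + i, c)"
    using rc T X by (simp add: drop_rows_def)
  also have "\<dots> = (\<Sum>k<n. T $$ (r + i, k) * X $$ (k, c))"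
    using rc by (intro index_mult_mat_sum[OF T(1) X]) auto
  also have "\<dots> = (\<Sum>k\<in>{i..<n}. T $$ (r + i, k) * X $$ (k, c))"
    using T rc by (intro sum.mono_neutral_right) (auto simp: upper_triangular_def)
  also have "\<dots> = (\<Sum>k<n - i. T $$ (r + i, k + i) * X $$ (k + i, c))"
    by (rule sum.reindex_bij_witness[of _ "\<lambda>k. k + i" "\<lambda>k. k - i"]) auto
  also have "\<dots> = (?Ti * drop_rows i X) $$ (r, c)"
    using rc X by (subst index_mult_mat_sum[of _ "n - i" "n - i" _ m]) (auto simp: drop_rows_def)
  finally show "drop_rows i (T * X) $$ (r, c) = (?Ti * drop_rows i X) $$ (r, c)" .
qed (use T X in \<open>auto simp: drop_rows_def\<close>)

text \<open>The triangular factor contributes the same amount to \<open>B * A = T * (V * A)\<close>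
  and to \<open>B = T * V\<close>, and the value of \<open>V\<close> is 0. One \<open>V\<close>
  serves all \<open>i\<close> and \<open>A\<close> at once, so the increments of the whole vector
  are governed by the single matrix \<open>V * A\<close>.\<close>

lemma row_val_mult:
  fixes B A :: "'p :: prime_card padic mat"
  assumes "B \<in> GL n"
  obtains V where "V \<in> GL_Zp n"
    "\<And>A i. A \<in> GL n \<Longrightarrow> i \<le> n \<Longrightarrow> row_val i (B * A) - row_val i B = row_val i (V * A)"
proof -
  have B: "B \<in> carrier_mat n n" using assms by (simp add: GL_def)
  obtain T V where T: "T \<in> carrier_mat n n" "upper_triangular T" and V: "V \<in> GL_Zp n" and BTV: "B = T * V"
    using Iwasawa_decomposition[OF B] .
  note Vc = GL_ZpD(1)[OF V]
  have "det B = det T * det V" unfolding BTV by (rule det_mult[OF T(1) Vc])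
  then have detT: "det T \<noteq> 0" using assms by (auto simp: GL_iff_det)
  have *: "row_val i (T * X) = - log (real CARD('p)) (padic_norm (det (mat (n - i) (n - i) (\<lambda>(r, c). T $$ (r + i, c + i))))) + row_val i X"
    if X: "X \<in> GL n" and i: "i \<le> n" for X :: "'p padic mat" and i
  proof -
    let ?Ti = "mat (n - i) (n - i) (\<lambda>(r, c). T $$ (r + i, c + i))"
    have Xc: "X \<in> carrier_mat n n" using X by (simp add: GL_def)
    have "det ?Ti \<noteq> 0"
    proof -
      have "T $$ (k, k) \<noteq> 0" if "k < n" for k
        using detT upper_triangular_imp_det_eq_0_iff[OF T] that T(1) by (auto simp: diag_mat_def)
      moreover have "upper_triangular ?Ti" using T by (auto simp: upper_triangular_def)
      ultimately show ?thesis
        using upper_triangular_imp_det_eq_0_iff[of ?Ti "n - i"] by (auto simp: diag_mat_def)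
    qed
    moreover have "row_volume (drop_rows i (T * X)) = padic_norm (det ?Ti) * row_volume (drop_rows i X)"
      unfolding drop_rows_triangular_mult[OF T Xc i] by (rule row_volume_mult_left[OF _ drop_rows_carrier[OF Xc]]) simp
    ultimately show ?thesis
      using row_volume_pos[OF X i] CARD_real_gt_1[where 'p = 'p]
      by (simp add: row_val_def log_mult padic_norm_pos)
  qed
  have "row_val i (B * A) - row_val i B = row_val i (V * A)" if A: "A \<in> GL n" and i: "i \<le> n" for A i
  proof -
    have "B * A = T * (V * A)"
      unfolding BTV using A by (intro assoc_mult_mat[OF T(1) Vc, of A n]) (simp add: GL_def)
    then show ?thesis
      using *[OF GL_mult[OF GL_Zp_subset_GL[OF V] A] i] *[OF GL_Zp_subset_GL[OF V] i] row_val_GL_Zp[OF V i]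
      unfolding BTV by simp
  qed
  then show ?thesis using that V by blast
qed

section \<open>Deviation of the last rows from the singular numbers\<close>

lemma GL_carrier: "B \<in> GL n \<Longrightarrow> B \<in> carrier_mat n n"
  by (simp add: GL_def)

lemma SN_props:
  assumes "B \<in> GL n"
  shows "is_SN B (SN B)" "length (SN B) = n"
  using is_SN_SN_square[OF assms] GL_carrier[OF assms] by (auto simp: is_SN_def)

text \<open>Selecting the last \<open>q\<close> rows is one particular integral compression from the
  left, and \<open>det_compression_le\<close> bounds all of them by the \<open>q\<close> smallest
  singular numbers.\<close>

lemma tail_sum_le_row_val:
  fixes B :: "'p :: prime_card padic mat"
  assumes B: "B \<in> GL n" and "q \<le> n"
  shows "real_of_int (tail_sum q (SN B)) \<le> row_val (n - q) B"
proof -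
  note Bc = GL_carrier[OF B]
  have q: "n - (n - q) = q" using \<open>q \<le> n\<close> by simp
  obtain X where X: "X \<in> residue_mats n q" "row_volume (drop_rows (n - q) B) = padic_norm (det (drop_rows (n - q) B * X))"
    using row_volume_attained[OF drop_rows_carrier[OF Bc, of "n - q"]] q by auto
  have "row_volume (drop_rows (n - q) B) = padic_norm (det (coord_rows q (n - q) n * B * X))"
    unfolding X(2) using drop_rows_eq_mult[OF Bc, of "n - q"] q by simp
  also have "\<dots> \<le> real CARD('p) powi (- tail_sum q (SN B))"
    by (rule det_compression_le[OF SN_props(1)[OF B] Bc])
      (use residue_mats_carrier[OF X(1)] residue_mats_integral[OF X(1)] in auto)
  finally have "log (real CARD('p)) (row_volume (drop_rows (n - q) B)) \<le> log (real CARD('p)) (real CARD('p) powi (- tail_sum q (SN B)))"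
    using row_volume_pos[OF B, of "n - q"] CARD_real_gt_1[where 'p = 'p] by (subst log_le_cancel_iff) auto
  then show ?thesis
    using CARD_real_gt_1[where 'p = 'p] by (simp add: row_val_def log_powi)
qed

lemma SN_mult_left:
  assumes B: "B \<in> GL n" and U: "U \<in> GL_Zp n"
  shows "SN (U * B) = SN B"
proof -
  note Bc = GL_carrier[OF B] and Uc = GL_ZpD(1)[OF U]
  obtain U0 V where UV: "length (SN B) = n" "sorted_wrt (\<ge>) (SN B)" "U0 \<in> GL_Zp n" "V \<in> GL_Zp n"
    "B = U0 * diag_powers n n (SN B) * V"
    using is_SND[OF SN_props(1)[OF B]] Bc by (metis carrier_matD)
  have "U * B = U * (U0 * diag_powers n n (SN B) * V) * 1\<^sub>m n"
    using UV(5) Bc Uc by simp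
  also have "\<dots> = (U * U0) * diag_powers n n (SN B) * (V * 1\<^sub>m n)"
    by (rule compression_reassoc) (use Uc GL_ZpD(1)[OF UV(3)] GL_ZpD(1)[OF UV(4)] in auto)
  finally have "U * B = (U * U0) * diag_powers n n (SN B) * V" using GL_ZpD(1)[OF UV(4)] by simp
  moreover have dims: "dim_row (U * B) = n" "dim_col (U * B) = n" using Uc Bc by auto
  ultimately have "is_SN (U * B) (SN B)"
    unfolding is_SN_def dims using UV GL_Zp_mult[OF U UV(3)]
    by (intro conjI bexI[of _ "U * U0"] bexI[of _ V]) auto
  then show ?thesis using dims by (intro SN_eq) auto
qed

section \<open>Counting over the congruence subgroup\<close>

lemma cofactor_cong_row:
  assumes "A \<in> carrier_mat n n" "A' \<in> carrier_mat n n" "a < n"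
    and "\<And>i j. i < n \<Longrightarrow> j < n \<Longrightarrow> i \<noteq> a \<Longrightarrow> A $$ (i, j) = A' $$ (i, j)"
  shows "cofactor A a j = cofactor A' a j"
proof -
  have "mat_delete A a j = mat_delete A' a j"
    unfolding mat_delete_def using assms by (intro eq_matI) auto
  then show ?thesis by (simp add: cofactor_def)
qed

lemma padic_norm_sum_less:
  "finite A \<Longrightarrow> 0 < c \<Longrightarrow> (\<And>i. i \<in> A \<Longrightarrow> padic_norm (f i) < c) \<Longrightarrow> padic_norm (sum f A) < c"
proof (induction A rule: finite_induct)
  case (insert x A)
  then have "padic_norm (f x) < c" "padic_norm (sum f A) < c" by auto
  then show ?case using padic_norm_add[of "f x" "sum f A"] insert(1,2) by simp
qed simp

text \<open>Identity plus \<open>p\<close> times a matrix of naturals. The parameters are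
  unconstrained, so drawing them from \<open>{..<CARD('p) ^ t}\<close> gives a product set, on which
  one coordinate can be changed with the others fixed.\<close>

definition congruence_mat :: "nat \<Rightarrow> (nat \<times> nat \<Rightarrow> nat) \<Rightarrow> 'p :: prime_card padic mat" where
  "congruence_mat n f = mat n n (\<lambda>(i, j). (if i = j then 1 else 0) + of_nat CARD('p) * of_nat (f (i, j)))"

lemma congruence_mat_carrier: "congruence_mat n f \<in> carrier_mat n n"
  by (simp add: congruence_mat_def)

text \<open>The matrix is within \<open>1 / p\<close> of the identity, hence its determinant is
  within \<open>1 / p\<close> of 1 and has norm 1, whatever the parameters are.\<close>

lemma congruence_mat_GL_Zp: "(congruence_mat n f :: 'p :: prime_card padic mat) \<in> GL_Zp n"
proof -
  let ?G = "congruence_mat n f :: 'p padic mat"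
  have less: "1 / real CARD('p) < 1" using CARD_real_gt_1[where 'p = 'p] by simp
  have small: "padic_norm ((of_nat CARD('p) :: 'p padic) * of_nat k) \<le> 1 / real CARD('p)" for k
    unfolding padic_norm_mult padic_norm_of_nat_CARD
    using mult_left_mono[OF padic_norm_of_nat_le_1[of k, where 'a = 'p], of "1 / real CARD('p)"] by simp
  have int: "integral_mat ?G"
    unfolding integral_mat_def
  proof (intro allI impI)
    fix i j assume "i < dim_row ?G" "j < dim_col ?G"
    then have "?G $$ (i, j) = (if i = j then 1 else 0) + of_nat CARD('p) * of_nat (f (i, j))"
      by (simp add: congruence_mat_def)
    also have "padic_norm \<dots> \<le> 1"
      by (rule order_trans[OF padic_norm_add])
        (use order_trans[OF small[of "f (i, j)"] less_imp_le[OF less]] in simp)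
    finally show "padic_norm (?G $$ (i, j)) \<le> 1" .
  qed
  have "padic_norm (det ?G - det (1\<^sub>m n)) \<le> 1 / real CARD('p)"
    by (rule padic_norm_det_diff_le[OF congruence_mat_carrier int one_carrier_mat])
      (use small in \<open>auto simp: congruence_mat_def\<close>)
  from order.strict_trans1[OF this less] have "padic_norm (1 + (det ?G - 1)) = padic_norm (1 :: 'p padic)"
    by (intro padic_norm_add_eq) simp
  then show ?thesis using int congruence_mat_carrier by (simp add: GL_Zp_iff)
qed

text \<open>
  The rows of \<open>drop_rows (n - q) G * W\<close> are substituted one at a time for the rows of the identity
  matrix.  The step is linear in the new row, and one of the coefficients of the free parameters of
  this row is at least as large as the previous determinant, because the rows of \<open>W\<close> generate the
  unit vectors; hence a step loses a factor \<open>p ^ (t + 1)\<close> or more only for a proportion of at most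
  \<open>p ^ (- t)\<close> of the parameters.
\<close>
lemma card_small_det_step:
  fixes W Y :: "'p :: prime_card padic mat" and t :: nat
  assumes W: "W \<in> carrier_mat n q" and Y: "Y \<in> carrier_mat q n" "integral_mat Y" and YW: "Y * W = 1\<^sub>m q"
    and "q \<le> n" and a: "a < q"
  defines "F \<equiv> ({..<n} \<times> {..<n}) \<rightarrow>\<^sub>E {..<CARD('p) ^ t}"
  defines "R \<equiv> \<lambda>f r c. W $$ (n - q + r, c) + of_nat CARD('p) * (\<Sum>j<n. of_nat (f (n - q + r, j)) * W $$ (j, c))"
  defines "D \<equiv> \<lambda>a f. det (mat q q (\<lambda>(r, c). if r < a then R f r c else if r = c then 1 else 0))"
  shows "card {f \<in> F. D a f \<noteq> 0 \<and> padic_norm (D (Suc a) f) \<le> padic_norm (D a f) / real CARD('p) ^ Suc t} * CARD('p) ^ t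
    \<le> card F"
proof -
  define bad where "bad = {f \<in> F. D a f \<noteq> 0 \<and> padic_norm (D (Suc a) f) \<le> padic_norm (D a f) / real CARD('p) ^ Suc t}"
  \<comment> \<open>Cofactors along row \<open>a\<close> see only the other rows. They are common to
    \<open>D a\<close> and \<open>D (Suc a)\<close>, and independent of the parameters that enter
    row \<open>a\<close>.\<close>
  define \<kappa> where "\<kappa> f c = cofactor (mat q q (\<lambda>(r, c). if r < a then R f r c else if r = c then 1 else 0)) a c" for f c
  have detexp: "det A = (\<Sum>c<q. A $$ (a, c) * \<kappa> f c)"
    if A: "A \<in> carrier_mat q q" "\<And>r c. r < q \<Longrightarrow> c < q \<Longrightarrow> r \<noteq> a \<Longrightarrow> A $$ (r, c) = (if r < a then R f r c else if r = c then 1 else 0)"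
    for A f
    unfolding \<kappa>_def laplace_expansion_row[OF A(1) a]
    by (intro sum.cong refl arg_cong2[of _ _ _ _ "(*)"] cofactor_cong_row[OF A(1) _ a]) (use A a in auto)
  \<comment> \<open>Up to the factor \<open>p\<close>, \<open>L f j\<close> is the coefficient of
    the parameter \<open>f (n - q + a, j)\<close> in \<open>D (Suc a) f\<close>.\<close>
  define L where "L f j = (\<Sum>c<q. W $$ (j, c) * \<kappa> f c)" for f j
  have Da: "D a f = \<kappa> f a" for f
  proof -
    have "D a f = (\<Sum>c<q. (if a = c then 1 else 0) * \<kappa> f c)"
      unfolding D_def by (subst detexp[of _ f]) (use a in auto)
    also have "\<dots> = (\<Sum>c<q. if c = a then \<kappa> f a else 0)" by (intro sum.cong) auto
    finally show ?thesis using a by simp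
  qed
  have DSa: "D (Suc a) f = L f (n - q + a) + of_nat CARD('p) * (\<Sum>j<n. of_nat (f (n - q + a, j)) * L f j)" for f
  proof -
    have "D (Suc a) f = (\<Sum>c<q. R f a c * \<kappa> f c)"
      unfolding D_def by (subst detexp[of _ f]) (use a in \<open>auto simp: less_Suc_eq\<close>)
    also have "\<dots> = L f (n - q + a) + of_nat CARD('p) * (\<Sum>c<q. \<Sum>j<n. of_nat (f (n - q + a, j)) * W $$ (j, c) * \<kappa> f c)"
      unfolding R_def L_def by (simp add: distrib_right sum.distrib sum_distrib_left sum_distrib_right mult.assoc)
    also have "(\<Sum>c<q. \<Sum>j<n. of_nat (f (n - q + a, j)) * W $$ (j, c) * \<kappa> f c) = (\<Sum>j<n. of_nat (f (n - q + a, j)) * L f j)"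
      unfolding L_def by (subst sum.swap) (simp add: sum_distrib_left mult.assoc)
    finally show ?thesis .
  qed
  \<comment> \<open>Combining the \<open>L f j\<close> with the integral row \<open>a\<close> of
    \<open>Y\<close> returns \<open>\<kappa> f a\<close>, because \<open>Y * W\<close> is the
    identity. If all of them had smaller norm, so would the combination.\<close>
  have exL: "\<exists>j. j < n \<and> padic_norm (\<kappa> f a) \<le> padic_norm (L f j)" if "\<kappa> f a \<noteq> 0" for f
  proof (rule ccontr)
    assume "\<nexists>j. j < n \<and> padic_norm (\<kappa> f a) \<le> padic_norm (L f j)"
    then have less: "padic_norm (L f j) < padic_norm (\<kappa> f a)" if "j < n" for j using that by (meson not_le)
    have "(\<Sum>j<n. Y $$ (a, j) * L f j) = (\<Sum>c<q. (\<Sum>j<n. Y $$ (a, j) * W $$ (j, c)) * \<kappa> f c)"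
      unfolding L_def sum_distrib_left sum_distrib_right by (subst sum.swap) (simp add: mult.assoc)
    also have "\<dots> = (\<Sum>c<q. if c = a then \<kappa> f a else 0)"
    proof (rule sum.cong[OF refl])
      fix c assume "c \<in> {..<q}"
      then have c: "c < q" by simp
      have "(\<Sum>j<n. Y $$ (a, j) * W $$ (j, c)) = (Y * W) $$ (a, c)"
        by (rule index_mult_mat_sum[OF Y(1) W a c, symmetric])
      then show "(\<Sum>j<n. Y $$ (a, j) * W $$ (j, c)) * \<kappa> f c = (if c = a then \<kappa> f a else 0)"
        unfolding YW using a c by simp
    qed
    also have "\<dots> = \<kappa> f a" using a by simp
    finally have eq: "(\<Sum>j<n. Y $$ (a, j) * L f j) = \<kappa> f a" .
    have "padic_norm (\<Sum>j<n. Y $$ (a, j) * L f j) < padic_norm (\<kappa> f a)"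
    proof (rule padic_norm_sum_less)
      fix j assume "j \<in> {..<n}"
      then have j: "j < n" by simp
      have "padic_norm (Y $$ (a, j) * L f j) \<le> 1 * padic_norm (L f j)"
        unfolding padic_norm_mult using Y a j by (intro mult_right_mono integral_matD) (auto simp: padic_norm_nonneg)
      then show "padic_norm (Y $$ (a, j) * L f j) < padic_norm (\<kappa> f a)" using less[OF j] by simp
    qed (use that padic_norm_pos in auto)
    then show False by (simp add: eq)
  qed
  \<comment> \<open>The least admissible index depends on \<open>f\<close> only through
    \<open>\<kappa> f\<close> and \<open>L f\<close>, so overwriting a parameter of row
    \<open>n - q + a\<close> does not move it. This makes the map below decodable.\<close>
  define J where "J f = (LEAST j. j < n \<and> padic_norm (\<kappa> f a) \<le> padic_norm (L f j))" for f
  have J: "J f < n" "padic_norm (\<kappa> f a) \<le> padic_norm (L f (J f))" if "\<kappa> f a \<noteq> 0" for f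
    using LeastI_ex[OF exL[OF that]] by (auto simp: J_def)
  have R_upd: "R (f((n - q + a, x) := y)) r c = R f r c" if "r < a" for f x y r c
    using that by (simp add: R_def)
  have \<kappa>_upd: "\<kappa> (f((n - q + a, x) := y)) = \<kappa> f" for f x y
    unfolding \<kappa>_def using R_upd
    by (intro ext arg_cong[of _ _ "\<lambda>M. cofactor M a _"] eq_matI) auto
  have L_upd: "L (f((n - q + a, x) := y)) = L f" for f x y
    by (intro ext) (simp add: L_def \<kappa>_upd)
  have J_upd: "J (f((n - q + a, x) := y)) = J f" for f x y
    by (simp add: J_def L_upd \<kappa>_upd)
  \<comment> \<open>The count is an injection of \<open>bad\<close> times the parameter range into
    \<open>F\<close>: the decisive parameter is overwritten by an arbitrary \<open>y\<close>. The
    image reveals \<open>y\<close>, the position, and all other parameters of \<open>f\<close>;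
    badness then determines the lost one.\<close>
  define \<Phi> where "\<Phi> = (\<lambda>(f, y). f((n - q + a, J f) := y :: nat))"
  have "inj_on \<Phi> (bad \<times> {..<CARD('p) ^ t})"
  proof (rule inj_onI, clarify)
    fix f y f' y'
    assume f: "f \<in> bad" and f': "f' \<in> bad" and eq: "\<Phi> (f, y) = \<Phi> (f', y')"
    define j where "j = J f"
    have eq': "f((n - q + a, J f) := y) = f'((n - q + a, J f') := y')" using eq by (simp add: \<Phi>_def)
    have JJ: "J f' = j" unfolding j_def using J_upd[of f "J f" y] J_upd[of f' "J f'" y'] by (simp add: eq')
    have \<kappa>\<kappa>: "\<kappa> f' = \<kappa> f" using \<kappa>_upd[of f "J f" y] \<kappa>_upd[of f' "J f'" y'] by (simp add: eq')
    have LL: "L f' = L f" using L_upd[of f "J f" y] L_upd[of f' "J f'" y'] by (simp add: eq')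
    have eq2: "f((n - q + a, j) := y) = f'((n - q + a, j) := y')" using eq' JJ j_def by simp
    have y: "y = y'" using fun_cong[OF eq2, of "(n - q + a, j)"] by simp
    have agree: "f' z = f z" if "z \<noteq> (n - q + a, j)" for z
      using fun_cong[OF eq2, of z] that by simp
    have \<kappa>0: "\<kappa> f a \<noteq> 0" using f Da by (simp add: bad_def)
    have j: "j < n" "padic_norm (\<kappa> f a) \<le> padic_norm (L f j)" using J[OF \<kappa>0] by (auto simp: j_def)
    define x where "x = f (n - q + a, j)"
    define x' where "x' = f' (n - q + a, j)"
    have "D (Suc a) f - D (Suc a) f' = of_nat CARD('p) * (\<Sum>i<n. of_nat (f (n - q + a, i)) * L f i - of_nat (f' (n - q + a, i)) * L f i)"
      unfolding DSa LL by (simp add: sum_subtractf right_diff_distrib)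
    also have "(\<Sum>i<n. of_nat (f (n - q + a, i)) * L f i - of_nat (f' (n - q + a, i)) * L f i)
        = (\<Sum>i<n. if i = j then (of_nat x - of_nat x') * L f j else 0)"
      using agree by (intro sum.cong) (auto simp: x_def x'_def left_diff_distrib)
    also have "\<dots> = of_int (int x - int x') * L f j" using j(1) by simp
    finally have diff: "D (Suc a) f - D (Suc a) f' = of_nat CARD('p) * (of_int (int x - int x') * L f j)" .
    \<comment> \<open>One of the \<open>Suc t\<close> powers of \<open>p\<close> is consumed by the
      factor \<open>p\<close> in front of the parameters. The remaining \<open>t\<close> give
      divisibility of \<open>int x - int x'\<close> by \<open>p ^ t\<close>, which exceeds its
      absolute value.\<close>
    let ?e = "padic_norm (\<kappa> f a) / real CARD('p) ^ Suc t"
    have "padic_norm (D (Suc a) f) \<le> ?e" "padic_norm (D (Suc a) f') \<le> ?e"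
      using f f' by (auto simp: bad_def Da \<kappa>\<kappa>)
    then have "padic_norm (D (Suc a) f - D (Suc a) f') \<le> ?e"
      using padic_norm_diff[of "D (Suc a) f" "D (Suc a) f'"] by simp
    also have "\<dots> \<le> padic_norm (L f j) / real CARD('p) ^ Suc t"
      by (rule divide_right_mono) (use j in auto)
    finally have "padic_norm (of_int (int x - int x') :: 'p padic) * padic_norm (L f j) / real CARD('p) \<le> padic_norm (L f j) / real CARD('p) ^ Suc t"
      unfolding diff padic_norm_mult padic_norm_of_nat_CARD by simp
    moreover have "padic_norm (L f j) > 0" using j(2) padic_norm_pos[OF \<kappa>0] by simp
    moreover have "real CARD('p) > 0" using CARD_real_gt_1[where 'p = 'p] by simp
    ultimately have "padic_norm (of_int (int x - int x') :: 'p padic) \<le> 1 / real CARD('p) ^ t"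
      by (simp add: field_simps)
    then have dvd: "int CARD('p) ^ t dvd int x - int x'"
      unfolding padic_norm_of_int_le_iff .
    have mem: "(n - q + a, j) \<in> {..<n} \<times> {..<n}" using a \<open>q \<le> n\<close> j(1) by auto
    have F: "f \<in> F" "f' \<in> F" using f f' by (auto simp: bad_def)
    have "x < CARD('p) ^ t" "x' < CARD('p) ^ t"
      using PiE_mem[OF F(1)[unfolded F_def] mem] PiE_mem[OF F(2)[unfolded F_def] mem]
      by (simp_all add: x_def x'_def)
    then have "\<bar>int x - int x'\<bar> < int CARD('p) ^ t"
      by (simp add: abs_less_iff flip: of_nat_power)
    then have "x = x'" using dvd zdvd_imp_le[of "int CARD('p) ^ t" "\<bar>int x - int x'\<bar>"] by fastforce
    then have "f z = f' z" for z using agree[of z] by (cases "z = (n - q + a, j)") (auto simp: x_def x'_def)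
    then show "f = f' \<and> y = y'" using y by auto
  qed
  moreover have "\<Phi> ` (bad \<times> {..<CARD('p) ^ t}) \<subseteq> F"
  proof (rule image_subsetI)
    fix z assume "z \<in> bad \<times> {..<CARD('p) ^ t}"
    then obtain f y where z: "z = (f, y)" and f: "f \<in> bad" and y: "y \<in> {..<CARD('p) ^ t}" by auto
    have "J f < n" using f Da by (intro J) (auto simp: bad_def)
    then have "(n - q + a, J f) \<in> {..<n} \<times> {..<n}" using a \<open>q \<le> n\<close> by auto
    then show "\<Phi> z \<in> F" using f y unfolding z \<Phi>_def bad_def F_def by (auto simp: PiE_iff extensional_def)
  qed
  moreover have "finite F" unfolding F_def by (intro finite_PiE) auto
  ultimately have "card (bad \<times> {..<CARD('p) ^ t}) \<le> card F" by (metis card_inj_on_le)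
  then show ?thesis by (simp add: bad_def card_cartesian_product)
qed

text \<open>\<open>D\<close> interpolates from the identity, with determinant 1, to the wanted
  matrix. If none of the \<open>q\<close> steps is bad, each keeps more than the fraction
  \<open>1 / p ^ (t + 1)\<close> of the norm, so a small final determinant forces a bad step; the
  union bound gives the factor \<open>q\<close>.\<close>

lemma card_small_det:
  fixes W Y :: "'p :: prime_card padic mat" and t :: nat
  assumes W: "W \<in> carrier_mat n q" and Y: "Y \<in> carrier_mat q n" "integral_mat Y" and YW: "Y * W = 1\<^sub>m q"
    and "q \<le> n"
  defines "F \<equiv> ({..<n} \<times> {..<n}) \<rightarrow>\<^sub>E {..<CARD('p) ^ t}"
  shows "card {f \<in> F. padic_norm (det (drop_rows (n - q) (congruence_mat n f) * W)) < 1 / real CARD('p) ^ (q * Suc t)} * CARD('p) ^ t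
    \<le> q * card F"
proof -
  define R where "R f r c = W $$ (n - q + r, c) + of_nat CARD('p) * (\<Sum>j<n. of_nat (f (n - q + r, j)) * W $$ (j, c))"
    for f :: "nat \<times> nat \<Rightarrow> nat" and r c
  define D where "D a f = det (mat q q (\<lambda>(r, c). if r < a then R f r c else if r = c then 1 else 0))" for a f
  define bad where "bad a = {f \<in> F. D a f \<noteq> 0 \<and> padic_norm (D (Suc a) f) \<le> padic_norm (D a f) / real CARD('p) ^ Suc t}" for a
  have bad: "card (bad a) * CARD('p) ^ t \<le> card F" if "a < q" for a
    unfolding bad_def F_def D_def R_def
    by (rule card_small_det_step[OF W Y YW \<open>q \<le> n\<close> that])
  have D0: "D 0 f = 1" for f
  proof -
    have "mat q q (\<lambda>(r, c). if r < 0 then R f r c else if r = c then 1 else 0) = 1\<^sub>m q"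
      by (rule eq_matI) auto
    then show ?thesis by (simp add: D_def)
  qed
  have Dq: "D q f = det (drop_rows (n - q) (congruence_mat n f) * W)" for f
  proof -
    have G: "drop_rows (n - q) (congruence_mat n f :: 'p padic mat) \<in> carrier_mat q n"
      using drop_rows_carrier[OF congruence_mat_carrier, of "n - q" n f] \<open>q \<le> n\<close> by simp
    have "mat q q (\<lambda>(r, c). if r < q then R f r c else if r = c then 1 else 0) = drop_rows (n - q) (congruence_mat n f) * W"
    proof (rule eq_matI)
      fix r c assume "r < dim_row (drop_rows (n - q) (congruence_mat n f) * W)" "c < dim_col (drop_rows (n - q) (congruence_mat n f) * W)"
      then have rc: "r < q" "c < q" using G W by auto
      have rn: "n - q + r < n" using rc \<open>q \<le> n\<close> by simp
      have "(drop_rows (n - q) (congruence_mat n f) * W) $$ (r, c) = (\<Sum>j<n. drop_rows (n - q) (congruence_mat n f) $$ (r, j) * W $$ (j, c))"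
        by (rule index_mult_mat_sum[OF G W rc])
      also have "\<dots> = (\<Sum>j<n. (if j = n - q + r then W $$ (n - q + r, c) else 0) + of_nat CARD('p) * (of_nat (f (n - q + r, j)) * W $$ (j, c)))"
        using rc rn \<open>q \<le> n\<close> by (intro sum.cong) (auto simp: drop_rows_def congruence_mat_def distrib_right mult.assoc add.commute)
      also have "\<dots> = R f r c" using rn by (simp add: sum.distrib R_def sum_distrib_left)
      finally show "mat q q (\<lambda>(r, c). if r < q then R f r c else if r = c then 1 else 0) $$ (r, c) = (drop_rows (n - q) (congruence_mat n f) * W) $$ (r, c)"
        using rc by simp
    qed (use G W in auto)
    then show ?thesis by (simp add: D_def)
  qed
  have fin: "finite F" unfolding F_def by (intro finite_PiE) auto
  let ?p = "real CARD('p)"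
  have p0: "?p > 0" using CARD_real_gt_1[where 'p = 'p] by simp
  have "{f \<in> F. padic_norm (D q f) < 1 / ?p ^ (q * Suc t)} \<subseteq> (\<Union>a<q. bad a)"
  proof (intro subsetI, rule ccontr)
    fix f assume f: "f \<in> {f \<in> F. padic_norm (D q f) < 1 / ?p ^ (q * Suc t)}" "f \<notin> (\<Union>a<q. bad a)"
    have "1 / ?p ^ (a * Suc t) \<le> padic_norm (D a f)" if "a \<le> q" for a
      using that
    proof (induction a)
      case (Suc a)
      then have IH: "1 / ?p ^ (a * Suc t) \<le> padic_norm (D a f)" by simp
      moreover have "0 < 1 / ?p ^ (a * Suc t)" using p0 by simp
      ultimately have "D a f \<noteq> 0" by (metis order.strict_trans2 padic_norm_pos_iff)
      then have "padic_norm (D a f) / ?p ^ Suc t < padic_norm (D (Suc a) f)"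
        using f Suc.prems by (auto simp: bad_def not_le)
      moreover have "1 / ?p ^ (Suc a * Suc t) = 1 / ?p ^ (a * Suc t) / ?p ^ Suc t"
        by (simp add: power_add)
      moreover have "\<dots> \<le> padic_norm (D a f) / ?p ^ Suc t"
        using IH p0 by (intro divide_right_mono) auto
      ultimately show ?case by linarith
    qed (simp add: D0)
    then show False using f by force
  qed
  then have "card {f \<in> F. padic_norm (D q f) < 1 / ?p ^ (q * Suc t)} \<le> card (\<Union>a<q. bad a)"
    using fin by (intro card_mono) (auto simp: bad_def)
  also have "\<dots> \<le> (\<Sum>a<q. card (bad a))" by (rule card_UN_le) simp
  finally have "card {f \<in> F. padic_norm (D q f) < 1 / ?p ^ (q * Suc t)} * CARD('p) ^ t \<le> (\<Sum>a<q. card (bad a)) * CARD('p) ^ t"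
    by simp
  also have "\<dots> = (\<Sum>a<q. card (bad a) * CARD('p) ^ t)" by (simp add: sum_distrib_right)
  also have "\<dots> \<le> (\<Sum>a<q. card F)" using bad by (intro sum_mono) auto
  finally show ?thesis by (simp add: Dq)
qed

text \<open>With \<open>K\<close> the inclusion of the last \<open>q\<close> coordinates, the test
  matrix \<open>V' * K\<close> satisfies \<open>B * (V' * K) = (U * K) * E\<close>, and
  \<open>det E\<close> accounts exactly for the tail sum. The deviation of \<open>G * B\<close> is
  thus at most the valuation of the determinant of the last rows of \<open>G\<close> times
  \<open>W = U * K\<close>, and \<open>Y = K' * U'\<close> is the integral left inverse required for
  counting.\<close>

lemma card_large_deviation:
  fixes B :: "'p :: prime_card padic mat" and t :: nat
  assumes B: "B \<in> GL n" and "q \<le> n"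
  defines "F \<equiv> ({..<n} \<times> {..<n}) \<rightarrow>\<^sub>E {..<CARD('p) ^ t}"
  shows "card {f \<in> F. row_val (n - q) (congruence_mat n f * B) - real_of_int (tail_sum q (SN (congruence_mat n f * B))) > real (q * Suc t)} * CARD('p) ^ t
    \<le> q * card F"
proof -
  note Bc = GL_carrier[OF B]
  define ls where "ls = SN B"
  obtain U V where UV: "length ls = n" "sorted_wrt (\<ge>) ls" "U \<in> GL_Zp n" "V \<in> GL_Zp n"
    "B = U * diag_powers n n ls * V"
    using is_SND[OF SN_props(1)[OF B]] Bc unfolding ls_def by (metis carrier_matD)
  note U = GL_ZpD[OF UV(3)] and V = GL_ZpD[OF UV(4)]
  obtain U' where U': "U' \<in> GL_Zp n" "U' * U = 1\<^sub>m n" using GL_Zp_inverse[OF UV(3)] by blast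
  obtain V' where V': "V' \<in> GL_Zp n" "V * V' = 1\<^sub>m n" using GL_Zp_inverse[OF UV(4)] by blast
  note U'c = GL_ZpD[OF U'(1)] and V'c = GL_ZpD[OF V'(1)]
  have qn: "n - (n - q) = q" "n - q + q = n" using \<open>q \<le> n\<close> by auto
  define K :: "'p padic mat" where "K = coord_cols n (n - q) q"
  define K' :: "'p padic mat" where "K' = coord_rows q (n - q) n"
  let ?D = "diag_powers n n ls :: 'p padic mat"
  have K: "K \<in> carrier_mat n q" "integral_mat K" and K': "K' \<in> carrier_mat q n" "integral_mat K'"
    by (auto simp: K_def K'_def)
  define W where "W = U * K"
  define Y where "Y = K' * U'"
  have W: "W \<in> carrier_mat n q" using U K by (auto simp: W_def)
  have Y: "Y \<in> carrier_mat q n" "integral_mat Y"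
    using U'c K' integral_mat_mult[of K' q n U' n] by (auto simp: Y_def)
  have KK: "K' * K = 1\<^sub>m q" unfolding K_def K'_def by (rule coord_rows_mult_coord_cols) (use qn in simp)
  have "Y * W = K' * (U' * (U * K))"
    unfolding Y_def W_def by (rule assoc_mult_mat) (use K K' U U'c in auto)
  also have "U' * (U * K) = K"
    using assoc_mult_mat[OF U'c(1) U(1) K(1)] U'(2) K by simp
  finally have YW: "Y * W = 1\<^sub>m q" using KK by simp
  define E where "E = K' * ?D * K"
  \<comment> \<open>A diagonal matrix preserves the span of the last \<open>q\<close> unit vectors
    and acts on it by the block \<open>E\<close>.\<close>
  have DK: "?D * K = K * E"
  proof (rule eq_matI)
    have KD: "K' * ?D = mat q n (\<lambda>(i, j). ?D $$ (n - q + i, j))"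
      unfolding K'_def by (rule coord_rows_mult) (use qn in auto)
    then have E_eq: "E = mat q q (\<lambda>(i, j). ?D $$ (n - q + i, n - q + j))"
      unfolding E_def KD K_def using qn by (subst mult_coord_cols) auto
    have Ec: "E \<in> carrier_mat q q" by (simp add: E_eq)
    fix i j assume "i < dim_row (K * E)" "j < dim_col (K * E)"
    then have ij: "i < n" "j < q" using K Ec by auto
    have "(?D * K) $$ (i, j) = ?D $$ (i, n - q + j)"
      unfolding K_def using ij qn by (subst mult_coord_cols[of _ n n]) auto
    moreover have "(K * E) $$ (i, j) = (\<Sum>k<q. K $$ (i, k) * E $$ (k, j))"
      by (rule index_mult_mat_sum[OF K(1) Ec ij])
    moreover have "\<dots> = (\<Sum>k<q. if k = j then K $$ (i, j) * E $$ (j, j) else 0)"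
      using ij qn by (intro sum.cong) (auto simp: E_eq diag_powers_def)
    moreover have "\<dots> = ?D $$ (i, n - q + j)"
      using ij qn by (auto simp: E_eq K_def coord_cols_def diag_powers_def)
    ultimately show "(?D * K) $$ (i, j) = (K * E) $$ (i, j)" by simp
  qed (use K in \<open>auto simp: E_def\<close>)
  have Ec: "E \<in> carrier_mat q q" using K K' by (auto simp: E_def)
  have detE: "padic_norm (det E) = real CARD('p) powi (- tail_sum q ls)"
    unfolding E_def K_def K'_def using UV(1) \<open>q \<le> n\<close> by (intro det_compression_diag_tail) auto
  have "{f \<in> F. row_val (n - q) (congruence_mat n f * B) - real_of_int (tail_sum q (SN (congruence_mat n f * B))) > real (q * Suc t)}
    \<subseteq> {f \<in> F. padic_norm (det (drop_rows (n - q) (congruence_mat n f) * W)) < 1 / real CARD('p) ^ (q * Suc t)}"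
  proof (intro subsetI CollectI conjI, goal_cases)
    case (2 f)
    let ?G = "congruence_mat n f :: 'p padic mat"
    let ?d = "det (drop_rows (n - q) ?G * W)"
    have Gc: "?G \<in> carrier_mat n n" by (rule congruence_mat_carrier)
    have GB: "?G * B \<in> GL n" by (rule GL_mult[OF GL_Zp_subset_GL[OF congruence_mat_GL_Zp] B])
    have SN: "SN (?G * B) = ls" unfolding ls_def by (rule SN_mult_left[OF B congruence_mat_GL_Zp])
    have dG: "drop_rows (n - q) ?G \<in> carrier_mat q n" using drop_rows_carrier[OF Gc, of "n - q"] qn by simp
    have BV: "B * (V' * K) = W * E"
    proof -
      have "B * (V' * K) = 1\<^sub>m n * (U * ?D * V) * (V' * K)"
        unfolding UV(5) using U V by simp
      also have "\<dots> = (1\<^sub>m n * U) * ?D * (V * (V' * K))"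
        by (rule compression_reassoc) (use U V V'c K in auto)
      also have "V * (V' * K) = K" using assoc_mult_mat[OF V(1) V'c(1) K(1)] V'(2) K by simp
      also have "1\<^sub>m n * U * ?D * K = U * (?D * K)" using U K by (simp add: assoc_mult_mat[of _ n n _ n _ q])
      also have "\<dots> = W * E"
        unfolding DK W_def using assoc_mult_mat[OF U(1) K(1) Ec] by simp
      finally show ?thesis .
    qed
    have "drop_rows (n - q) (?G * B) * (V' * K) = drop_rows (n - q) ?G * (B * (V' * K))"
      unfolding drop_rows_mult[OF Gc Bc diff_le_self] by (rule assoc_mult_mat[OF dG Bc]) (use V'c K in auto)
    also have "\<dots> = drop_rows (n - q) ?G * W * E"
      unfolding BV by (rule assoc_mult_mat[OF dG W Ec, symmetric])
    finally have "padic_norm (det (drop_rows (n - q) (?G * B) * (V' * K))) = padic_norm ?d * real CARD('p) powi (- tail_sum q ls)"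
      using det_mult[of "drop_rows (n - q) ?G * W" q E] dG W Ec detE by (simp add: padic_norm_mult)
    moreover have "padic_norm (det (drop_rows (n - q) (?G * B) * (V' * K))) \<le> row_volume (drop_rows (n - q) (?G * B))"
      by (rule row_volume_integral_ge[OF GB]) (use V'c K qn integral_mat_mult[OF V'c(1) K(1)] in auto)
    ultimately have le: "padic_norm ?d * real CARD('p) powi (- tail_sum q ls) \<le> row_volume (drop_rows (n - q) (?G * B))"
      by simp
    have p1: "real CARD('p) > 1" by (rule CARD_real_gt_1)
    show ?case
    proof (rule ccontr)
      assume "\<not> padic_norm ?d < 1 / real CARD('p) ^ (q * Suc t)"
      then have "1 / real CARD('p) ^ (q * Suc t) \<le> padic_norm ?d" by simp
      then have "1 / real CARD('p) ^ (q * Suc t) * real CARD('p) powi (- tail_sum q ls) \<le> padic_norm ?d * real CARD('p) powi (- tail_sum q ls)"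
        using p1 by (intro mult_right_mono) auto
      also note le
      finally have "log (real CARD('p)) (1 / real CARD('p) ^ (q * Suc t) * real CARD('p) powi (- tail_sum q ls)) \<le> log (real CARD('p)) (row_volume (drop_rows (n - q) (?G * B)))"
        using p1 row_volume_pos[OF GB, of "n - q"] by (subst log_le_cancel_iff) auto
      moreover have "log (real CARD('p)) (1 / real CARD('p) ^ (q * Suc t) * real CARD('p) powi (- tail_sum q ls)) = - real (q * Suc t) - real_of_int (tail_sum q ls)"
        using p1 by (simp add: log_mult log_divide log_powi log_nat_power)
      ultimately have "row_val (n - q) (?G * B) \<le> real (q * Suc t) + real_of_int (tail_sum q ls)"
        by (simp add: row_val_def)
      then show False using 2 SN by simp
    qed
  qed auto
  moreover have "finite F" unfolding F_def by (intro finite_PiE) auto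
  ultimately have "card {f \<in> F. row_val (n - q) (congruence_mat n f * B) - real_of_int (tail_sum q (SN (congruence_mat n f * B))) > real (q * Suc t)}
    \<le> card {f \<in> F. padic_norm (det (drop_rows (n - q) (congruence_mat n f) * W)) < 1 / real CARD('p) ^ (q * Suc t)}"
    by (intro card_mono) auto
  then have "card {f \<in> F. row_val (n - q) (congruence_mat n f * B) - real_of_int (tail_sum q (SN (congruence_mat n f * B))) > real (q * Suc t)} * CARD('p) ^ t
    \<le> card {f \<in> F. padic_norm (det (drop_rows (n - q) (congruence_mat n f) * W)) < 1 / real CARD('p) ^ (q * Suc t)} * CARD('p) ^ t"
    by simp
  also have "\<dots> \<le> q * card F"
    unfolding F_def by (rule card_small_det[OF W Y YW \<open>q \<le> n\<close>])
  finally show ?thesis .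
qed

section \<open>Topology and measurability over the p-adic numbers\<close>

lemma padic_dist_le_max: "dist x z \<le> max (dist x y) (dist y (z :: 'p :: prime_card padic))"
  using padic_norm_add[of "x - y" "y - z"] by (simp add: dist_padic_def)

text \<open>Multiplication by a power of \<open>p\<close> moves \<open>x\<close> into the ring of
  integers, where naturals are dense. The fractions \<open>c / p ^ k\<close> form the countable
  dense set for the next instance.\<close>

lemma padic_approx_rational:
  fixes x :: "'p :: prime_card padic"
  assumes "e > 0"
  shows "\<exists>c k. dist x (of_nat c / of_nat CARD('p) ^ k) < e"
proof -
  let ?p = "real CARD('p)"
  have p1: "?p > 1" by (rule CARD_real_gt_1)
  obtain k where k: "padic_norm x < ?p ^ k" using real_arch_pow[OF p1] by blast
  define y where "y = of_nat CARD('p) ^ k * x"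
  have "padic_norm y = padic_norm x / ?p ^ k"
    by (simp add: y_def padic_norm_mult padic_norm_power padic_norm_of_nat_CARD power_divide)
  also have "\<dots> \<le> 1" using k p1 by (simp add: divide_le_eq)
  finally have y: "padic_norm y \<le> 1" .
  obtain N where N: "?p ^ k / e < ?p ^ N" using real_arch_pow[OF p1] by blast
  obtain c where c: "padic_norm (y - of_nat c) \<le> 1 / ?p ^ N" using padic_approx_nat[OF y] by blast
  have p0: "(of_nat CARD('p) :: 'p padic) \<noteq> 0"
  proof -
    have "padic_norm (of_nat CARD('p) :: 'p padic) \<noteq> 0" unfolding padic_norm_of_nat_CARD using p1 by simp
    then show ?thesis by (metis padic_norm_eq_0_iff)
  qed
  have "x - of_nat c / of_nat CARD('p) ^ k = (y - of_nat c) / of_nat CARD('p) ^ k"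
    using p0 by (simp add: y_def diff_divide_distrib)
  then have "dist x (of_nat c / of_nat CARD('p) ^ k) = padic_norm (y - of_nat c) * ?p ^ k"
    by (simp add: dist_padic_def padic_norm_divide padic_norm_power padic_norm_of_nat_CARD power_divide)
  also have "\<dots> \<le> 1 / ?p ^ N * ?p ^ k" using c p1 by (intro mult_right_mono) auto
  also have "\<dots> < e" using N p1 assms by (simp add: field_simps)
  finally show ?thesis by blast
qed

text \<open>Second countability makes continuous functions of two Borel functions Borel, which is
  what measurability of sums and products rests on.\<close>

instance padic :: (prime_card) second_countable_topology
proof
  define D :: "'a padic set" where "D = range (\<lambda>(c, k). of_nat c / of_nat CARD('a) ^ k)"
  define B where "B = (\<lambda>(x, m). ball x (1 / real (Suc m))) ` (D \<times> UNIV)"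
  have "countable D" unfolding D_def by (intro countable_image) auto
  then have "countable B" unfolding B_def by (intro countable_image countable_SIGMA) auto
  moreover have "topological_basis B"
  proof (rule topological_basisI)
    fix U and x :: "'a padic" assume "open U" "x \<in> U"
    then obtain e where e: "e > 0" "ball x e \<subseteq> U" using open_contains_ball by blast
    obtain m where m: "1 / real (Suc m) < e" using nat_approx_posE[OF e(1)] .
    obtain d where d: "d \<in> D" "dist x d < 1 / real (Suc m)"
      using padic_approx_rational[of "1 / real (Suc m)" x] by (auto simp: D_def)
    have "ball d (1 / real (Suc m)) \<subseteq> U"
    proof
      fix y assume "y \<in> ball d (1 / real (Suc m))"
      then have "dist x y < e"
        using padic_dist_le_max[of x y d] d(2) m by (auto simp: dist_commute)
      then show "y \<in> U" using e by auto
    qed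
    then show "\<exists>B'\<in>B. x \<in> B' \<and> B' \<subseteq> U"
      using d unfolding B_def by (intro bexI[of _ "ball d (1 / real (Suc m))"]) (auto simp: dist_commute)
  qed (auto simp: B_def)
  ultimately show "\<exists>B::'a padic set set. countable B \<and> open = generate_topology B"
    using topological_basis_imp_subbasis by blast
qed

instance padic :: (prime_card) topological_comm_monoid_add
proof
  fix a b :: "'a padic"
  show "((\<lambda>x. fst x + snd x) \<longlongrightarrow> a + b) (nhds a \<times>\<^sub>F nhds b)"
    unfolding tendsto_iff
  proof (intro allI impI)
    fix e :: real assume e: "0 < e"
    have "\<forall>\<^sub>F x in nhds a. dist x a < e" "\<forall>\<^sub>F y in nhds b. dist y b < e"
      using e by (auto intro!: eventually_nhds_metric[THEN iffD2])
    then have "\<forall>\<^sub>F x in nhds a \<times>\<^sub>F nhds b. dist (fst x) a < e \<and> dist (snd x) b < e"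
      by (rule eventually_prodI)
    then show "\<forall>\<^sub>F x in nhds a \<times>\<^sub>F nhds b. dist (fst x + snd x) (a + b) < e"
    proof eventually_elim
      case (elim x)
      have "padic_norm ((fst x - a) + (snd x - b)) \<le> max (padic_norm (fst x - a)) (padic_norm (snd x - b))"
        by (rule padic_norm_add)
      also have "\<dots> < e" using elim by (simp add: dist_padic_def)
      finally show ?case by (simp add: dist_padic_def algebra_simps)
    qed
  qed
qed

lemma continuous_on_padic_mult: "continuous_on UNIV (\<lambda>x. fst x * snd x :: 'p :: prime_card padic)"
proof (rule continuous_at_imp_continuous_on, rule ballI)
  fix ab :: "'p padic \<times> 'p padic"
  obtain a b where ab: "ab = (a, b)" by force
  show "isCont (\<lambda>x. fst x * snd x) ab"
    unfolding isCont_def tendsto_iff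
  proof (intro allI impI)
    fix e :: real assume e: "0 < e"
    \<comment> \<open>\<open>K\<close> bounds the norms of \<open>b\<close> and of every point
      within distance 1 of \<open>a\<close>, so both terms of the split difference are at most
      \<open>\<delta> * K\<close>.\<close>
    define K where "K = 1 + padic_norm a + padic_norm b"
    have K: "K \<ge> 1" "padic_norm a \<le> K - 1" "padic_norm b \<le> K"
      using padic_norm_nonneg[of a] padic_norm_nonneg[of b] by (auto simp: K_def)
    define \<delta> where "\<delta> = min 1 (e / (2 * K))"
    have \<delta>: "\<delta> > 0" "\<delta> \<le> 1" "\<delta> * K < e" using e K(1) by (auto simp: \<delta>_def min_def field_simps)
    have "\<forall>\<^sub>F x in at ab. dist x ab < \<delta>" using \<delta>(1) by (auto simp: eventually_at)
    then show "\<forall>\<^sub>F x in at ab. dist (fst x * snd x) (fst ab * snd ab) < e"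
    proof eventually_elim
      case (elim x)
      have d: "padic_norm (fst x - a) < \<delta>" "padic_norm (snd x - b) < \<delta>"
        using elim dist_fst_le[of x ab] dist_snd_le[of x ab] by (auto simp: ab dist_padic_def)
      have "padic_norm (fst x) \<le> K"
        using padic_norm_add[of "fst x - a" a] d(1) \<delta>(2) K(1,2) by (simp add: max_def split: if_splits)
      then have "padic_norm (fst x * (snd x - b)) \<le> K * \<delta>"
        unfolding padic_norm_mult using d K(1) by (intro mult_mono) (auto simp: padic_norm_nonneg)
      moreover have "padic_norm ((fst x - a) * b) \<le> \<delta> * K"
        unfolding padic_norm_mult using d K \<delta> by (intro mult_mono) (auto simp: padic_norm_nonneg)
      moreover have "fst x * snd x - a * b = fst x * (snd x - b) + (fst x - a) * b"
        by (simp add: algebra_simps)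
      ultimately have "padic_norm (fst x * snd x - a * b) \<le> \<delta> * K"
        using padic_norm_add[of "fst x * (snd x - b)" "(fst x - a) * b"] by (simp add: mult.commute)
      then show ?case using \<delta>(3) by (simp add: dist_padic_def ab)
    qed
  qed
qed

lemma borel_measurable_padic_mult [measurable]:
  fixes f g :: "'a \<Rightarrow> 'p :: prime_card padic"
  assumes "f \<in> borel_measurable M" "g \<in> borel_measurable M"
  shows "(\<lambda>x. f x * g x) \<in> borel_measurable M"
  by (rule borel_measurable_continuous_Pair[OF assms continuous_on_padic_mult])

lemma borel_measurable_padic_norm [measurable]:
  "(padic_norm :: 'p :: prime_card padic \<Rightarrow> real) \<in> borel_measurable borel"
proof (rule borel_measurable_continuous_onI)
  show "continuous_on UNIV (padic_norm :: 'p padic \<Rightarrow> real)"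
    unfolding continuous_on_iff
  proof (intro ballI allI impI exI conjI)
    fix x y :: "'p padic" and e :: real assume "0 < e" "dist y x < e"
    moreover have "\<bar>padic_norm y - padic_norm x\<bar> \<le> padic_norm (y - x)"
      using padic_norm_add[of "y - x" x] padic_norm_diff[of y "y - x"] padic_norm_nonneg[of x]
        padic_norm_nonneg[of y] padic_norm_nonneg[of "y - x"] by simp
    ultimately show "dist (padic_norm y) (padic_norm x) < e" by (simp add: dist_real_def dist_padic_def)
  qed simp
qed

lemma borel_measurable_padic_prod:
  fixes f :: "'i \<Rightarrow> 'a \<Rightarrow> 'p :: prime_card padic"
  assumes "\<And>i. i \<in> A \<Longrightarrow> f i \<in> borel_measurable M"
  shows "(\<lambda>x. \<Prod>i\<in>A. f i x) \<in> borel_measurable M"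
  using assms by (induction A rule: infinite_finite_induct) (auto intro!: borel_measurable_padic_mult)

section \<open>Measurability of matrix-valued maps, values and singular numbers\<close>

lemma measurable_borel_mat_iff:
  "X \<in> measurable M (borel_mat r c) \<longleftrightarrow> X \<in> space M \<rightarrow> carrier_mat r c \<and>
     (\<forall>i<r. \<forall>j<c. (\<lambda>\<omega>. X \<omega> $$ (i, j)) \<in> borel_measurable M)"
proof
  let ?I = "{..<r} \<times> {..<c}"
  let ?f = "\<lambda>A. \<lambda>ij \<in> ?I. A $$ ij"
  assume X: "X \<in> measurable M (borel_mat r c)"
  have f: "?f \<in> measurable (borel_mat r c) (Pi\<^sub>M ?I (\<lambda>_. borel))"
    unfolding borel_mat_def by (rule measurable_vimage_algebra1) (auto simp: space_PiM)
  have "(\<lambda>\<omega>. X \<omega> $$ (i, j)) \<in> borel_measurable M" if "i < r" "j < c" for i j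
  proof -
    have "(\<lambda>\<omega>. ?f (X \<omega>) (i, j)) \<in> borel_measurable M"
      by (rule measurable_compose[OF measurable_compose[OF X f] measurable_component_singleton]) (use that in auto)
    then show ?thesis using that by simp
  qed
  moreover have "space (borel_mat r c) = carrier_mat r c" by (simp add: borel_mat_def)
  ultimately show "X \<in> space M \<rightarrow> carrier_mat r c \<and> (\<forall>i<r. \<forall>j<c. (\<lambda>\<omega>. X \<omega> $$ (i, j)) \<in> borel_measurable M)"
    using measurable_space[OF X] by auto
next
  assume X: "X \<in> space M \<rightarrow> carrier_mat r c \<and> (\<forall>i<r. \<forall>j<c. (\<lambda>\<omega>. X \<omega> $$ (i, j)) \<in> borel_measurable M)"
  show "X \<in> measurable M (borel_mat r c)"
    unfolding borel_mat_def
    by (rule measurable_vimage_algebra2) (use X in \<open>auto intro!: measurable_restrict\<close>)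
qed

lemma measurable_mat_mult:
  fixes X Y :: "'a \<Rightarrow> 'p :: prime_card padic mat"
  assumes "X \<in> measurable M (borel_mat r k)" "Y \<in> measurable M (borel_mat k c)"
  shows "(\<lambda>\<omega>. X \<omega> * Y \<omega>) \<in> measurable M (borel_mat r c)"
  unfolding measurable_borel_mat_iff
proof (intro conjI allI impI)
  fix i j assume ij: "i < r" "j < c"
  have "(\<lambda>\<omega>. \<Sum>l<k. X \<omega> $$ (i, l) * Y \<omega> $$ (l, j)) \<in> borel_measurable M"
    using assms ij by (intro borel_measurable_sum borel_measurable_padic_mult) (auto simp: measurable_borel_mat_iff)
  moreover have "(X \<omega> * Y \<omega>) $$ (i, j) = (\<Sum>l<k. X \<omega> $$ (i, l) * Y \<omega> $$ (l, j))" if "\<omega> \<in> space M" for \<omega>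
    using assms ij that by (intro index_mult_mat_sum) (auto simp: measurable_borel_mat_iff)
  ultimately show "(\<lambda>\<omega>. (X \<omega> * Y \<omega>) $$ (i, j)) \<in> borel_measurable M"
    by (simp cong: measurable_cong)
qed (use assms in \<open>auto simp: measurable_borel_mat_iff intro!: mult_carrier_mat\<close>)

lemma measurable_mat_const: "C \<in> carrier_mat r c \<Longrightarrow> (\<lambda>_. C) \<in> measurable M (borel_mat r c)"
  by (simp add: measurable_borel_mat_iff)

lemma borel_measurable_det:
  fixes X :: "'a \<Rightarrow> 'p :: prime_card padic mat"
  assumes "X \<in> measurable M (borel_mat n n)"
  shows "(\<lambda>\<omega>. det (X \<omega>)) \<in> borel_measurable M"
proof -
  have "(\<lambda>\<omega>. \<Sum>p\<in>{p. p permutes {0..<n}}. signof p * (\<Prod>i = 0..<n. X \<omega> $$ (i, p i))) \<in> borel_measurable M"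
    using assms by (intro borel_measurable_sum borel_measurable_padic_mult borel_measurable_padic_prod)
      (auto simp: measurable_borel_mat_iff permutes_less)
  moreover have "det (X \<omega>) = (\<Sum>p\<in>{p. p permutes {0..<n}}. signof p * (\<Prod>i = 0..<n. X \<omega> $$ (i, p i)))"
    if "\<omega> \<in> space M" for \<omega>
    using assms that by (intro det_def') (auto simp: measurable_borel_mat_iff)
  ultimately show ?thesis by (simp cong: measurable_cong)
qed

lemma space_borel_GL: "space (borel_GL n) = GL n"
  by (auto simp: borel_GL_def space_restrict_space borel_mat_def GL_def)

lemma measurable_borel_GL_iff:
  "X \<in> measurable M (borel_GL n) \<longleftrightarrow> X \<in> measurable M (borel_mat n n) \<and> X \<in> space M \<rightarrow> GL n"
  unfolding borel_GL_def by (auto simp: measurable_restrict_space2_iff)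

lemma measurable_GL_id: "(\<lambda>B. B) \<in> measurable (borel_GL n) (borel_mat n n)"
  using measurable_borel_GL_iff[of "\<lambda>B. B" "borel_GL n" n] measurable_ident by (auto simp: id_def)

lemma measurable_GL_mult:
  fixes X Y :: "'a \<Rightarrow> 'p :: prime_card padic mat"
  assumes "X \<in> measurable M (borel_GL n)" "Y \<in> measurable M (borel_GL n)"
  shows "(\<lambda>\<omega>. X \<omega> * Y \<omega>) \<in> measurable M (borel_GL n)"
  using assms unfolding measurable_borel_GL_iff by (auto intro!: measurable_mat_mult GL_mult)

text \<open>The volume is a finite maximum of norms of polynomials in the entries; no measurable
  choice of a Smith form is involved. The tail sums of \<open>SN\<close> are treated in the same way
  through \<open>max_minor\<close>.\<close>

lemma borel_measurable_row_val:
  assumes "i \<le> n"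
  shows "(row_val i :: 'p :: prime_card padic mat \<Rightarrow> real) \<in> borel_measurable (borel_GL n)"
proof -
  have "(\<lambda>B. padic_norm (det (coord_rows (n - i) i n * B * X))) \<in> borel_measurable (borel_GL n)"
    if "X \<in> residue_mats n (n - i)" for X :: "'p padic mat"
    using residue_mats_carrier[OF that]
    by (intro measurable_compose[OF _ borel_measurable_padic_norm] borel_measurable_det measurable_mat_mult[of _ _ _ n]
        measurable_mat_const measurable_GL_id) auto
  then have "(\<lambda>B. Max ((\<lambda>X. padic_norm (det (coord_rows (n - i) i n * B * X))) ` residue_mats n (n - i)) :: real)
      \<in> borel_measurable (borel_GL n :: 'p padic mat measure)"
    by (intro borel_measurable_Max finite_residue_mats)
  then have "(\<lambda>B. - log (real CARD('p)) (Max ((\<lambda>X. padic_norm (det (coord_rows (n - i) i n * B * X))) ` residue_mats n (n - i))))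
      \<in> borel_measurable (borel_GL n :: 'p padic mat measure)"
    by measurable
  moreover have "row_val i B = - log (real CARD('p)) (Max ((\<lambda>X. padic_norm (det (coord_rows (n - i) i n * B * X))) ` residue_mats n (n - i)))"
    if "B \<in> space (borel_GL n)" for B :: "'p padic mat"
  proof -
    have B: "B \<in> carrier_mat n n" using that by (simp add: space_borel_GL GL_carrier)
    then show ?thesis
      using drop_rows_carrier[OF B, of i] by (simp add: row_val_def row_volume_def drop_rows_eq_mult[OF B assms])
  qed
  ultimately show ?thesis by (simp cong: measurable_cong)
qed

lemma borel_measurable_tail_sum_SN:
  assumes "q \<le> n"
  shows "(\<lambda>B :: 'p :: prime_card padic mat. real_of_int (tail_sum q (SN B))) \<in> borel_measurable (borel_GL n)"
proof -
  have "(\<lambda>B. padic_norm (det (fst YX * B * snd YX))) \<in> borel_measurable (borel_GL n)"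
    if "YX \<in> residue_mats q n \<times> residue_mats n q" for YX :: "'p padic mat \<times> 'p padic mat"
    using that by (intro measurable_compose[OF _ borel_measurable_padic_norm] borel_measurable_det measurable_mat_mult[of _ _ _ n]
        measurable_mat_const measurable_GL_id) (auto intro!: residue_mats_carrier)
  then have "(\<lambda>B. Max ((\<lambda>YX. padic_norm (det (fst YX * B * snd YX))) ` (residue_mats q n \<times> residue_mats n q)) :: real)
      \<in> borel_measurable (borel_GL n :: 'p padic mat measure)"
    by (intro borel_measurable_Max finite_cartesian_product finite_residue_mats)
  then have "(\<lambda>B. - log (real CARD('p)) (Max ((\<lambda>YX. padic_norm (det (fst YX * B * snd YX))) ` (residue_mats q n \<times> residue_mats n q))))
      \<in> borel_measurable (borel_GL n :: 'p padic mat measure)"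
    by measurable
  moreover have "real_of_int (tail_sum q (SN B)) = - log (real CARD('p)) (Max ((\<lambda>YX. padic_norm (det (fst YX * B * snd YX))) ` (residue_mats q n \<times> residue_mats n q)))"
    if "B \<in> space (borel_GL n)" for B :: "'p padic mat"
  proof -
    have B: "B \<in> GL n" using that by (simp add: space_borel_GL)
    note Bc = GL_carrier[OF B]
    have "max_minor q B = real CARD('p) powi (- tail_sum q (SN B))"
      by (rule max_minor_eq[OF SN_props(1)[OF B] Bc order_refl assms])
    moreover have "max_minor q B = Max ((\<lambda>YX. padic_norm (det (fst YX * B * snd YX))) ` (residue_mats q n \<times> residue_mats n q))"
      using Bc by (simp add: max_minor_def case_prod_beta')
    ultimately show ?thesis
      using CARD_real_gt_1[where 'p = 'p] by (simp add: log_powi)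
  qed
  ultimately show ?thesis by (simp cong: measurable_cong)
qed

section \<open>Independent increments\<close>

context prob_space
begin

text \<open>Independence is available for subfamilies over disjoint index sets, so
  \<open>A k\<close> is treated as the family over \<open>{k}\<close> and then projected to its only
  coordinate.\<close>

lemma pair_distr_past:
  fixes k :: nat
  assumes ind: "indep_vars (\<lambda>_. N) A (UNIV :: nat set)"
  defines "P \<equiv> \<lambda>\<omega>. \<lambda>i\<in>{..<k}. A i \<omega>"
  shows "distr M (Pi\<^sub>M {..<k} (\<lambda>_. N)) P \<Otimes>\<^sub>M distr M N (A k) = distr M (Pi\<^sub>M {..<k} (\<lambda>_. N) \<Otimes>\<^sub>M N) (\<lambda>\<omega>. (P \<omega>, A k \<omega>))"
proof -
  let ?S = "Pi\<^sub>M {..<k} (\<lambda>_. N)" and ?T = "Pi\<^sub>M {k} (\<lambda>_. N)"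
  let ?Y = "\<lambda>\<omega>. \<lambda>i\<in>{k}. A i \<omega>"
  have "indep_var ?S P ?T ?Y"
    unfolding P_def by (rule indep_var_restrict[OF ind]) auto
  then have PY: "P \<in> measurable M ?S" "?Y \<in> measurable M ?T"
    and eq: "distr M ?S P \<Otimes>\<^sub>M distr M ?T ?Y = distr M (?S \<Otimes>\<^sub>M ?T) (\<lambda>\<omega>. (P \<omega>, ?Y \<omega>))"
    unfolding indep_var_distribution_eq by auto
  have A: "A k \<in> measurable M N" using ind unfolding indep_vars_def2 by auto
  have comp: "(\<lambda>y. y k) \<in> measurable ?T N" by (rule measurable_component_singleton) simp
  have Ak: "distr M N (A k) = distr (distr M ?T ?Y) N (\<lambda>y. y k)"
    by (subst distr_distr[OF comp PY(2)]) (simp add: comp_def)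
  interpret Ak: prob_space "distr M N (A k)" by (rule prob_space_distr[OF A])
  have "distr M ?S P \<Otimes>\<^sub>M distr M N (A k) = distr (distr M ?S P) ?S (\<lambda>x. x) \<Otimes>\<^sub>M distr (distr M ?T ?Y) N (\<lambda>y. y k)"
    unfolding Ak[symmetric] by (subst distr_id2) simp_all
  also have "\<dots> = distr (distr M ?S P \<Otimes>\<^sub>M distr M ?T ?Y) (?S \<Otimes>\<^sub>M N) (\<lambda>(x, y). (x, y k))"
    by (rule pair_measure_distr) (use comp Ak.sigma_finite_measure_axioms[unfolded Ak] in auto)
  also have "\<dots> = distr (distr M (?S \<Otimes>\<^sub>M ?T) (\<lambda>\<omega>. (P \<omega>, ?Y \<omega>))) (?S \<Otimes>\<^sub>M N) (\<lambda>(x, y). (x, y k))"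
    by (simp only: eq)
  also have "\<dots> = distr M (?S \<Otimes>\<^sub>M N) ((\<lambda>(x, y). (x, y k)) \<circ> (\<lambda>\<omega>. (P \<omega>, ?Y \<omega>)))"
  proof (rule distr_distr)
    show "(\<lambda>(x, y). (x, y k)) \<in> measurable (?S \<Otimes>\<^sub>M ?T) (?S \<Otimes>\<^sub>M N)"
      unfolding case_prod_beta' by (intro measurable_Pair measurable_fst measurable_compose[OF measurable_snd comp])
  qed (intro measurable_Pair PY)
  finally show ?thesis by (simp add: comp_def)
qed

text \<open>Fubini with the past frozen at \<open>x\<close>: the inner probability is that of
  \<open>E\<close> under \<open>\<mu>\<close>, whatever \<open>x\<close> is, so it comes out of the
  integral over \<open>C\<close>. In other words, a constant conditional law means independence from
  the past.\<close>

lemma indep_increment_prob: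
  assumes XY: "X \<in> measurable M S" "Y \<in> measurable M T"
    and eq: "distr M S X \<Otimes>\<^sub>M distr M T Y = distr M (S \<Otimes>\<^sub>M T) (\<lambda>x. (X x, Y x))"
    and G: "G \<in> borel_measurable (S \<Otimes>\<^sub>M T)"
    and law: "\<And>x. x \<in> space S \<Longrightarrow> distr M borel (\<lambda>\<omega>. G (x, Y \<omega>)) = \<mu>"
    and C: "C \<in> sets S" and E: "E \<in> sets borel"
  shows "emeasure M ((X -` C \<inter> space M) \<inter> ((\<lambda>\<omega>. G (X \<omega>, Y \<omega>)) -` E \<inter> space M))
    = emeasure M (X -` C \<inter> space M) * emeasure \<mu> E"
proof -
  interpret DY: prob_space "distr M T Y" by (rule prob_space_distr) fact
  define Q where "Q = {z \<in> space (S \<Otimes>\<^sub>M T). fst z \<in> C \<and> G z \<in> E}"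
  have "(fst -` C \<inter> space (S \<Otimes>\<^sub>M T)) \<inter> (G -` E \<inter> space (S \<Otimes>\<^sub>M T)) \<in> sets (S \<Otimes>\<^sub>M T)"
    by (rule sets.Int[OF measurable_sets[OF measurable_fst C] measurable_sets[OF G E]])
  also have "(fst -` C \<inter> space (S \<Otimes>\<^sub>M T)) \<inter> (G -` E \<inter> space (S \<Otimes>\<^sub>M T)) = Q" by (auto simp: Q_def)
  finally have Q: "Q \<in> sets (S \<Otimes>\<^sub>M T)" .
  have pair: "(\<lambda>\<omega>. (X \<omega>, Y \<omega>)) \<in> measurable M (S \<Otimes>\<^sub>M T)" using XY by measurable
  have "(X -` C \<inter> space M) \<inter> ((\<lambda>\<omega>. G (X \<omega>, Y \<omega>)) -` E \<inter> space M) = (\<lambda>\<omega>. (X \<omega>, Y \<omega>)) -` Q \<inter> space M"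
    using measurable_space[OF pair] by (auto simp: Q_def)
  then have "emeasure M ((X -` C \<inter> space M) \<inter> ((\<lambda>\<omega>. G (X \<omega>, Y \<omega>)) -` E \<inter> space M))
      = emeasure (distr M S X \<Otimes>\<^sub>M distr M T Y) Q"
    unfolding eq by (subst emeasure_distr[OF pair Q]) simp
  also have "\<dots> = (\<integral>\<^sup>+x. emeasure (distr M T Y) (Pair x -` Q) \<partial>distr M S X)"
    using Q by (intro DY.emeasure_pair_measure_alt) (simp cong: sets_pair_measure_cong)
  also have "\<dots> = (\<integral>\<^sup>+x. emeasure \<mu> E * indicator C x \<partial>distr M S X)"
  proof (rule nn_integral_cong)
    fix x assume "x \<in> space (distr M S X)"
    then have x: "x \<in> space S" by simp
    have Gx: "(\<lambda>y. G (x, y)) \<in> borel_measurable T" using measurable_Pair2[OF G x] .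
    show "emeasure (distr M T Y) (Pair x -` Q) = emeasure \<mu> E * indicator C x"
    proof (cases "x \<in> C")
      case True
      have "Pair x -` Q = (\<lambda>y. G (x, y)) -` E \<inter> space T"
        using True x by (auto simp: Q_def space_pair_measure)
      then have "emeasure (distr M T Y) (Pair x -` Q) = emeasure M (Y -` ((\<lambda>y. G (x, y)) -` E \<inter> space T) \<inter> space M)"
        using measurable_sets[OF Gx E] by (simp add: emeasure_distr[OF XY(2)])
      also have "Y -` ((\<lambda>y. G (x, y)) -` E \<inter> space T) \<inter> space M = (\<lambda>\<omega>. G (x, Y \<omega>)) -` E \<inter> space M"
        using measurable_space[OF XY(2)] by auto
      also have "emeasure M \<dots> = emeasure (distr M borel (\<lambda>\<omega>. G (x, Y \<omega>))) E"
        using measurable_compose[OF XY(2) Gx] E by (simp add: emeasure_distr)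
      finally show ?thesis using True law[OF x] by simp
    next
      case False
      then have "Pair x -` Q = {}" by (auto simp: Q_def)
      then show ?thesis using False by simp
    qed
  qed
  also have "\<dots> = emeasure \<mu> E * emeasure (distr M S X) C"
    using C by (simp add: nn_integral_cmult_indicator)
  also have "\<dots> = emeasure M (X -` C \<inter> space M) * emeasure \<mu> E"
    using C XY by (simp add: emeasure_distr mult.commute)
  finally show ?thesis .
qed

text \<open>Earlier increments are functions of the past, so the probability of a joint event
  factors off its last increment by \<open>indep_increment_prob\<close>; induction gives the full
  product.\<close>

lemma indep_increments:
  fixes G :: "nat \<Rightarrow> (nat \<Rightarrow> 'b) \<times> 'b \<Rightarrow> real"
  assumes ind: "indep_vars (\<lambda>_. N) A (UNIV :: nat set)"
    and G: "\<And>k. G k \<in> borel_measurable (Pi\<^sub>M {..<k} (\<lambda>_. N) \<Otimes>\<^sub>M N)"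
    and law: "\<And>k x. x \<in> space (Pi\<^sub>M {..<k} (\<lambda>_. N)) \<Longrightarrow> distr M borel (\<lambda>\<omega>. G k (x, A k \<omega>)) = \<mu>"
  defines "\<xi> \<equiv> \<lambda>k \<omega>. G k (\<lambda>i\<in>{..<k}. A i \<omega>, A k \<omega>)"
  shows "indep_vars (\<lambda>_. borel) \<xi> UNIV" "\<And>k. distr M borel (\<xi> k) = \<mu>"
proof -
  define P where "P k = (\<lambda>\<omega>. \<lambda>i\<in>{..<k}. A i \<omega>)" for k
  have A: "A k \<in> measurable M N" for k
    using ind unfolding indep_vars_def2 by auto
  have P: "P k \<in> measurable M (Pi\<^sub>M {..<k} (\<lambda>_. N))" for k
    unfolding P_def using A by (intro measurable_restrict)
  have pd: "distr M (Pi\<^sub>M {..<k} (\<lambda>_. N)) (P k) \<Otimes>\<^sub>M distr M N (A k) =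
      distr M (Pi\<^sub>M {..<k} (\<lambda>_. N) \<Otimes>\<^sub>M N) (\<lambda>\<omega>. (P k \<omega>, A k \<omega>))" for k
    unfolding P_def by (rule pair_distr_past[OF ind])
  have \<xi>: "\<xi> k \<in> borel_measurable M" for k
    using measurable_compose[OF measurable_Pair[OF P A] G, of k] by (simp add: \<xi>_def P_def)
  have step: "emeasure M ((P k -` C \<inter> space M) \<inter> (\<xi> k -` E \<inter> space M)) = emeasure M (P k -` C \<inter> space M) * emeasure \<mu> E"
    if "C \<in> sets (Pi\<^sub>M {..<k} (\<lambda>_. N))" "E \<in> sets borel" for k C E
    using indep_increment_prob[OF P A pd G law that] by (simp add: \<xi>_def P_def)
  show distr: "distr M borel (\<xi> k) = \<mu>" for k
  proof (rule measure_eqI)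
    obtain x where x: "x \<in> space (Pi\<^sub>M {..<k} (\<lambda>_. N))"
      using measurable_space[OF P] not_empty by blast
    show sets: "sets (distr M borel (\<xi> k)) = sets \<mu>" using law[OF x, symmetric] by simp
    fix E assume "E \<in> sets (distr M borel (\<xi> k))"
    then have E: "E \<in> sets borel" by simp
    \<comment> \<open>With the whole space as event of the past, the factorisation reduces to the
      law of the increment itself.\<close>
    have "P k -` space (Pi\<^sub>M {..<k} (\<lambda>_. N)) \<inter> space M = space M" using measurable_space[OF P] by auto
    then show "emeasure (distr M borel (\<xi> k)) E = emeasure \<mu> E"
      using step[OF sets.top E, of k] \<xi> E by (simp add: emeasure_distr emeasure_space_1 Int_absorb1)
  qed
  have prod: "emeasure M {\<omega> \<in> space M. \<forall>j<k. \<xi> j \<omega> \<in> E j} = (\<Prod>j<k. emeasure M (\<xi> j -` E j \<inter> space M))"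
    if E: "\<And>j. j < k \<Longrightarrow> E j \<in> sets borel" for k E
    using E
  proof (induction k)
    case 0
    then show ?case by (simp add: emeasure_space_1)
  next
    case (Suc k)
    \<comment> \<open>\<open>H j\<close> recomputes increment \<open>j\<close> from the first
      \<open>k\<close> matrices, so that the joint event becomes an event \<open>C\<close> of the
      past.\<close>
    define H where "H j x = G j (restrict x {..<j}, x j)" for j and x :: "nat \<Rightarrow> 'b"
    have H: "H j \<in> borel_measurable (Pi\<^sub>M {..<k} (\<lambda>_. N))" if "j < k" for j
      unfolding H_def
      by (rule measurable_compose[OF measurable_Pair[OF measurable_restrict_subset measurable_component_singleton] G])
        (use that in auto)
    define C where "C = {x \<in> space (Pi\<^sub>M {..<k} (\<lambda>_. N)). \<forall>j\<in>{..<k}. H j x \<in> E j}"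
    have "{x \<in> space (Pi\<^sub>M {..<k} (\<lambda>_. N)). H j x \<in> E j} \<in> sets (Pi\<^sub>M {..<k} (\<lambda>_. N))" if "j < k" for j
    proof -
      have "H j -` E j \<inter> space (Pi\<^sub>M {..<k} (\<lambda>_. N)) \<in> sets (Pi\<^sub>M {..<k} (\<lambda>_. N))"
        using H[OF that] Suc.prems[of j] that by (intro measurable_sets) auto
      then show ?thesis by (simp add: vimage_def Int_def conj_commute)
    qed
    then have C: "C \<in> sets (Pi\<^sub>M {..<k} (\<lambda>_. N))"
      unfolding C_def by (intro sets.sets_Collect_finite_All) auto
    have HP: "H j (P k \<omega>) = \<xi> j \<omega>" if "j < k" for j \<omega>
      using that by (simp add: H_def P_def \<xi>_def restrict_def) (intro arg_cong[of _ _ "G j"], auto simp: restrict_def fun_eq_iff)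
    have PC: "P k -` C \<inter> space M = {\<omega> \<in> space M. \<forall>j<k. \<xi> j \<omega> \<in> E j}"
      using measurable_space[OF P] HP by (auto simp: C_def)
    have "{\<omega> \<in> space M. \<forall>j<Suc k. \<xi> j \<omega> \<in> E j} = (P k -` C \<inter> space M) \<inter> (\<xi> k -` E k \<inter> space M)"
      unfolding PC by (auto simp: less_Suc_eq)
    also have "emeasure M \<dots> = emeasure M (P k -` C \<inter> space M) * emeasure \<mu> (E k)"
      using C Suc.prems[of k] by (intro step) auto
    also have "emeasure \<mu> (E k) = emeasure M (\<xi> k -` E k \<inter> space M)"
      unfolding distr[of k, symmetric] using \<xi> Suc.prems[of k] by (simp add: emeasure_distr)
    finally show ?case unfolding PC using Suc by simp
  qed
  show "indep_vars (\<lambda>_. borel) \<xi> UNIV"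
    unfolding indep_vars_def2
  proof (intro conjI ballI \<xi>)
    let ?F = "\<lambda>i. {\<xi> i -` E \<inter> space M |E. E \<in> sets borel}"
    have fin: "indep_sets ?F {..<k}" if "k > 0" for k
    proof (subst indep_sets_finite)
      show "\<And>i. i \<in> {..<k} \<Longrightarrow> ?F i \<subseteq> events" using \<xi> by (auto intro: measurable_sets)
      show "\<And>i. i \<in> {..<k} \<Longrightarrow> space M \<in> ?F i" by (auto intro!: exI[of _ UNIV])
      show "\<forall>A\<in>Pi {..<k} ?F. prob (\<Inter>j\<in>{..<k}. A j) = (\<Prod>j\<in>{..<k}. prob (A j))"
      proof
        fix B assume "B \<in> Pi {..<k} ?F"
        then have "\<forall>j. \<exists>E. j < k \<longrightarrow> B j = \<xi> j -` E \<inter> space M \<and> E \<in> sets borel" by (auto simp: Pi_iff)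
        then obtain E where E: "\<And>j. j < k \<Longrightarrow> B j = \<xi> j -` E j \<inter> space M" "\<And>j. j < k \<Longrightarrow> E j \<in> sets borel"
          by metis
        have "(\<Inter>j\<in>{..<k}. B j) = {\<omega> \<in> space M. \<forall>j<k. \<xi> j \<omega> \<in> E j}"
          using E(1) that by auto
        then have "emeasure M (\<Inter>j\<in>{..<k}. B j) = (\<Prod>j<k. emeasure M (B j))"
          using prod[of k E] E by simp
        then show "prob (\<Inter>j\<in>{..<k}. B j) = (\<Prod>j\<in>{..<k}. prob (B j))"
          by (simp add: emeasure_eq_measure prod_ennreal prod_nonneg)
      qed
    qed (use that in auto)
    show "indep_sets ?F UNIV"
    proof (subst indep_sets_finite_index_sets, intro allI impI)
      fix J :: "nat set" assume J: "finite J" "J \<noteq> {}"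
      then have "J \<subseteq> {..<Suc (Max J)}" by (auto simp: less_Suc_eq_le)
      then show "indep_sets ?F J" using fin[of "Suc (Max J)"] by (intro indep_sets_mono_index[of J]) auto
    qed
  qed
qed

end

section \<open>Products of independent matrices with invariant law\<close>

lemma mat_prod_cong: "(\<And>j. j < k \<Longrightarrow> f j = g j) \<Longrightarrow> mat_prod n f k = mat_prod n g k"
  by (induction k) auto

lemma measurable_mat_prod:
  fixes f :: "'a \<Rightarrow> nat \<Rightarrow> 'p :: prime_card padic mat"
  assumes "\<And>j. j < k \<Longrightarrow> (\<lambda>\<omega>. f \<omega> j) \<in> measurable M (borel_GL n)"
  shows "(\<lambda>\<omega>. mat_prod n (f \<omega>) k) \<in> measurable M (borel_GL n)"
  using assms
proof (induction k)
  case 0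
  then show ?case using GL_one[of n, where 'a = "'p padic"] by (simp add: space_borel_GL)
next
  case (Suc k)
  then show ?case by (auto intro!: measurable_GL_mult)
qed

locale biinvariant_products = prob_space M for M :: "'w measure" +
  fixes A :: "nat \<Rightarrow> 'w \<Rightarrow> 'p :: prime_card padic mat" and n :: nat
  assumes indep: "indep_vars (\<lambda>_. borel_GL n) A UNIV"
    and ident: "\<And>k. distr M (borel_GL n) (A k) = distr M (borel_GL n) (A 0)"
    and left_inv: "\<And>U. U \<in> GL_Zp n \<Longrightarrow>
      distr M (borel_GL n) (\<lambda>\<omega>. U * A 0 \<omega>) = distr M (borel_GL n) (A 0)"
begin

lemma A_measurable: "A k \<in> measurable M (borel_GL n)"
  using indep unfolding indep_vars_def2 by auto

lemma A_GL: "\<omega> \<in> space M \<Longrightarrow> A k \<omega> \<in> GL n"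
  using measurable_space[OF A_measurable] by (simp add: space_borel_GL)

definition B :: "nat \<Rightarrow> 'w \<Rightarrow> 'p padic mat" where
  "B k \<omega> = mat_prod n (\<lambda>j. A j \<omega>) k"

lemma B_measurable: "B k \<in> measurable M (borel_GL n)"
  using measurable_mat_prod[of k "\<lambda>\<omega> j. A j \<omega>" M n] A_measurable by (simp add: B_def[abs_def])

lemma B_GL: "\<omega> \<in> space M \<Longrightarrow> B k \<omega> \<in> GL n"
  using measurable_space[OF B_measurable] by (simp add: space_borel_GL)

lemma B_Suc: "B (Suc k) \<omega> = B k \<omega> * A k \<omega>"
  by (simp add: B_def)

lemma measurable_left_mult: "U \<in> GL n \<Longrightarrow> (\<lambda>a. U * a) \<in> measurable (borel_GL n) (borel_GL n)"
  for U :: "'p padic mat"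
  by (rule measurable_GL_mult) (auto simp: space_borel_GL measurable_ident_sets)

lemma A_left_inv:
  assumes "U \<in> GL_Zp n"
  shows "distr M (borel_GL n) (\<lambda>\<omega>. U * A k \<omega>) = distr M (borel_GL n) (A 0)"
proof -
  note U = measurable_left_mult[OF GL_Zp_subset_GL[OF assms]]
  have "distr M (borel_GL n) (\<lambda>\<omega>. U * A k \<omega>) = distr (distr M (borel_GL n) (A k)) (borel_GL n) (\<lambda>a. U * a)" for k
    by (subst distr_distr[OF U A_measurable]) (simp add: comp_def)
  then show ?thesis using ident left_inv[OF assms] by metis
qed

lemma indep_var_B_A: "indep_var (borel_GL n) (B k) (borel_GL n) (A k)"
proof -
  have "(\<lambda>x. mat_prod n x k) \<in> measurable (Pi\<^sub>M {..<k} (\<lambda>_. borel_GL n)) (borel_GL n :: 'p padic mat measure)"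
    by (rule measurable_mat_prod) (auto intro: measurable_component_singleton)
  from indep_var_compose[OF indep_var_restrict[OF indep, of "{..<k}" "{k}"] this measurable_component_singleton[of k "{k}"]]
  have "indep_var (borel_GL n) (\<lambda>\<omega>. mat_prod n (\<lambda>i\<in>{..<k}. A i \<omega>) k) (borel_GL n) (A k)"
    by (simp add: comp_def)
  moreover have "mat_prod n (\<lambda>i\<in>{..<k}. A i \<omega>) k = B k \<omega>" for \<omega>
    unfolding B_def by (rule mat_prod_cong) simp
  ultimately show ?thesis by simp
qed

text \<open>A factor on the left meets the first matrix only, and further matrices are appended
  independently on the right. The index is \<open>Suc k\<close> because the empty product is the
  constant identity matrix.\<close>

lemma B_left_inv:
  assumes U: "U \<in> GL_Zp n"
  shows "distr M (borel_GL n) (\<lambda>\<omega>. U * B (Suc k) \<omega>) = distr M (borel_GL n) (B (Suc k))"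
proof (induction k)
  case 0
  have "B (Suc 0) \<omega> = A 0 \<omega>" if "\<omega> \<in> space M" for \<omega>
    using left_mult_one_mat[OF GL_carrier[OF A_GL[OF that, of 0]]] by (simp add: B_def)
  then show ?case using left_inv[OF U] by (simp cong: distr_cong)
next
  case (Suc k)
  let ?N = "borel_GL n :: 'p padic mat measure"
  note Um = measurable_left_mult[OF GL_Zp_subset_GL[OF U]]
  have mult: "(\<lambda>z. fst z * snd z) \<in> measurable (?N \<Otimes>\<^sub>M ?N) ?N"
    by (rule measurable_GL_mult) auto
  have 1: "distr M (?N \<Otimes>\<^sub>M ?N) (\<lambda>\<omega>. (X \<omega>, A (Suc k) \<omega>)) = distr M ?N X \<Otimes>\<^sub>M distr M ?N (A (Suc k))"
    if "indep_var ?N X ?N (A (Suc k))" for X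
    using that unfolding indep_var_distribution_eq by simp
  have 2: "indep_var ?N (\<lambda>\<omega>. U * B (Suc k) \<omega>) ?N (A (Suc k))"
    using indep_var_compose[OF indep_var_B_A Um measurable_ident] by (simp add: comp_def)
  have pm: "(\<lambda>\<omega>. (X \<omega>, A (Suc k) \<omega>)) \<in> measurable M (?N \<Otimes>\<^sub>M ?N)" if "X \<in> measurable M ?N" for X
    using that A_measurable by (rule measurable_Pair)
  have UB: "(\<lambda>\<omega>. U * B (Suc k) \<omega>) \<in> measurable M ?N" by (rule measurable_compose[OF B_measurable Um])
  have "distr M ?N (\<lambda>\<omega>. U * B (Suc (Suc k)) \<omega>) = distr M ?N (\<lambda>\<omega>. (U * B (Suc k) \<omega>) * A (Suc k) \<omega>)"
  proof (rule distr_cong[OF refl refl])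
    fix \<omega> assume "\<omega> \<in> space M"
    then show "U * B (Suc (Suc k)) \<omega> = U * B (Suc k) \<omega> * A (Suc k) \<omega>"
      using GL_ZpD(1)[OF U] GL_carrier[OF B_GL] GL_carrier[OF A_GL]
      by (subst B_Suc) (simp add: assoc_mult_mat[of _ n n _ n _ n])
  qed
  also have "\<dots> = distr (distr M (?N \<Otimes>\<^sub>M ?N) (\<lambda>\<omega>. (U * B (Suc k) \<omega>, A (Suc k) \<omega>))) ?N (\<lambda>z. fst z * snd z)"
    by (subst distr_distr[OF mult pm[OF UB]]) (simp add: comp_def)
  also have "distr M (?N \<Otimes>\<^sub>M ?N) (\<lambda>\<omega>. (U * B (Suc k) \<omega>, A (Suc k) \<omega>)) = distr M (?N \<Otimes>\<^sub>M ?N) (\<lambda>\<omega>. (B (Suc k) \<omega>, A (Suc k) \<omega>))"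
    unfolding 1[OF 2] 1[OF indep_var_B_A] Suc.IH ..
  also have "distr \<dots> ?N (\<lambda>z. fst z * snd z) = distr M ?N (B (Suc (Suc k)))"
    by (subst distr_distr[OF mult pm[OF B_measurable]]) (simp add: comp_def B_Suc[abs_def])
  finally show ?case .
qed

definition deviation :: "nat \<Rightarrow> 'p padic mat \<Rightarrow> real" where
  "deviation q C = row_val (n - q) C - real_of_int (tail_sum q (SN C))"

lemma deviation_measurable: "q \<le> n \<Longrightarrow> deviation q \<in> borel_measurable (borel_GL n)"
  unfolding deviation_def[abs_def]
  by (intro borel_measurable_diff borel_measurable_row_val borel_measurable_tail_sum_SN) auto

text \<open>By left invariance the event has the same probability for
  \<open>congruence_mat n f * B (Suc k) \<omega>\<close>, for every \<open>f\<close>. Averaging over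
  \<open>F\<close> inside the expectation leaves, for each fixed matrix, the count bounded by
  \<open>card_large_deviation\<close>; hence a bound independent of \<open>k\<close>.\<close>

lemma prob_deviation:
  assumes "q \<le> n"
  shows "prob {\<omega> \<in> space M. deviation q (B (Suc k) \<omega>) > real (q * Suc t)} \<le> real q / real CARD('p) ^ t"
proof -
  define F where "F = ({..<n} \<times> {..<n}) \<rightarrow>\<^sub>E {..<CARD('p) ^ t}"
  define S where "S = deviation q -` {real (q * Suc t)<..} \<inter> space (borel_GL n)"
  have S: "S \<in> sets (borel_GL n)"
    unfolding S_def by (rule measurable_sets[OF deviation_measurable[OF assms]]) simp
  have fin: "finite F" unfolding F_def by (intro finite_PiE) auto
  have ne: "card F > 0"
    unfolding F_def using CARD_gt_1[where 'p = 'p] by (subst card_PiE) (auto simp: prod_constant)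
  let ?G = "\<lambda>f. congruence_mat n f :: 'p padic mat"
  let ?E = "\<lambda>X. (\<lambda>\<omega>. X \<omega>) -` S \<inter> space M"
  have GBm: "(\<lambda>\<omega>. ?G f * B (Suc k) \<omega>) \<in> measurable M (borel_GL n)" for f
    by (rule measurable_compose[OF B_measurable measurable_left_mult]) (intro GL_Zp_subset_GL congruence_mat_GL_Zp)
  have same: "prob (?E (\<lambda>\<omega>. ?G f * B (Suc k) \<omega>)) = prob (?E (B (Suc k)))" for f
  proof -
    have "measure (distr M (borel_GL n) (\<lambda>\<omega>. ?G f * B (Suc k) \<omega>)) S = measure (distr M (borel_GL n) (B (Suc k))) S"
      by (simp only: B_left_inv[OF congruence_mat_GL_Zp])
    then show ?thesis using S GBm B_measurable by (simp add: measure_distr)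
  qed
  have "real (card F) * prob (?E (B (Suc k))) = (\<Sum>f\<in>F. prob (?E (\<lambda>\<omega>. ?G f * B (Suc k) \<omega>)))"
    by (simp only: same) simp
  also have "\<dots> = (\<Sum>f\<in>F. expectation (indicat_real (?E (\<lambda>\<omega>. ?G f * B (Suc k) \<omega>))))"
    using measurable_sets[OF GBm S] by (intro sum.cong refl) simp
  also have "\<dots> = expectation (\<lambda>\<omega>. \<Sum>f\<in>F. indicat_real (?E (\<lambda>\<omega>. ?G f * B (Suc k) \<omega>)) \<omega>)"
    using measurable_sets[OF GBm S]
    by (intro Bochner_Integration.integral_sum[symmetric] integrable_real_indicator) (auto simp: emeasure_eq_measure)
  also have "\<dots> \<le> expectation (\<lambda>_. real q * real (card F) / real CARD('p) ^ t)"
  proof (rule integral_mono)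
    show "integrable M (\<lambda>\<omega>. \<Sum>f\<in>F. indicat_real (?E (\<lambda>\<omega>. ?G f * B (Suc k) \<omega>)) \<omega>)"
      using measurable_sets[OF GBm S] by (intro Bochner_Integration.integrable_sum integrable_real_indicator) (auto simp: emeasure_eq_measure)
    fix \<omega> assume \<omega>: "\<omega> \<in> space M"
    note BG = B_GL[OF \<omega>, of "Suc k"]
    have "(\<Sum>f\<in>F. indicat_real (?E (\<lambda>\<omega>. ?G f * B (Suc k) \<omega>)) \<omega>) = real (card {f \<in> F. ?G f * B (Suc k) \<omega> \<in> S})"
      using \<omega> fin by (simp add: indicator_def sum.If_cases Int_def conj_commute)
    also have "{f \<in> F. ?G f * B (Suc k) \<omega> \<in> S} = {f \<in> F. row_val (n - q) (?G f * B (Suc k) \<omega>) - real_of_int (tail_sum q (SN (?G f * B (Suc k) \<omega>))) > real (q * Suc t)}"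
      using GL_mult[OF GL_Zp_subset_GL[OF congruence_mat_GL_Zp] BG] by (auto simp: S_def space_borel_GL deviation_def)
    finally have eq: "(\<Sum>f\<in>F. indicat_real (?E (\<lambda>\<omega>. ?G f * B (Suc k) \<omega>)) \<omega>) =
      real (card {f \<in> F. row_val (n - q) (?G f * B (Suc k) \<omega>) - real_of_int (tail_sum q (SN (?G f * B (Suc k) \<omega>))) > real (q * Suc t)})" .
    have "real (card {f \<in> F. row_val (n - q) (?G f * B (Suc k) \<omega>) - real_of_int (tail_sum q (SN (?G f * B (Suc k) \<omega>))) > real (q * Suc t)} * CARD('p) ^ t)
        \<le> real (q * card F)"
      unfolding F_def by (intro of_nat_mono card_large_deviation[OF BG assms])
    then show "(\<Sum>f\<in>F. indicat_real (?E (\<lambda>\<omega>. ?G f * B (Suc k) \<omega>)) \<omega>) \<le> real q * real (card F) / real CARD('p) ^ t"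
      unfolding eq using CARD_real_gt_1[where 'p = 'p] by (simp add: pos_le_divide_eq)
  qed simp
  also have "\<dots> = real q * real (card F) / real CARD('p) ^ t" by (simp add: prob_space)
  finally have "prob (?E (B (Suc k))) \<le> real q / real CARD('p) ^ t"
    using ne CARD_real_gt_1[where 'p = 'p] by (simp add: field_simps)
  moreover have "?E (B (Suc k)) = {\<omega> \<in> space M. deviation q (B (Suc k) \<omega>) > real (q * Suc t)}"
    using B_GL by (auto simp: S_def space_borel_GL)
  ultimately show ?thesis by simp
qed

text \<open>One scalar walk for each direction \<open>s\<close>: unit vectors serve the law of large
  numbers for a single value, general \<open>s\<close> the linear functionals in the central limit
  theorem.\<close>

definition increment :: "(nat \<Rightarrow> real) \<Rightarrow> nat \<Rightarrow> 'w \<Rightarrow> real" where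
  "increment s k \<omega> = (\<Sum>i<n. s i * (row_val i (B (Suc k) \<omega>) - row_val i (B k \<omega>)))"

text \<open>For a frozen past the increment is a function of \<open>V * A k \<omega>\<close>, where
  \<open>V\<close> depends on the past. Left invariance removes \<open>V\<close> from the law, which
  is the hypothesis of \<open>indep_increments\<close>.\<close>

lemma increments_iid:
  "indep_vars (\<lambda>_. borel) (increment s) UNIV"
  "distr M borel (increment s k) = distr M borel (\<lambda>\<omega>. \<Sum>i<n. s i * row_val i (A 0 \<omega>))"
proof -
  let ?N = "borel_GL n :: 'p padic mat measure"
  define h where "h a = (\<Sum>i<n. s i * row_val i a)" for a :: "'p padic mat"
  have h: "h \<in> borel_measurable ?N"
    unfolding h_def by (intro borel_measurable_sum borel_measurable_times borel_measurable_const borel_measurable_row_val) auto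
  define G where "G k = (\<lambda>(x, a). h (mat_prod n x k * a) - h (mat_prod n x k))" for k
  have mp: "(\<lambda>x. mat_prod n x k) \<in> measurable (Pi\<^sub>M {..<k} (\<lambda>_. ?N)) ?N" for k
    by (rule measurable_mat_prod) (auto intro: measurable_component_singleton)
  have G: "G k \<in> borel_measurable (Pi\<^sub>M {..<k} (\<lambda>_. ?N) \<Otimes>\<^sub>M ?N)" for k
    unfolding G_def case_prod_beta'
    by (intro borel_measurable_diff measurable_compose[OF _ h] measurable_GL_mult measurable_compose[OF measurable_fst mp]
        measurable_snd)
  have law: "distr M borel (\<lambda>\<omega>. G k (x, A k \<omega>)) = distr M borel (\<lambda>\<omega>. h (A 0 \<omega>))"
    if x: "x \<in> space (Pi\<^sub>M {..<k} (\<lambda>_. ?N))" for k x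
  proof -
    have "mat_prod n x k \<in> GL n" using measurable_space[OF mp x] by (simp add: space_borel_GL)
    then obtain V where V: "V \<in> GL_Zp n"
      "\<And>A i. A \<in> GL n \<Longrightarrow> i \<le> n \<Longrightarrow> row_val i (mat_prod n x k * A) - row_val i (mat_prod n x k) = row_val i (V * A)"
      using row_val_mult by blast
    have "G k (x, a) = h (V * a)" if "a \<in> GL n" for a
      using that V(2) by (simp add: G_def h_def flip: sum_subtractf right_diff_distrib)
    then have "distr M borel (\<lambda>\<omega>. G k (x, A k \<omega>)) = distr M borel (\<lambda>\<omega>. h (V * A k \<omega>))"
      using A_GL by (intro distr_cong) auto
    also have "\<dots> = distr (distr M ?N (\<lambda>\<omega>. V * A k \<omega>)) borel h"
      using measurable_compose[OF A_measurable measurable_left_mult[OF GL_Zp_subset_GL[OF V(1)]]]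
      by (subst distr_distr[OF h]) (auto simp: comp_def)
    also have "\<dots> = distr M borel (\<lambda>\<omega>. h (A 0 \<omega>))"
      unfolding A_left_inv[OF V(1)] by (subst distr_distr[OF h A_measurable]) (simp add: comp_def)
    finally show ?thesis .
  qed
  have inc: "increment s = (\<lambda>k \<omega>. G k (\<lambda>i\<in>{..<k}. A i \<omega>, A k \<omega>))"
  proof (intro ext)
    fix k \<omega>
    have "mat_prod n (\<lambda>i\<in>{..<k}. A i \<omega>) k = B k \<omega>" unfolding B_def by (rule mat_prod_cong) simp
    then show "increment s k \<omega> = G k (\<lambda>i\<in>{..<k}. A i \<omega>, A k \<omega>)"
      by (simp add: increment_def G_def h_def B_Suc sum_subtractf right_diff_distrib)
  qed
  show "indep_vars (\<lambda>_. borel) (increment s) UNIV"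
    unfolding inc by (rule indep_increments(1)[OF indep G law])
  show "distr M borel (increment s k) = distr M borel (\<lambda>\<omega>. \<Sum>i<n. s i * row_val i (A 0 \<omega>))"
    unfolding inc using indep_increments(2)[OF indep G law] by (simp add: h_def)
qed

lemma sum_increment: "(\<Sum>j<k. increment s j \<omega>) = (\<Sum>i<n. s i * row_val i (B k \<omega>))"
proof -
  have "row_val i (B 0 \<omega>) = 0" if "i < n" for i
    using row_val_GL_Zp[OF GL_Zp_one, of i n] that by (simp add: B_def)
  then have "(\<Sum>j<k. row_val i (B (Suc j) \<omega>) - row_val i (B j \<omega>)) = row_val i (B k \<omega>)" if "i < n" for i
    using that sum_lessThan_telescope[of "\<lambda>j. row_val i (B j \<omega>)" k] by simp
  then show ?thesis
    unfolding increment_def by (subst sum.swap) (simp flip: sum_distrib_left)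
qed

end

section \<open>The strong law of large numbers\<close>

text \<open>The empty sum is among the candidates, so the maximum is nonnegative, and it is positive
  only if a nonempty sum is.\<close>

definition max_partial_sum :: "nat \<Rightarrow> (nat \<Rightarrow> real) \<Rightarrow> real" where
  "max_partial_sum n x = Max ((\<lambda>j. \<Sum>i<j. x i) ` {..n})"

lemma max_partial_sum_ge: "j \<le> n \<Longrightarrow> (\<Sum>i<j. x i) \<le> max_partial_sum n x"
  unfolding max_partial_sum_def by (intro Max_ge) auto

lemma max_partial_sum_nonneg: "0 \<le> max_partial_sum n x"
  using max_partial_sum_ge[of 0 n x] by simp

lemma max_partial_sum_attained:
  obtains j where "j \<le> n" "max_partial_sum n x = (\<Sum>i<j. x i)"
proof -
  have "max_partial_sum n x \<in> (\<lambda>j. \<Sum>i<j. x i) ` {..n}"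
    unfolding max_partial_sum_def by (intro Max_in) auto
  then show ?thesis using that by auto
qed

lemma max_partial_sum_abs_le: "\<bar>max_partial_sum n x\<bar> \<le> (\<Sum>i<n. \<bar>x i\<bar>)"
proof -
  obtain j where j: "j \<le> n" "max_partial_sum n x = (\<Sum>i<j. x i)" by (rule max_partial_sum_attained)
  have "\<bar>\<Sum>i<j. x i\<bar> \<le> (\<Sum>i<j. \<bar>x i\<bar>)" by (rule sum_abs)
  also have "\<dots> \<le> (\<Sum>i<n. \<bar>x i\<bar>)" using j by (intro sum_mono2) auto
  finally show ?thesis using j by simp
qed

text \<open>Garsia's step towards the maximal ergodic inequality: a positive maximum is attained by
  a nonempty sum, from which the first term is split off.\<close>

lemma max_partial_sum_shift:
  "max_partial_sum n x - max_partial_sum n (\<lambda>i. x (Suc i)) \<le> (if max_partial_sum n x > 0 then x 0 else 0)"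
proof (cases "max_partial_sum n x > 0")
  case True
  obtain j where j: "j \<le> n" "max_partial_sum n x = (\<Sum>i<j. x i)" by (rule max_partial_sum_attained)
  then obtain j' where j': "j = Suc j'" using True by (cases j) auto
  have "max_partial_sum n x = x 0 + (\<Sum>i<j'. x (Suc i))"
    unfolding j(2) j' by (rule sum.lessThan_Suc_shift)
  also have "\<dots> \<le> x 0 + max_partial_sum n (\<lambda>i. x (Suc i))"
    using j(1) j' by (intro add_left_mono max_partial_sum_ge) auto
  finally show ?thesis using True by simp
next
  case False
  then show ?thesis using max_partial_sum_nonneg[of n "\<lambda>i. x (Suc i)"] by simp
qed

section \<open>Maximal inequality and almost sure bounds on partial sums\<close>

context prob_space
begin

lemma indep_vars_shift:
  assumes "indep_vars (\<lambda>_. N) X (UNIV :: nat set)"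
  shows "indep_vars (\<lambda>_. N) (\<lambda>i. X (m + i)) UNIV"
  unfolding indep_vars_def2
proof (intro conjI ballI indep_setsI)
  let ?F = "\<lambda>i. {X i -` A \<inter> space M |A. A \<in> sets N}"
  have ind: "indep_sets ?F UNIV" and rv: "\<And>i. random_variable N (X i)"
    using assms unfolding indep_vars_def2 by auto
  show "random_variable N (X (m + i))" for i by (rule rv)
  show "?F (m + i) \<subseteq> events" for i using rv by (auto intro: measurable_sets)
  fix A J assume J: "J \<noteq> {}" "J \<subseteq> UNIV" "finite J" "\<forall>j\<in>J. A j \<in> ?F (m + j)"
  have "prob (\<Inter>j\<in>(+) m ` J. A (j - m)) = (\<Prod>j\<in>(+) m ` J. prob (A (j - m)))"
    by (rule indep_setsD[OF ind]) (use J in auto)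
  then show "prob (\<Inter>j\<in>J. A j) = (\<Prod>j\<in>J. prob (A j))"
    by (simp add: prod.reindex image_image comp_def)
qed

lemma distr_shift_eq:
  fixes X :: "nat \<Rightarrow> 'a \<Rightarrow> real"
  assumes ind: "indep_vars (\<lambda>_. borel) X UNIV" and law: "\<And>k. distr M borel (X k) = \<mu>"
  shows "distr M (Pi\<^sub>M {..<n} (\<lambda>_. borel)) (\<lambda>\<omega>. \<lambda>i\<in>{..<n}. X (m + i) \<omega>) =
    distr M (Pi\<^sub>M {..<n} (\<lambda>_. borel)) (\<lambda>\<omega>. \<lambda>i\<in>{..<n}. X i \<omega>)"
proof (cases "n = 0")
  case True
  then show ?thesis by (simp add: restrict_def)
next
  case False
  have rv: "random_variable borel (X i)" for i using ind unfolding indep_vars_def2 by auto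
  have "distr M (Pi\<^sub>M {..<n} (\<lambda>_. borel)) (\<lambda>\<omega>. \<lambda>i\<in>{..<n}. X (k + i) \<omega>) = Pi\<^sub>M {..<n} (\<lambda>_. \<mu>)" for k
    using indep_vars_iff_distr_eq_PiM[where I = "{..<n}" and M' = "\<lambda>_. borel" and X = "\<lambda>i. X (k + i)"] False rv law
      indep_vars_subset[OF indep_vars_shift[OF ind, of k], of "{..<n}"] by auto
  from this[of m] this[of 0] show ?thesis by simp
qed

text \<open>The maximum and its shift have the same law, hence the same expectation, so integrating
  \<open>max_partial_sum_shift\<close> leaves 0 on the smaller side.\<close>

lemma maximal_inequality:
  fixes X :: "nat \<Rightarrow> 'a \<Rightarrow> real"
  assumes ind: "indep_vars (\<lambda>_. borel) X UNIV" and law: "\<And>k. distr M borel (X k) = \<mu>"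
    and int: "\<And>k. integrable M (X k)"
  shows "0 \<le> expectation (\<lambda>\<omega>. if max_partial_sum n (\<lambda>i. X i \<omega>) > 0 then X 0 \<omega> else 0)"
proof -
  have rv[measurable]: "random_variable borel (X i)" for i using ind unfolding indep_vars_def2 by auto
  let ?P = "Pi\<^sub>M {..<n} (\<lambda>_. borel) :: (nat \<Rightarrow> real) measure"
  define Q where "Q m \<omega> = max_partial_sum n (\<lambda>i. X (m + i) \<omega>)" for m \<omega>
  have Q_meas[measurable]: "Q m \<in> borel_measurable M" for m
    unfolding Q_def max_partial_sum_def by measurable
  have Q_int: "integrable M (Q m)" for m
    by (rule Bochner_Integration.integrable_bound[of _ "\<lambda>\<omega>. \<Sum>i<n. \<bar>X (m + i) \<omega>\<bar>"])
      (use int max_partial_sum_abs_le[of n "\<lambda>i. X (m + i) _"] in \<open>auto simp: Q_def sum_nonneg\<close>)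
  have restr: "max_partial_sum n (\<lambda>i\<in>{..<n}. x i) = max_partial_sum n x" for x
    unfolding max_partial_sum_def by (intro arg_cong[of _ _ Max] image_cong refl sum.cong) auto
  have m: "max_partial_sum n \<in> borel_measurable ?P"
    unfolding max_partial_sum_def
    by (intro borel_measurable_Max borel_measurable_sum measurable_component_singleton) auto
  have QE: "expectation (Q m) = (\<integral>x. max_partial_sum n x \<partial>distr M ?P (\<lambda>\<omega>. \<lambda>i\<in>{..<n}. X (m + i) \<omega>))" for m
    by (subst integral_distr[OF _ m]) (auto simp: restr Q_def[abs_def] intro!: measurable_restrict)
  have "expectation (Q 1) = expectation (Q 0)"
    unfolding QE distr_shift_eq[OF ind law, of n 1] by simp
  then have "0 = expectation (\<lambda>\<omega>. Q 0 \<omega> - Q 1 \<omega>)" using Q_int by simp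
  also have "\<dots> \<le> expectation (\<lambda>\<omega>. if Q 0 \<omega> > 0 then X 0 \<omega> else 0)"
  proof (rule integral_mono)
    show "integrable M (\<lambda>\<omega>. if Q 0 \<omega> > 0 then X 0 \<omega> else 0)"
      by (rule Bochner_Integration.integrable_bound[OF int[of 0]]) (auto intro!: measurable_If)
    show "Q 0 \<omega> - Q 1 \<omega> \<le> (if Q 0 \<omega> > 0 then X 0 \<omega> else 0)" for \<omega>
      using max_partial_sum_shift[of n "\<lambda>i. X i \<omega>"] by (simp add: Q_def)
  qed (use Q_int in auto)
  finally show ?thesis by (simp add: Q_def)
qed

text \<open>
  By the zero-one law the partial sums are unbounded above with probability 0 or 1; in the second
  case the maximal inequality would give a nonnegative mean in the limit.
\<close>
lemma partial_sums_bounded_above: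
  fixes X :: "nat \<Rightarrow> 'a \<Rightarrow> real"
  assumes ind: "indep_vars (\<lambda>_. borel) X UNIV" and law: "\<And>k. distr M borel (X k) = \<mu>"
    and int: "\<And>k. integrable M (X k)" and neg: "expectation (X 0) < 0"
  shows "AE \<omega> in M. \<exists>C::nat. \<forall>j. (\<Sum>i<j. X i \<omega>) \<le> real C"
proof -
  have rv[measurable]: "random_variable borel (X i)" for i using ind unfolding indep_vars_def2 by auto
  define U where "U = {\<omega> \<in> space M. \<forall>C::nat. \<exists>j. (\<Sum>i<j. X i \<omega>) > real C}"
  have U[measurable]: "U \<in> events" unfolding U_def by measurable
  define F where "F i = {X i -` A \<inter> space M |A. A \<in> sets borel}" for i
  have F: "F i = sets (vimage_algebra (space M) (X i) borel)" for i
    unfolding F_def by (subst sets_vimage_algebra2) auto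
  \<comment> \<open>Dropping the first \<open>n\<close> terms changes all longer partial sums by the
    same amount, and the finitely many shorter ones cannot exceed every bound.\<close>
  have tail: "U \<in> tail_events F"
    unfolding tail_events_def
  proof
    fix n
    define N where "N = sigma (space M) (\<Union>(F ` {n..}))"
    have sub: "\<Union>(F ` {n..}) \<subseteq> Pow (space M)" by (auto simp: F_def)
    have N: "space N = space M" "sets N = sigma_sets (space M) (\<Union>(F ` {n..}))"
      using sub by (simp_all add: N_def space_measure_of sets_measure_of)
    have XN: "X i \<in> borel_measurable N" if "n \<le> i" for i
    proof (rule measurableI)
      fix A :: "real set" assume "A \<in> sets borel"
      then have "X i -` A \<inter> space M \<in> \<Union>(F ` {n..})" using that by (auto simp: F_def)
      then show "X i -` A \<inter> space N \<in> sets N" unfolding N by (rule sigma_sets.Basic)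
    qed simp
    have "{\<omega> \<in> space N. \<forall>C::nat. \<exists>j. (\<Sum>i\<in>{n..<n + j}. X i \<omega>) > real C} \<in> sets N"
    proof -
      have "(\<lambda>\<omega>. \<Sum>i\<in>{n..<n + j}. X i \<omega>) \<in> borel_measurable N" for j
        using XN by (intro borel_measurable_sum) auto
      then have "{\<omega> \<in> space N. (\<Sum>i\<in>{n..<n + j}. X i \<omega>) > real C} \<in> sets N" for C :: nat and j
        by (simp add: borel_measurable_iff_greater)
      then show ?thesis by (rule sets.sets_Collect_countable_All[OF sets.sets_Collect_countable_Ex])
    qed
    also have "{\<omega> \<in> space N. \<forall>C::nat. \<exists>j. (\<Sum>i\<in>{n..<n + j}. X i \<omega>) > real C} = U"
    proof -
      have split: "(\<Sum>i<n + j. X i \<omega>) = (\<Sum>i<n. X i \<omega>) + (\<Sum>i\<in>{n..<n + j}. X i \<omega>)" for j \<omega>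
        using sum.atLeastLessThan_concat[of 0 n "n + j" "\<lambda>i. X i \<omega>"] by (simp add: atLeast0LessThan)
      have "(\<forall>C::nat. \<exists>j. (\<Sum>i\<in>{n..<n + j}. X i \<omega>) > real C) \<longleftrightarrow> (\<forall>C::nat. \<exists>j. (\<Sum>i<j. X i \<omega>) > real C)" for \<omega>
      proof safe
        fix C :: nat
        assume *: "\<forall>C::nat. \<exists>j. (\<Sum>i\<in>{n..<n + j}. X i \<omega>) > real C"
        obtain j where "(\<Sum>i\<in>{n..<n + j}. X i \<omega>) > real (nat \<lceil>\<bar>\<Sum>i<n. X i \<omega>\<bar>\<rceil> + C)" using * by blast
        then have "(\<Sum>i<n + j. X i \<omega>) > real C" unfolding split by linarith
        then show "\<exists>j. (\<Sum>i<j. X i \<omega>) > real C" by blast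
      next
        fix C :: nat
        assume *: "\<forall>C::nat. \<exists>j. (\<Sum>i<j. X i \<omega>) > real C"
        \<comment> \<open>Large enough to exclude indices below \<open>n\<close> and to absorb the
          first \<open>n\<close> terms.\<close>
        define K where "K = nat \<lceil>\<Sum>i<n. \<bar>X i \<omega>\<bar>\<rceil> + C"
        have K: "(\<Sum>i<n. \<bar>X i \<omega>\<bar>) + real C \<le> real K"
          using of_nat_ceiling[of "\<Sum>i<n. \<bar>X i \<omega>\<bar>"] by (simp add: K_def)
        obtain j where j: "(\<Sum>i<j. X i \<omega>) > real K" using * by blast
        have "n \<le> j"
        proof (rule ccontr)
          assume "\<not> n \<le> j"
          have "(\<Sum>i<j. X i \<omega>) \<le> (\<Sum>i<j. \<bar>X i \<omega>\<bar>)" by (intro sum_mono) simp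
          also have "\<dots> \<le> (\<Sum>i<n. \<bar>X i \<omega>\<bar>)" using \<open>\<not> n \<le> j\<close> by (intro sum_mono2) auto
          finally show False using j K by linarith
        qed
        then obtain l where l: "j = n + l" using le_Suc_ex by blast
        have "(\<Sum>i<n. X i \<omega>) \<le> (\<Sum>i<n. \<bar>X i \<omega>\<bar>)" by (intro sum_mono) simp
        then have "(\<Sum>i\<in>{n..<n + l}. X i \<omega>) > real C" using j K unfolding l split by linarith
        then show "\<exists>j. (\<Sum>i\<in>{n..<n + j}. X i \<omega>) > real C" by blast
      qed
      then show ?thesis by (simp add: U_def N)
    qed
    finally show "U \<in> sigma_sets (space M) (\<Union>(F ` {n..}))" unfolding N .
  qed
  have "prob U = 0 \<or> prob U = 1"
  proof (rule kolmogorov_0_1_law[OF _ _ tail])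
    show "sigma_algebra (space M) (F i)" for i
      unfolding F by (metis sets.sigma_algebra_axioms space_vimage_algebra)
    show "indep_sets F UNIV" using ind unfolding indep_vars_def2 F_def[abs_def] by simp
  qed
  moreover have "prob U \<noteq> 1"
  proof
    assume "prob U = 1"
    then have AE: "AE \<omega> in M. \<omega> \<in> U" using prob_eq_1[OF U] by simp
    \<comment> \<open>On \<open>U\<close> some partial sum is positive, so the truncation by the
      positivity of the maximum eventually disappears and the truncated means tend to the full
      one.\<close>
    have "(\<lambda>n. expectation (\<lambda>\<omega>. if max_partial_sum n (\<lambda>i. X i \<omega>) > 0 then X 0 \<omega> else 0)) \<longlonglongrightarrow> expectation (X 0)"
    proof (rule integral_dominated_convergence)
      show "integrable M (\<lambda>\<omega>. \<bar>X 0 \<omega>\<bar>)" using int by simp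
      show "AE \<omega> in M. (\<lambda>n. if max_partial_sum n (\<lambda>i. X i \<omega>) > 0 then X 0 \<omega> else 0) \<longlonglongrightarrow> X 0 \<omega>"
        using AE
      proof eventually_elim
        case (elim \<omega>)
        then obtain j where j: "(\<Sum>i<j. X i \<omega>) > real 0" unfolding U_def by blast
        have "\<forall>\<^sub>F n in sequentially. (if max_partial_sum n (\<lambda>i. X i \<omega>) > 0 then X 0 \<omega> else 0) = X 0 \<omega>"
          using eventually_ge_at_top[of j]
        proof eventually_elim
          case (elim n)
          then show ?case using max_partial_sum_ge[OF elim, of "\<lambda>i. X i \<omega>"] j by simp
        qed
        then show ?case by (rule tendsto_eventually)
      qed
      have "(\<lambda>\<omega>. max_partial_sum n (\<lambda>i. X i \<omega>)) \<in> borel_measurable M" for n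
        unfolding max_partial_sum_def by measurable
      then show "(\<lambda>\<omega>. if max_partial_sum n (\<lambda>i. X i \<omega>) > 0 then X 0 \<omega> else 0) \<in> borel_measurable M" for n
        by (auto intro!: measurable_If)
    qed auto
    then have "0 \<le> expectation (X 0)"
      using maximal_inequality[OF ind law int] by (intro LIMSEQ_le_const) auto
    then show False using neg by simp
  qed
  ultimately have "AE \<omega> in M. \<omega> \<notin> U" using prob_eq_0[OF U] by simp
  then show ?thesis using AE_space
  proof eventually_elim
    case (elim \<omega>)
    then show ?case unfolding U_def by (auto simp: not_less)
  qed
qed

text \<open>Subtracting slightly more than the mean makes the drift negative, so the partial sums
  stay below a finite random bound, which vanishes after division by \<open>k\<close>. Countably
  many excesses \<open>1 / (l + 1)\<close> suffice.\<close>

lemma slln_upper: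
  fixes X :: "nat \<Rightarrow> 'a \<Rightarrow> real"
  assumes ind: "indep_vars (\<lambda>_. borel) X UNIV" and law: "\<And>k. distr M borel (X k) = \<mu>"
    and int: "integrable M (X 0)"
  shows "AE \<omega> in M. \<forall>e>0. \<forall>\<^sub>F k in sequentially. (\<Sum>i<k. X i \<omega>) / real k \<le> expectation (X 0) + e"
proof -
  have rv[measurable]: "random_variable borel (X i)" for i using ind unfolding indep_vars_def2 by auto
  define m where "m = expectation (X 0)"
  have ints: "integrable M (X k)" and exps: "expectation (X k) = m" for k
  proof -
    have eq: "distr M borel (X k) = distr M borel (X 0)" using law by simp
    show "integrable M (X k)"
      using int integrable_distr_eq[OF rv[of k], of "\<lambda>x. x"] integrable_distr_eq[OF rv[of 0], of "\<lambda>x. x"] eq by simp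
    show "expectation (X k) = m"
      unfolding m_def using integral_distr[OF rv[of k], of "\<lambda>x. x"] integral_distr[OF rv[of 0], of "\<lambda>x. x"] eq by simp
  qed
  have "AE \<omega> in M. \<exists>C::nat. \<forall>j. (\<Sum>i<j. X i \<omega> - (m + 1 / real (Suc l))) \<le> real C" for l
  proof (rule partial_sums_bounded_above)
    let ?c = "m + 1 / real (Suc l)"
    show "indep_vars (\<lambda>_. borel) (\<lambda>i \<omega>. X i \<omega> - ?c) UNIV"
      by (rule indep_vars_compose2[OF ind]) simp
    show "distr M borel (\<lambda>\<omega>. X k \<omega> - ?c) = distr \<mu> borel (\<lambda>x. x - ?c)" for k
      unfolding law[of k, symmetric] by (subst distr_distr) (auto simp: comp_def)
    show "integrable M (\<lambda>\<omega>. X k \<omega> - ?c)" for k using ints by simp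
    show "expectation (\<lambda>\<omega>. X 0 \<omega> - ?c) < 0" using ints exps by (simp add: prob_space)
  qed
  then have "AE \<omega> in M. \<forall>l. \<exists>C::nat. \<forall>j. (\<Sum>i<j. X i \<omega> - (m + 1 / real (Suc l))) \<le> real C"
    by (subst AE_all_countable) auto
  then show ?thesis
  proof eventually_elim
    case (elim \<omega>)
    show ?case
    proof (intro allI impI)
      fix e :: real assume "e > 0"
      then obtain l where l: "1 / real (Suc l) < e / 2" using nat_approx_posE[of "e / 2"] by auto
      obtain C :: nat where C: "\<And>j. (\<Sum>i<j. X i \<omega> - (m + 1 / real (Suc l))) \<le> real C" using elim by blast
      obtain K where K: "real C / (e / 2) < real K" using reals_Archimedean2 by blast
      have "(\<Sum>i<k. X i \<omega>) / real k \<le> m + e" if k: "k \<ge> Suc K" for k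
      proof -
        have kpos: "real k > 0" using k by simp
        have "(\<Sum>i<k. X i \<omega>) \<le> real C + real k * (m + 1 / real (Suc l))"
          using C[of k] by (simp add: sum_subtractf)
        also have "real C \<le> real k * (e / 2)"
        proof -
          have "real C < real K * (e / 2)" using K \<open>e > 0\<close> by (simp add: pos_divide_less_eq)
          also have "\<dots> \<le> real k * (e / 2)" using k \<open>e > 0\<close> by (intro mult_right_mono) auto
          finally show ?thesis by simp
        qed
        also have "real k * (m + 1 / real (Suc l)) \<le> real k * (m + e / 2)"
          using l by (intro mult_left_mono) auto
        finally have "(\<Sum>i<k. X i \<omega>) \<le> real k * (m + e)" by (simp add: algebra_simps)
        then show ?thesis using kpos by (simp add: pos_divide_le_eq mult.commute)
      qed
      then show "\<forall>\<^sub>F k in sequentially. (\<Sum>i<k. X i \<omega>) / real k \<le> expectation (X 0) + e"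
        unfolding eventually_sequentially m_def by blast
    qed
  qed
qed

text \<open>The lower bound is \<open>slln_upper\<close> for the negated variables.\<close>

theorem strong_law_of_large_numbers:
  fixes X :: "nat \<Rightarrow> 'a \<Rightarrow> real"
  assumes ind: "indep_vars (\<lambda>_. borel) X UNIV" and law: "\<And>k. distr M borel (X k) = \<mu>"
    and int: "integrable M (X 0)"
  shows "AE \<omega> in M. (\<lambda>k. (\<Sum>i<k. X i \<omega>) / real k) \<longlonglongrightarrow> expectation (X 0)"
proof -
  have rv[measurable]: "random_variable borel (X i)" for i using ind unfolding indep_vars_def2 by auto
  have "AE \<omega> in M. \<forall>e>0. \<forall>\<^sub>F k in sequentially. (\<Sum>i<k. - X i \<omega>) / real k \<le> expectation (\<lambda>\<omega>. - X 0 \<omega>) + e"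
  proof (rule slln_upper)
    show "indep_vars (\<lambda>_. borel) (\<lambda>i \<omega>. - X i \<omega>) UNIV" by (rule indep_vars_compose2[OF ind]) simp
    show "distr M borel (\<lambda>\<omega>. - X k \<omega>) = distr \<mu> borel uminus" for k
      unfolding law[of k, symmetric] by (subst distr_distr) (auto simp: comp_def)
  qed (use int in auto)
  with slln_upper[OF assms] show ?thesis
  proof eventually_elim
    case (elim \<omega>)
    show ?case
      unfolding tendsto_iff
    proof (intro allI impI)
      fix e :: real assume "e > 0"
      then have "\<forall>\<^sub>F k in sequentially. (\<Sum>i<k. X i \<omega>) / real k \<le> expectation (X 0) + e / 2"
        "\<forall>\<^sub>F k in sequentially. (\<Sum>i<k. - X i \<omega>) / real k \<le> - expectation (X 0) + e / 2"
        using elim by (auto dest!: spec[of _ "e / 2"])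
      then show "\<forall>\<^sub>F k in sequentially. dist ((\<Sum>i<k. X i \<omega>) / real k) (expectation (X 0)) < e"
        by eventually_elim (use \<open>e > 0\<close> in \<open>auto simp: dist_real_def sum_negf abs_less_iff\<close>)
    qed
  qed
qed

end

section \<open>The Cramer-Wold device\<close>

text \<open>The free phase \<open>b\<close> also covers sines, so product-to-sum formulas close the
  set under products with a single kind of generator. Means of generators are determined by
  characteristic functions.\<close>

inductive_set trig_poly :: "nat \<Rightarrow> ((nat \<Rightarrow> real) \<Rightarrow> real) set" for n where
  cos: "(\<lambda>x. c * cos ((\<Sum>i<n. t i * x i) + b)) \<in> trig_poly n"
| add: "f \<in> trig_poly n \<Longrightarrow> g \<in> trig_poly n \<Longrightarrow> (\<lambda>x. f x + g x) \<in> trig_poly n"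

lemma trig_poly_const: "(\<lambda>_. c) \<in> trig_poly n"
  using trig_poly.cos[where t = "\<lambda>_. 0" and b = 0 and c = c and n = n] by simp

lemma trig_poly_sin: "j < n \<Longrightarrow> (\<lambda>x. sin (w * x j)) \<in> trig_poly n"
proof -
  assume j: "j < n"
  have "(\<Sum>i<n. (if i = j then w else 0) * x i) = w * x j" for x :: "nat \<Rightarrow> real"
    using j by (simp add: if_distrib[of "\<lambda>y. y * _"] cong: if_cong)
  then show ?thesis
    using trig_poly.cos[where t = "\<lambda>i. if i = j then w else 0" and b = "- (pi / 2)" and c = 1 and n = n]
    by (simp add: cos_diff)
qed

lemma trig_poly_mult:
  assumes "f \<in> trig_poly n" "g \<in> trig_poly n"
  shows "(\<lambda>x. f x * g x) \<in> trig_poly n"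
  using assms
proof (induction f rule: trig_poly.induct)
  case (cos c t b)
  from cos.prems show ?case
  proof (induction g rule: trig_poly.induct)
    case (cos c' t' b')
    have "(\<lambda>x. (c * c' / 2) * cos ((\<Sum>i<n. (t i - t' i) * x i) + (b - b')) + (c * c' / 2) * cos ((\<Sum>i<n. (t i + t' i) * x i) + (b + b'))) \<in> trig_poly n"
      by (intro trig_poly.add trig_poly.cos)
    moreover have "c * cos ((\<Sum>i<n. t i * x i) + b) * (c' * cos ((\<Sum>i<n. t' i * x i) + b')) =
      (c * c' / 2) * cos ((\<Sum>i<n. (t i - t' i) * x i) + (b - b')) + (c * c' / 2) * cos ((\<Sum>i<n. (t i + t' i) * x i) + (b + b'))"
      for x :: "nat \<Rightarrow> real"
    proof -
      define u where "u = (\<Sum>i<n. t i * x i) + b"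
      define v where "v = (\<Sum>i<n. t' i * x i) + b'"
      have "(\<Sum>i<n. (t i - t' i) * x i) + (b - b') = u - v" "(\<Sum>i<n. (t i + t' i) * x i) + (b + b') = u + v"
        by (simp_all add: u_def v_def left_diff_distrib distrib_right sum_subtractf sum.distrib)
      moreover have "c * cos u * (c' * cos v) = (c * c' / 2) * cos (u - v) + (c * c' / 2) * cos (u + v)"
        by (simp add: cos_diff cos_add algebra_simps)
      ultimately show ?thesis by (simp only: u_def v_def)
    qed
    ultimately show ?case by simp
  next
    case (add f g)
    from trig_poly.add[OF add.IH] show ?case by (simp only: distrib_left)
  qed
next
  case (add f1 f2)
  from trig_poly.add[OF add.IH[OF add.prems]] show ?case by (simp only: distrib_right)
qed

lemma trig_poly_bounded:
  "f \<in> trig_poly n \<Longrightarrow> \<exists>K. \<forall>x. \<bar>f x\<bar> \<le> K"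
proof (induction rule: trig_poly.induct)
  case (cos c t b)
  have "\<bar>c * cos ((\<Sum>i<n. t i * x i) + b)\<bar> \<le> \<bar>c\<bar> * 1" for x
    unfolding abs_mult by (intro mult_left_mono) auto
  then show ?case by blast
next
  case (add f g)
  then obtain K K' where "\<forall>x. \<bar>f x\<bar> \<le> K" "\<forall>x. \<bar>g x\<bar> \<le> K'" by blast
  then have "\<bar>f x + g x\<bar> \<le> K + K'" for x by (meson abs_triangle_ineq add_mono order_trans)
  then show ?case by blast
qed

lemma trig_poly_measurable:
  "f \<in> trig_poly n \<Longrightarrow> f \<in> borel_measurable (borel_Rn n)"
proof (induction rule: trig_poly.induct)
  case (cos c t b)
  have "(\<lambda>x. \<Sum>i<n. t i * x i) \<in> borel_measurable (borel_Rn n)"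
    by (intro borel_measurable_sum borel_measurable_times borel_measurable_const measurable_component_singleton) auto
  then show ?case by measurable
next
  case (add f g)
  then show ?case by measurable
qed

text \<open>The identification of Borel and product structures is available for all functions on
  \<open>nat\<close>. So \<open>f\<close> is composed with restriction to the first \<open>n\<close>
  coordinates, which is continuous on the full space, and pulled back along extension by
  zero.\<close>

lemma borel_measurable_continuous_Rn:
  assumes f: "continuous_map (top_Rn n) euclideanreal f"
  shows "f \<in> borel_measurable (borel_Rn n)"
proof -
  have res: "continuous_map euclidean (top_Rn n) (\<lambda>x. \<lambda>i\<in>{..<n}. x i :: real)"
    unfolding continuous_map_componentwise
  proof (intro conjI ballI)
    show "(\<lambda>x. \<lambda>i\<in>{..<n}. x i) ` topspace euclidean \<subseteq> extensional {..<n}" by auto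
    fix k assume k: "k \<in> {..<n}"
    have "continuous_map euclidean euclideanreal (\<lambda>x :: nat \<Rightarrow> real. x k)"
      by (simp add: continuous_on_product_coordinates)
    then show "continuous_map euclidean euclideanreal (\<lambda>x. (\<lambda>i\<in>{..<n}. x i) k)" using k by simp
  qed
  have "continuous_map euclidean euclideanreal (f \<circ> (\<lambda>x. \<lambda>i\<in>{..<n}. x i))"
    by (rule continuous_map_compose[OF res f])
  then have "(f \<circ> (\<lambda>x. \<lambda>i\<in>{..<n}. x i)) \<in> borel_measurable borel"
    by (intro borel_measurable_continuous_onI) simp
  then have m: "(f \<circ> (\<lambda>x. \<lambda>i\<in>{..<n}. x i)) \<in> borel_measurable (Pi\<^sub>M UNIV (\<lambda>_ :: nat. borel :: real measure))"
    by (simp cong: measurable_cong_sets add: sets_PiM_equal_borel)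
  have e: "(\<lambda>x i. if i < n then x i else 0) \<in> measurable (borel_Rn n) (Pi\<^sub>M UNIV (\<lambda>_ :: nat. borel :: real measure))"
  proof (rule measurable_PiM_single')
    fix i :: nat
    show "(\<lambda>x. if i < n then x i else 0) \<in> borel_measurable (borel_Rn n)"
      by (cases "i < n") (auto intro: measurable_component_singleton)
  qed auto
  have "(\<lambda>x. (f \<circ> (\<lambda>x. \<lambda>i\<in>{..<n}. x i)) (\<lambda>i. if i < n then x i else 0)) \<in> borel_measurable (borel_Rn n)"
    by (rule measurable_compose[OF e m])
  moreover have "(f \<circ> (\<lambda>x. \<lambda>i\<in>{..<n}. x i)) (\<lambda>i. if i < n then x i else 0) = f x" if "x \<in> space (borel_Rn n)" for x
  proof -
    have "(\<lambda>i\<in>{..<n}. if i < n then x i else 0) = x"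
      using that by (auto simp: space_PiM PiE_def extensional_def fun_eq_iff)
    then show ?thesis by simp
  qed
  ultimately show ?thesis by (simp cong: measurable_cong)
qed

text \<open>
  Folding each coordinate into \<open>{-R..R}\<close> by \<open>x \<mapsto> (2 R / \<pi>) arcsin (sin (\<pi> x / (2 R)))\<close> turns \<open>f\<close> into
  a continuous function of the sines, which is uniformly close on the whole space to a
  trigonometric polynomial.
\<close>
lemma trig_poly_approx:
  assumes f: "continuous_map (top_Rn n) euclideanreal f" and R: "R > 0" and e: "e > 0"
  obtains T where "T \<in> trig_poly n"
    "\<And>x. \<bar>f (\<lambda>i\<in>{..<n}. (2 * R / pi) * arcsin (sin (pi / (2 * R) * x i))) - T x\<bar> < e"
proof -
  define w where "w = pi / (2 * R)"
  \<comment> \<open>The cube of possible sine values, placed among sequences that vanish from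
    \<open>n\<close> on. This keeps it compact in the full sequence space, where Stone-Weierstrass
    is applied.\<close>
  define S where "S = Pi\<^sub>E UNIV (\<lambda>i :: nat. if i < n then {-1..1 :: real} else {0})"
  define \<sigma> where "\<sigma> x = (\<lambda>i. if i < n then sin (w * x i) else 0)" for x :: "nat \<Rightarrow> real"
  define g where "g s = f (\<lambda>i\<in>{..<n}. (2 * R / pi) * arcsin (s i))" for s :: "nat \<Rightarrow> real"
  \<comment> \<open>The function algebra on the cube: functions that become trigonometric
    polynomials when the sines are inserted. Coordinates belong to it and separate points.\<close>
  define Q where "Q = {q. continuous_on S q \<and> (\<lambda>x. q (\<sigma> x)) \<in> trig_poly n}"
  have S: "compact S"
  proof -
    have "compactin (product_topology (\<lambda>i :: nat. euclideanreal) UNIV) S"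
      unfolding S_def by (subst compactin_PiE) auto
    then show ?thesis by (simp add: euclidean_product_topology)
  qed
  have coord: "continuous_on S (\<lambda>s. s i)" for i :: nat
    by (rule continuous_on_subset[OF continuous_on_product_coordinates]) simp
  have "continuous_on S g"
  proof -
    have "continuous_map (top_of_set S) (top_Rn n) (\<lambda>s. \<lambda>i\<in>{..<n}. (2 * R / pi) * arcsin (s i))"
      unfolding continuous_map_componentwise
    proof (intro conjI ballI)
      show "(\<lambda>s. \<lambda>i\<in>{..<n}. 2 * R / pi * arcsin (s i)) ` topspace (top_of_set S) \<subseteq> extensional {..<n}" by auto
      fix k assume k: "k \<in> {..<n}"
      have "continuous_on S (\<lambda>s. (2 * R / pi) * arcsin (s k))"
      proof (intro continuous_on_mult continuous_on_const continuous_on_arcsin coord ballI)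
        fix s assume "s \<in> S"
        then have "s k \<in> {-1..1}" using k unfolding S_def by (auto dest!: PiE_mem[where x = k])
        then show "- 1 \<le> s k \<and> s k \<le> 1" by simp
      qed
      then show "continuous_map (top_of_set S) euclideanreal (\<lambda>s. (\<lambda>i\<in>{..<n}. 2 * R / pi * arcsin (s i)) k)"
        using k by simp
    qed
    from continuous_map_compose[OF this f] show ?thesis by (simp add: comp_def g_def)
  qed
  interpret function_ring_on Q S
  proof
    show "compact S" by (rule S)
    show "continuous_on S q" if "q \<in> Q" for q using that by (simp add: Q_def)
    show "(\<lambda>x. q x + r x) \<in> Q" if "q \<in> Q" "r \<in> Q" for q r
      using that unfolding Q_def by (auto intro: continuous_on_add trig_poly.add)
    show "(\<lambda>x. q x * r x) \<in> Q" if "q \<in> Q" "r \<in> Q" for q r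
      using that unfolding Q_def by (auto intro: continuous_on_mult trig_poly_mult)
    show "(\<lambda>_. c) \<in> Q" for c unfolding Q_def by (simp add: trig_poly_const)
    fix x y assume xy: "x \<in> S" "y \<in> S" "x \<noteq> y"
    then obtain i where i: "x i \<noteq> y i" by blast
    have "i < n"
    proof (rule ccontr)
      assume "\<not> i < n"
      then have "x i = 0" "y i = 0" using xy unfolding S_def by (auto dest!: PiE_mem[where x = i])
      then show False using i by simp
    qed
    then have *: "(\<lambda>s. s i) \<in> Q" unfolding Q_def using coord trig_poly_sin[of i n w] by (simp add: \<sigma>_def)
    show "\<exists>q\<in>Q. q x \<noteq> q y" by (rule bexI[OF _ *]) (rule i)
  qed
  obtain q where q: "q \<in> Q" "\<And>s. s \<in> S \<Longrightarrow> \<bar>g s - q s\<bar> < e"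
    using Stone_Weierstrass_basic[OF \<open>continuous_on S g\<close> e] by blast
  show ?thesis
  proof (rule that)
    show "(\<lambda>x. q (\<sigma> x)) \<in> trig_poly n" using q(1) by (simp add: Q_def)
    fix x :: "nat \<Rightarrow> real"
    have "\<sigma> x \<in> S" unfolding S_def \<sigma>_def by auto
    from q(2)[OF this] show "\<bar>f (\<lambda>i\<in>{..<n}. (2 * R / pi) * arcsin (sin (pi / (2 * R) * x i))) - q (\<sigma> x)\<bar> < e"
      by (simp add: g_def \<sigma>_def w_def cong: restrict_cong)
  qed
qed

text \<open>A continuous stand-in for the indicator of large values: it vanishes up to
  \<open>R\<close> and equals 1 from \<open>R + 1\<close> on. Continuity allows smallness to pass
  from the limit measure to the sequence.\<close>

definition tail_fun :: "real \<Rightarrow> real \<Rightarrow> real" where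
  "tail_fun R x = min 1 (max 0 (\<bar>x\<bar> - R))"

lemma tail_fun_bounds: "0 \<le> tail_fun R x" "tail_fun R x \<le> 1"
  by (auto simp: tail_fun_def)

lemma tail_fun_measurable [measurable]: "tail_fun R \<in> borel_measurable borel"
  unfolding tail_fun_def by measurable

lemma (in prob_space) tail_fun_small:
  assumes X[measurable]: "X \<in> borel_measurable M" and e: "e > 0"
  shows "\<forall>\<^sub>F R in sequentially. expectation (\<lambda>\<omega>. tail_fun (real R) (X \<omega>)) < e"
proof -
  have "(\<lambda>R. expectation (\<lambda>\<omega>. tail_fun (real R) (X \<omega>))) \<longlonglongrightarrow> expectation (\<lambda>\<omega>. 0)"
  proof (rule integral_dominated_convergence[where w = "\<lambda>_. 1"])
    show "AE \<omega> in M. (\<lambda>R. tail_fun (real R) (X \<omega>)) \<longlonglongrightarrow> 0"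
    proof (rule AE_I2)
      fix \<omega>
      have "\<forall>\<^sub>F R in sequentially. tail_fun (real R) (X \<omega>) = 0"
        using eventually_ge_at_top[of "nat \<lceil>\<bar>X \<omega>\<bar>\<rceil>"]
      proof eventually_elim
        case (elim R)
        then have "\<bar>X \<omega>\<bar> \<le> real R" by linarith
        then show ?case by (simp add: tail_fun_def)
      qed
      then show "(\<lambda>R. tail_fun (real R) (X \<omega>)) \<longlonglongrightarrow> 0" by (rule tendsto_eventually)
    qed
    show "(\<lambda>\<omega>. tail_fun (real R) (X \<omega>)) \<in> borel_measurable M" for R by measurable
  qed (auto simp: tail_fun_bounds)
  then show ?thesis using e by (auto dest: order_tendstoD(2))
qed

text \<open>The phase \<open>- (pi / 2)\<close> turns the cosine into the sine, so convergence of
  shifted cosine means is convergence of characteristic functions.\<close>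

lemma char_eq_cos:
  assumes "prob_space M" "sets M = sets (borel :: real measure)"
  shows "char M t = Complex (\<integral>x. cos (t * x) \<partial>M) (\<integral>x. cos (t * x + - (pi / 2)) \<partial>M)"
proof -
  interpret prob_space M by fact
  have [measurable_cong]: "sets M = sets borel" by fact
  have int: "integrable M (\<lambda>x. iexp (t * x))"
    by (rule integrable_const_bound[where B = 1]) (auto simp: norm_exp_i_times simp del: of_real_mult)
  show ?thesis
  proof (rule complex_eqI)
    show "Re (char M t) = Re (Complex (\<integral>x. cos (t * x) \<partial>M) (\<integral>x. cos (t * x + - (pi / 2)) \<partial>M))"
      unfolding char_def using integral_Re[OF int] by (simp add: Re_exp)
    show "Im (char M t) = Im (Complex (\<integral>x. cos (t * x) \<partial>M) (\<integral>x. cos (t * x + - (pi / 2)) \<partial>M))"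
      unfolding char_def using integral_Im[OF int] by (simp add: Im_exp cos_diff)
  qed
qed

text \<open>A trigonometric polynomial close to the folded \<open>f\<close> has convergent means by
  assumption. The error of folding lives on large values only, and these are controlled uniformly
  through the one-dimensional marginals.\<close>

theorem Cramer_Wold:
  fixes \<mu> :: "nat \<Rightarrow> (nat \<Rightarrow> real) measure"
  assumes \<mu>: "\<And>k. prob_space (\<mu> k)" "\<And>k. sets (\<mu> k) = sets (borel_Rn n)"
    and \<nu>: "prob_space \<nu>" "sets \<nu> = sets (borel_Rn n)"
    and conv: "\<And>t b. (\<lambda>k. \<integral>x. cos ((\<Sum>i<n. t i * x i) + b) \<partial>\<mu> k) \<longlonglongrightarrow> (\<integral>x. cos ((\<Sum>i<n. t i * x i) + b) \<partial>\<nu>)"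
  shows "weakly_converges (top_Rn n) \<mu> \<nu>"
  unfolding weakly_converges_def
proof (intro allI impI)
  fix f :: "(nat \<Rightarrow> real) \<Rightarrow> real"
  assume f: "continuous_map (top_Rn n) euclideanreal f \<and> bounded (f ` topspace (top_Rn n))"
  interpret \<mu>: prob_space "\<mu> k" for k by (rule \<mu>)
  interpret \<nu>: prob_space \<nu> by (rule \<nu>)
  have meas: "h \<in> borel_measurable (\<mu> k)" "h \<in> borel_measurable \<nu>" if "h \<in> borel_measurable (borel_Rn n)" for h :: "(nat \<Rightarrow> real) \<Rightarrow> real" and k
    using that by (simp_all cong: measurable_cong_sets add: \<mu>(2) \<nu>(2))
  have space: "space (\<mu> k) = topspace (top_Rn n)" "space \<nu> = topspace (top_Rn n)" for k
    using sets_eq_imp_space_eq[OF \<mu>(2)] sets_eq_imp_space_eq[OF \<nu>(2)] by (simp_all add: space_PiM)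
  obtain C0 where C0: "\<And>x. x \<in> topspace (top_Rn n) \<Longrightarrow> \<bar>f x\<bar> \<le> C0"
    using f unfolding bounded_iff by auto
  define C where "C = max C0 0"
  have C: "\<And>x. x \<in> topspace (top_Rn n) \<Longrightarrow> \<bar>f x\<bar> \<le> C" "C \<ge> 0" using C0 by (auto simp: C_def intro: max.coboundedI1)
  have fm: "f \<in> borel_measurable (borel_Rn n)" using f borel_measurable_continuous_Rn by blast
  have trig_conv: "(\<lambda>k. \<integral>x. T x \<partial>\<mu> k) \<longlonglongrightarrow> (\<integral>x. T x \<partial>\<nu>)" if "T \<in> trig_poly n" for T
    using that
  proof (induction rule: trig_poly.induct)
    case (cos c t b)
    then show ?case using tendsto_mult_left[OF conv[of t b], of c] by simp
  next
    case (add f g)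
    have i: "integrable (\<mu> k) h" "integrable \<nu> h" if h: "h \<in> trig_poly n" for h k
    proof -
      obtain K where K: "\<And>x. \<bar>h x\<bar> \<le> K" using trig_poly_bounded[OF h] by blast
      show "integrable (\<mu> k) h"
        by (rule \<mu>.integrable_const_bound[where B = K]) (use K meas[OF trig_poly_measurable[OF h]] in auto)
      show "integrable \<nu> h"
        by (rule \<nu>.integrable_const_bound[where B = K]) (use K meas[OF trig_poly_measurable[OF h]] in auto)
    qed
    show ?case using tendsto_add[OF add.IH] i[OF add.hyps(1)] i[OF add.hyps(2)] by simp
  qed
  have coord: "(\<lambda>x. x i) \<in> borel_measurable (borel_Rn n)" if "i < n" for i
    using that by (intro measurable_component_singleton) auto
  \<comment> \<open>Functionals supported on one coordinate give the characteristic functions of the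
    marginal, so Levy continuity yields its weak convergence.\<close>
  have tail_conv: "(\<lambda>k. \<integral>x. tail_fun R (x i) \<partial>\<mu> k) \<longlonglongrightarrow> (\<integral>x. tail_fun R (x i) \<partial>\<nu>)" if i: "i < n" for i R
  proof -
    let ?m = "\<lambda>k. distr (\<mu> k) borel (\<lambda>x. x i)"
    note c = meas[OF coord[OF i]]
    have rd: "real_distribution (?m k)" "real_distribution (distr \<nu> borel (\<lambda>x. x i))" for k
      using c by (auto intro!: \<mu>.real_distribution_distr \<nu>.real_distribution_distr)
    have sum1: "(\<Sum>j<n. (if j = i then t else 0) * x j) = t * x i" for t :: real and x
      using i by (simp add: if_distrib[of "\<lambda>y. y * _"] cong: if_cong)
    have cv: "(\<lambda>k. \<integral>x. cos (t * x i + b) \<partial>\<mu> k) \<longlonglongrightarrow> (\<integral>x. cos (t * x i + b) \<partial>\<nu>)" for t b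
      using conv[of "\<lambda>j. if j = i then t else 0" b] unfolding sum1 .
    have "weak_conv_m ?m (distr \<nu> borel (\<lambda>x. x i))"
    proof (rule levy_continuity[OF rd])
      fix t
      have "char (?m k) t = Complex (\<integral>x. cos (t * x i) \<partial>\<mu> k) (\<integral>x. cos (t * x i + - (pi / 2)) \<partial>\<mu> k)" for k
        using c by (subst char_eq_cos) (auto simp: integral_distr intro!: \<mu>.prob_space_distr)
      moreover have "char (distr \<nu> borel (\<lambda>x. x i)) t = Complex (\<integral>x. cos (t * x i) \<partial>\<nu>) (\<integral>x. cos (t * x i + - (pi / 2)) \<partial>\<nu>)"
        using c by (subst char_eq_cos) (auto simp: integral_distr intro!: \<nu>.prob_space_distr)
      ultimately show "(\<lambda>k. char (?m k) t) \<longlonglongrightarrow> char (distr \<nu> borel (\<lambda>x. x i)) t"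
        using tendsto_Complex[OF cv[of t 0] cv[of t "- (pi / 2)"]] by simp
    qed
    then have "(\<lambda>k. \<integral>x. tail_fun R x \<partial>?m k) \<longlonglongrightarrow> (\<integral>x. tail_fun R x \<partial>distr \<nu> borel (\<lambda>x. x i))"
      using rd by (intro weak_conv_imp_integral_bdd_continuous_conv[where B = 1])
        (auto simp: tail_fun_bounds tail_fun_def[abs_def] intro!: continuous_intros)
    then show ?thesis using c by (simp add: integral_distr)
  qed
  show "(\<lambda>k. \<integral>x. f x \<partial>\<mu> k) \<longlonglongrightarrow> (\<integral>x. f x \<partial>\<nu>)"
    unfolding tendsto_iff
  proof (intro allI impI)
    fix \<epsilon> :: real assume \<epsilon>: "0 < \<epsilon>"
    \<comment> \<open>Two approximation errors of at most \<open>e + 2 * C * real n * e\<close> each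
      and one difference of trigonometric means below \<open>e\<close> must stay below
      \<open>\<epsilon>\<close>.\<close>
    define e where "e = \<epsilon> / (4 + 4 * C * real n)"
    have den: "4 + 4 * C * real n > 0" using C(2) by (intro add_pos_nonneg) auto
    have "e * (4 + 4 * C * real n) = \<epsilon>" using den by (simp add: e_def)
    moreover have "e > 0" using \<epsilon> den by (simp add: e_def)
    ultimately have e: "e > 0" "4 * e + 4 * C * real n * e = \<epsilon>"
      by (simp_all add: algebra_simps)
    have "\<forall>\<^sub>F r in sequentially. \<forall>i\<in>{..<n}. (\<integral>x. tail_fun (real r) (x i) \<partial>\<nu>) < e"
      using \<nu>.tail_fun_small[OF meas(2)[OF coord] e(1)] by (intro eventually_ball_finite) auto
    then obtain r where r: "\<And>i. i < n \<Longrightarrow> (\<integral>x. tail_fun (real r) (x i) \<partial>\<nu>) < e"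
      by (auto dest!: eventually_happens)
    define R where "R = real r + 1"
    have R: "R > 0" by (simp add: R_def)
    define \<phi> where "\<phi> x = (\<lambda>i\<in>{..<n}. (2 * R / pi) * arcsin (sin (pi / (2 * R) * x i)))" for x :: "nat \<Rightarrow> real"
    obtain T where T: "T \<in> trig_poly n" "\<And>x. \<bar>f (\<phi> x) - T x\<bar> < e"
      using trig_poly_approx[of n f R e] f R e(1) unfolding \<phi>_def by blast
    obtain K where K: "\<And>x. \<bar>T x\<bar> \<le> K" using trig_poly_bounded[OF T(1)] by blast
    \<comment> \<open>Inside the cube of radius \<open>R = r + 1\<close> folding is the identity.
      Outside, some tail function equals 1 and pays for the trivial bound
      \<open>2 * C\<close>.\<close>
    have pt: "\<bar>f x - T x\<bar> \<le> e + 2 * C * (\<Sum>i<n. tail_fun (real r) (x i))" if x: "x \<in> topspace (top_Rn n)" for x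
    proof (cases "\<forall>i<n. \<bar>x i\<bar> \<le> R")
      case True
      have "(2 * R / pi) * arcsin (sin (pi / (2 * R) * x i)) = x i" if i: "i < n" for i
      proof -
        have "\<bar>pi / (2 * R) * x i\<bar> = pi / (2 * R) * \<bar>x i\<bar>" using R by (simp add: abs_mult)
        also have "\<dots> \<le> pi / (2 * R) * R" using True i R by (intro mult_left_mono) auto
        finally have "\<bar>pi / (2 * R) * x i\<bar> \<le> pi / 2" using R by simp
        then have "arcsin (sin (pi / (2 * R) * x i)) = pi / (2 * R) * x i"
          by (intro arcsin_sin) (simp_all only: abs_le_iff, linarith+)
        then show ?thesis using R by simp
      qed
      then have "\<phi> x = x"
        using x by (auto simp: \<phi>_def PiE_def extensional_def fun_eq_iff)
      then have "\<bar>f x - T x\<bar> \<le> e" using T(2)[of x] by simp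
      also have "\<dots> \<le> e + 2 * C * (\<Sum>i<n. tail_fun (real r) (x i))"
        using C(2) by (simp add: sum_nonneg tail_fun_bounds)
      finally show ?thesis .
    next
      case False
      then obtain i where i: "i < n" "\<bar>x i\<bar> > R" by auto
      have \<phi>x: "\<phi> x \<in> topspace (top_Rn n)" by (simp add: \<phi>_def)
      have "\<bar>f x - T x\<bar> \<le> e + 2 * C"
        using C(1)[OF x] C(1)[OF \<phi>x] T(2)[of x] by linarith
      moreover have "1 = tail_fun (real r) (x i)" using i(2) by (simp add: tail_fun_def R_def)
      moreover have "tail_fun (real r) (x i) \<le> (\<Sum>i<n. tail_fun (real r) (x i))"
        using i(1) by (intro member_le_sum) (auto simp: tail_fun_bounds)
      ultimately show ?thesis using C(2) mult_left_mono[of 1 "\<Sum>i<n. tail_fun (real r) (x i)" "2 * C"] by simp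
    qed
    have tfm: "(\<lambda>x. tail_fun (real r) (x i)) \<in> borel_measurable (borel_Rn n)" if "i < n" for i
      by (rule measurable_compose[OF coord[OF that] tail_fun_measurable])
    have main: "\<bar>(\<integral>x. f x \<partial>N) - (\<integral>x. T x \<partial>N)\<bar> \<le> e + 2 * C * (\<Sum>i<n. \<integral>x. tail_fun (real r) (x i) \<partial>N)"
      if N: "prob_space N" "sets N = sets (borel_Rn n)" for N
    proof -
      interpret N: prob_space N by (rule N)
      have mN: "h \<in> borel_measurable N" if "h \<in> borel_measurable (borel_Rn n)" for h :: "(nat \<Rightarrow> real) \<Rightarrow> real"
        using that by (simp cong: measurable_cong_sets add: N(2))
      have sN: "space N = topspace (top_Rn n)" using sets_eq_imp_space_eq[OF N(2)] by (simp add: space_PiM)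
      have i1: "integrable N f"
        by (rule N.integrable_const_bound[where B = C]) (use C mN[OF fm] sN in auto)
      have i2: "integrable N T"
        by (rule N.integrable_const_bound[where B = K]) (use K mN[OF trig_poly_measurable[OF T(1)]] in auto)
      have i3: "integrable N (\<lambda>x. tail_fun (real r) (x i))" if "i < n" for i
        by (rule N.integrable_const_bound[where B = 1]) (use mN[OF tfm[OF that]] in \<open>auto simp: tail_fun_bounds\<close>)
      have i4: "integrable N (\<lambda>x. e + 2 * C * (\<Sum>i<n. tail_fun (real r) (x i)))"
        by (intro Bochner_Integration.integrable_add integrable_mult_right Bochner_Integration.integrable_sum i3) auto
      have "\<bar>(\<integral>x. f x \<partial>N) - (\<integral>x. T x \<partial>N)\<bar> = \<bar>\<integral>x. f x - T x \<partial>N\<bar>" using i1 i2 by simp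
      also have "\<dots> \<le> (\<integral>x. \<bar>f x - T x\<bar> \<partial>N)" by (rule integral_abs_bound)
      also have "\<dots> \<le> (\<integral>x. e + 2 * C * (\<Sum>i<n. tail_fun (real r) (x i)) \<partial>N)"
        using i1 i2 i4 pt sN by (intro integral_mono) auto
      also have "\<dots> = e + 2 * C * (\<Sum>i<n. \<integral>x. tail_fun (real r) (x i) \<partial>N)"
        using i3 by (subst Bochner_Integration.integral_add)
          (auto simp: N.prob_space Bochner_Integration.integral_sum intro!: integrable_mult_right Bochner_Integration.integrable_sum)
      finally show ?thesis .
    qed
    have "\<forall>\<^sub>F k in sequentially. \<forall>i\<in>{..<n}. (\<integral>x. tail_fun (real r) (x i) \<partial>\<mu> k) < e"
      using order_tendstoD(2)[OF tail_conv r] by (intro eventually_ball_finite) auto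
    moreover have "\<forall>\<^sub>F k in sequentially. dist (\<integral>x. T x \<partial>\<mu> k) (\<integral>x. T x \<partial>\<nu>) < e"
      using trig_conv[OF T(1)] e(1) by (auto simp: tendsto_iff)
    ultimately show "\<forall>\<^sub>F k in sequentially. dist (\<integral>x. f x \<partial>\<mu> k) (\<integral>x. f x \<partial>\<nu>) < \<epsilon>"
    proof eventually_elim
      case (elim k)
      have "(\<Sum>i<n. \<integral>x. tail_fun (real r) (x i) \<partial>\<mu> k) \<le> (\<Sum>i<n. e)" using elim by (intro sum_mono) (auto intro: less_imp_le)
      then have "2 * C * (\<Sum>i<n. \<integral>x. tail_fun (real r) (x i) \<partial>\<mu> k) \<le> 2 * C * (real n * e)"
        using C(2) by (intro mult_left_mono) auto
      then have a: "\<bar>(\<integral>x. f x \<partial>\<mu> k) - (\<integral>x. T x \<partial>\<mu> k)\<bar> \<le> e + 2 * C * real n * e"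
        using main[OF \<mu>, of k] by (simp add: mult.assoc)
      have "(\<Sum>i<n. \<integral>x. tail_fun (real r) (x i) \<partial>\<nu>) \<le> (\<Sum>i<n. e)" using r by (intro sum_mono) (auto intro: less_imp_le)
      then have "2 * C * (\<Sum>i<n. \<integral>x. tail_fun (real r) (x i) \<partial>\<nu>) \<le> 2 * C * (real n * e)"
        using C(2) by (intro mult_left_mono) auto
      then have b: "\<bar>(\<integral>x. f x \<partial>\<nu>) - (\<integral>x. T x \<partial>\<nu>)\<bar> \<le> e + 2 * C * real n * e"
        using main[OF \<nu>] by (simp add: mult.assoc)
      have c: "\<bar>(\<integral>x. T x \<partial>\<mu> k) - (\<integral>x. T x \<partial>\<nu>)\<bar> < e" using elim by (simp add: dist_real_def)
      show ?case unfolding dist_real_def using a b c e by linarith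
    qed
  qed
qed

section \<open>Gaussian measures\<close>

lemma quadratic_affine_nonneg:
  assumes "\<And>s::real. 0 \<le> q + 2 * s * b"
  shows "b = 0"
proof (rule ccontr)
  assume b: "b \<noteq> 0"
  have "q + 2 * (- (q + 1) / (2 * b)) * b = -1" using b by (simp add: field_simps)
  then show False using assms[of "- (q + 1) / (2 * b)"] by simp
qed

text \<open>Completing the square in the last variable; for \<open>c = 0\<close> the convention \<open>x / 0 = 0\<close> is harmless.\<close>
lemma psd_sum_of_squares:
  fixes C :: "nat \<Rightarrow> nat \<Rightarrow> real"
  assumes "\<And>i j. i < n \<Longrightarrow> j < n \<Longrightarrow> C i j = C j i"
    and "\<And>t. 0 \<le> (\<Sum>i<n. \<Sum>j<n. t i * C i j * t j)"
  shows "\<exists>a. \<forall>t. (\<Sum>i<n. \<Sum>j<n. t i * C i j * t j) = (\<Sum>l<n. (\<Sum>i<n. a l i * t i)\<^sup>2)"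
  using assms
proof (induction n arbitrary: C)
  case (Suc n)
  define c where "c = C n n"
  define B where "B t = (\<Sum>i<n. C i n * t i)" for t
  have expand: "(\<Sum>i<Suc n. \<Sum>j<Suc n. t i * C i j * t j) =
      (\<Sum>i<n. \<Sum>j<n. t i * C i j * t j) + 2 * t n * B t + c * (t n)\<^sup>2" for t
  proof -
    have "(\<Sum>i<n. t i * C i n * t n) = t n * B t" "(\<Sum>j<n. t n * C n j * t j) = t n * B t"
      using Suc.prems(1)[of n] by (auto simp: B_def sum_distrib_left intro!: sum.cong)
    then show ?thesis by (simp add: sum.distrib c_def power2_eq_square)
  qed
  have B_upd: "B (t(n := s)) = B t" for t s by (simp add: B_def)
  have sum_upd: "(\<Sum>i<n. \<Sum>j<n. (t(n := s)) i * D i j * (t(n := s)) j) = (\<Sum>i<n. \<Sum>j<n. t i * D i j * t j)"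
    for t s and D :: "nat \<Rightarrow> nat \<Rightarrow> real"
    by (intro sum.cong refl) auto
  have nonneg: "0 \<le> (\<Sum>i<n. \<Sum>j<n. t i * C i j * t j) + 2 * s * B t + c * s\<^sup>2" for t s
    using Suc.prems(2)[of "t(n := s)"] unfolding expand sum_upd B_upd by simp
  have c0: "c \<ge> 0" using nonneg[of "\<lambda>_. 0" 1] by (simp add: B_def)
  have B0: "B t = 0" if "c = 0" for t
    using nonneg[of t] that by (intro quadratic_affine_nonneg[of "\<Sum>i<n. \<Sum>j<n. t i * C i j * t j"]) simp
  define C' where "C' i j = C i j - C i n * C j n / c" for i j
  have C': "(\<Sum>i<n. \<Sum>j<n. t i * C' i j * t j) = (\<Sum>i<n. \<Sum>j<n. t i * C i j * t j) - (B t)\<^sup>2 / c" for t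
  proof -
    have "(\<Sum>i<n. \<Sum>j<n. t i * (C i n * C j n / c) * t j) = B t * B t / c"
      unfolding B_def sum_product sum_divide_distrib by (intro sum.cong refl) simp
    then show ?thesis
      by (simp add: C'_def right_diff_distrib left_diff_distrib sum_subtractf power2_eq_square)
  qed
  have "\<exists>a. \<forall>t. (\<Sum>i<n. \<Sum>j<n. t i * C' i j * t j) = (\<Sum>l<n. (\<Sum>i<n. a l i * t i)\<^sup>2)"
  proof (rule Suc.IH)
    show "C' i j = C' j i" if "i < n" "j < n" for i j
      using Suc.prems(1)[of i j] that by (simp add: C'_def mult.commute)
    show "0 \<le> (\<Sum>i<n. \<Sum>j<n. t i * C' i j * t j)" for t
    proof (cases "c = 0")
      case True
      then show ?thesis using nonneg[of t 0] by (simp add: C')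
    next
      case False
      \<comment> \<open>The quadratic in the last variable is smallest at \<open>- B t / c\<close>,
        and its minimum is the form of the Schur complement \<open>C'\<close>, which is therefore
        nonnegative.\<close>
      have "q + 2 * (- b / c) * b + c * (- b / c)\<^sup>2 = q - b\<^sup>2 / c" for q b
        using False by (simp add: power2_eq_square field_simps)
      then show ?thesis using nonneg[of t "- B t / c"] unfolding C' by (simp only:)
    qed
  qed
  then obtain a where a: "\<And>t. (\<Sum>i<n. \<Sum>j<n. t i * C' i j * t j) = (\<Sum>l<n. (\<Sum>i<n. a l i * t i)\<^sup>2)" by blast
  define a' where "a' l i = (if l < n then if i < n then a l i else 0 else if i < n then sqrt c * (C i n / c) else sqrt c)" for l i
  have "(\<Sum>i<Suc n. \<Sum>j<Suc n. t i * C i j * t j) = (\<Sum>l<Suc n. (\<Sum>i<Suc n. a' l i * t i)\<^sup>2)" for t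
  proof -
    have "(\<Sum>l<n. (\<Sum>i<Suc n. a' l i * t i)\<^sup>2) = (\<Sum>i<n. \<Sum>j<n. t i * C' i j * t j)"
      unfolding a by (intro sum.cong refl) (simp add: a'_def)
    moreover have "(\<Sum>i<Suc n. a' n i * t i) = sqrt c * (B t / c + t n)"
      by (simp add: a'_def B_def distrib_left sum_distrib_left sum_divide_distrib mult.assoc)
    moreover have "(sqrt c * (B t / c + t n))\<^sup>2 = c * (B t / c + t n)\<^sup>2"
      using c0 by (simp add: power_mult_distrib)
    moreover have "c * (B t / c + t n)\<^sup>2 = (B t)\<^sup>2 / c + 2 * t n * B t + c * (t n)\<^sup>2"
      using B0[of t] by (cases "c = 0") (simp_all add: power2_eq_square field_simps)
    ultimately show ?thesis unfolding expand C' by simp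
  qed
  then show ?case by blast
qed simp

text \<open>Scaling a standard normal variable by \<open>sqrt v\<close> also covers
  \<open>v = 0\<close>, so characteristic functions need no separate degenerate case.\<close>

lemma normal_law_eq:
  assumes "v \<ge> 0"
  shows "normal_law v = distr std_normal_distribution borel (\<lambda>x. sqrt v * x)"
proof (cases "v = 0")
  case True
  interpret prob_space std_normal_distribution by (rule prob_space_normal_density) simp
  have "distr std_normal_distribution borel (\<lambda>x. 0 :: real) = return borel 0"
    by (rule distr_const) simp
  then show ?thesis using True by (simp add: normal_law_def)
next
  case False
  interpret prob_space std_normal_distribution by (rule prob_space_normal_density) simp
  have "distributed std_normal_distribution lborel (\<lambda>x. x) (normal_density 0 1)"
    by (auto simp: distributed_def distr_id2)
  then have "distributed std_normal_distribution lborel (\<lambda>x. 0 + sqrt v * x) (normal_density (0 + sqrt v * 0) (\<bar>sqrt v\<bar> * 1))"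
    using assms False by (intro normal_density_affine) auto
  then have "distr std_normal_distribution lborel (\<lambda>x. sqrt v * x) = density lborel (normal_density 0 (sqrt v))"
    using assms by (simp add: distributed_def)
  moreover have "distr std_normal_distribution lborel (\<lambda>x. sqrt v * x) = distr std_normal_distribution borel (\<lambda>x. sqrt v * x)"
    by (rule distr_cong) auto
  ultimately show ?thesis using False by (simp add: normal_law_def)
qed

lemma char_distr_scale:
  assumes "prob_space M" "X \<in> borel_measurable M"
  shows "char (distr M borel (\<lambda>x. c * X x)) s = char (distr M borel X) (c * s)"
  using assms(2) by (simp add: char_def integral_distr mult.assoc mult.left_commute mult.commute)

lemma char_normal_law:
  assumes "v \<ge> 0"
  shows "char (normal_law v) s = complex_of_real (exp (- (v * s\<^sup>2) / 2))"
proof -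
  have ps: "prob_space std_normal_distribution" by (rule prob_space_normal_density) simp
  have "char (normal_law v) s = char (distr std_normal_distribution borel (\<lambda>x. x)) (sqrt v * s)"
    unfolding normal_law_eq[OF assms] by (rule char_distr_scale[OF ps]) simp
  also have "distr std_normal_distribution borel (\<lambda>x. x) = std_normal_distribution"
    by (rule distr_id2) simp
  also have "char std_normal_distribution (sqrt v * s) = complex_of_real (exp (- (sqrt v * s)\<^sup>2 / 2))"
    by (simp only: char_std_normal_distribution)
  also have "(sqrt v * s)\<^sup>2 = v * s\<^sup>2" using assms by (simp add: power_mult_distrib)
  finally show ?thesis .
qed

lemma real_distribution_normal_law:
  assumes "v \<ge> 0"
  shows "real_distribution (normal_law v)"
proof -
  interpret prob_space std_normal_distribution by (rule prob_space_normal_density) simp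
  show ?thesis unfolding normal_law_eq[OF assms] by (rule real_distribution_distr) simp
qed

text \<open>The image of independent standard normals under a square root of \<open>C\<close>, whose
  coefficients come from the sum of squares. Each linear functional is then a combination of
  independent normals, and Levy uniqueness identifies its law; \<open>C\<close> may be
  singular.\<close>

lemma ex_centered_gaussian:
  fixes C :: "real mat"
  assumes "\<And>i j. i < n \<Longrightarrow> j < n \<Longrightarrow> C $$ (i, j) = C $$ (j, i)"
    and "\<And>t. 0 \<le> (\<Sum>i<n. \<Sum>j<n. t i * C $$ (i, j) * t j)"
  shows "\<exists>N. is_centered_gaussian n C N"
proof -
  obtain a where a: "\<And>t. (\<Sum>i<n. \<Sum>j<n. t i * C $$ (i, j) * t j) = (\<Sum>l<n. (\<Sum>i<n. a l i * t i)\<^sup>2)"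
    using psd_sum_of_squares[of n "\<lambda>i j. C $$ (i, j)"] assms by blast
  define G where "G = (std_normal_distribution :: real measure)"
  interpret G: prob_space G unfolding G_def by (rule prob_space_normal_density) simp
  have sG: "sets G = sets borel" by (simp add: G_def)
  define P where "P = Pi\<^sub>M {..<n} (\<lambda>_. G)"
  interpret P: prob_space P unfolding P_def by (rule prob_space_PiM) (rule G.prob_space_axioms)
  have coord: "(\<lambda>z. z l) \<in> borel_measurable P" if "l < n" for l
    unfolding P_def using measurable_component_singleton[of l "{..<n}" "\<lambda>_. G"] that
    by (simp cong: measurable_cong_sets add: sG)
  define F where "F z = (\<lambda>i\<in>{..<n}. \<Sum>l<n. a l i * z l)" for z :: "nat \<Rightarrow> real"
  have F: "F \<in> measurable P (borel_Rn n)"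
    unfolding F_def by (intro measurable_restrict borel_measurable_sum borel_measurable_times borel_measurable_const coord) simp
  define N where "N = distr P (borel_Rn n) F"
  \<comment> \<open>Independence of the coordinates is read off from the joint law being the product
    of the marginals, a criterion applied to a nonempty index set; hence the case
    \<open>n = 0\<close>.\<close>
  have ind: "P.indep_vars (\<lambda>_. borel) (\<lambda>l z. z l) {..<n}"
  proof (cases "n = 0")
    case True
    then show ?thesis unfolding P.indep_vars_def2 P.indep_sets_def by simp
  next
    case False
    have "distr P (Pi\<^sub>M {..<n} (\<lambda>_. borel)) (\<lambda>z. \<lambda>l\<in>{..<n}. z l) = P"
    proof (subst distr_cong[where g = "\<lambda>z. z", OF refl refl])
      show "(\<lambda>l\<in>{..<n}. z l) = z" if "z \<in> space P" for z
        using that unfolding P_def space_PiM by (simp add: PiE_restrict)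
      show "distr P (Pi\<^sub>M {..<n} (\<lambda>_. borel)) (\<lambda>z. z) = P"
        unfolding P_def by (rule distr_id2, rule sets_PiM_cong) (auto simp: sG)
    qed
    moreover have "distr P borel (\<lambda>z. z l) = G" if "l < n" for l
    proof -
      have "distr P G (\<lambda>z. z l) = G"
        unfolding P_def by (rule distr_PiM_component) (use that G.prob_space_axioms in auto)
      moreover have "distr P G (\<lambda>z. z l) = distr P borel (\<lambda>z. z l)" by (rule distr_cong) (auto simp: sG)
      ultimately show ?thesis by simp
    qed
    then have "Pi\<^sub>M {..<n} (\<lambda>l. distr P borel (\<lambda>z. z l)) = P"
      unfolding P_def[symmetric] by (subst PiM_cong[where N = "\<lambda>_. G", OF refl]) (auto simp: P_def)
    ultimately show ?thesis
      using False coord by (subst P.indep_vars_iff_distr_eq_PiM') auto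
  qed
  have proj: "distr N borel (\<lambda>x. \<Sum>i<n. t i * x i) = normal_law (\<Sum>i<n. \<Sum>j<n. t i * C $$ (i, j) * t j)" for t
  proof -
    define \<alpha> where "\<alpha> l = (\<Sum>i<n. a l i * t i)" for l
    have tm: "(\<lambda>x. \<Sum>i<n. t i * x i) \<in> borel_measurable (borel_Rn n)"
      by (intro borel_measurable_sum borel_measurable_times borel_measurable_const measurable_component_singleton) auto
    have "(\<Sum>i<n. t i * F z i) = (\<Sum>l<n. \<alpha> l * z l)" for z
    proof -
      have "(\<Sum>i<n. t i * F z i) = (\<Sum>i<n. \<Sum>l<n. a l i * t i * z l)"
        by (simp add: F_def sum_distrib_left mult_ac)
      also have "\<dots> = (\<Sum>l<n. \<alpha> l * z l)" unfolding \<alpha>_def sum_distrib_right by (rule sum.swap)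
      finally show ?thesis .
    qed
    then have D: "distr N borel (\<lambda>x. \<Sum>i<n. t i * x i) = distr P borel (\<lambda>z. \<Sum>l<n. \<alpha> l * z l)"
      unfolding N_def by (subst distr_distr[OF tm F]) (simp add: comp_def)
    have lm: "(\<lambda>z. \<Sum>l<n. \<alpha> l * z l) \<in> borel_measurable P"
      by (intro borel_measurable_sum borel_measurable_times borel_measurable_const coord) simp
    have v: "(\<Sum>i<n. \<Sum>j<n. t i * C $$ (i, j) * t j) = (\<Sum>l<n. (\<alpha> l)\<^sup>2)" unfolding a \<alpha>_def ..
    have v0: "(\<Sum>l<n. (\<alpha> l)\<^sup>2) \<ge> 0" by (intro sum_nonneg) simp
    show ?thesis
      unfolding D v
    proof (rule Levy_uniqueness)
      show "real_distribution (distr P borel (\<lambda>z. \<Sum>l<n. \<alpha> l * z l))" by (rule P.real_distribution_distr[OF lm])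
      show "real_distribution (normal_law (\<Sum>l<n. (\<alpha> l)\<^sup>2))" by (rule real_distribution_normal_law[OF v0])
      show "char (distr P borel (\<lambda>z. \<Sum>l<n. \<alpha> l * z l)) = char (normal_law (\<Sum>l<n. (\<alpha> l)\<^sup>2))"
      proof
        fix s
        have "char (distr P borel (\<lambda>z. \<Sum>l<n. \<alpha> l * z l)) s = (\<Prod>l<n. char (distr P borel (\<lambda>z. \<alpha> l * z l)) s)"
          by (rule P.char_distr_sum) (rule P.indep_vars_compose2[OF ind], simp)
        also have "\<dots> = (\<Prod>l<n. complex_of_real (exp (- ((\<alpha> l)\<^sup>2 * s\<^sup>2) / 2)))"
        proof (rule prod.cong[OF refl])
          fix l assume "l \<in> {..<n}"
          then have l: "l < n" by simp
          have "distr P G (\<lambda>z. z l) = G"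
            unfolding P_def by (rule distr_PiM_component) (use l G.prob_space_axioms in auto)
          moreover have "distr P G (\<lambda>z. z l) = distr P borel (\<lambda>z. z l)" by (rule distr_cong) (auto simp: sG)
          ultimately have "distr P borel (\<lambda>z. z l) = std_normal_distribution" by (simp add: G_def)
          then show "char (distr P borel (\<lambda>z. \<alpha> l * z l)) s = complex_of_real (exp (- ((\<alpha> l)\<^sup>2 * s\<^sup>2) / 2))"
            using char_distr_scale[OF P.prob_space_axioms coord[OF l], of "\<alpha> l" s]
            by (simp add: char_std_normal_distribution power_mult_distrib)
        qed
        also have "\<dots> = complex_of_real (\<Prod>l<n. exp (- ((\<alpha> l)\<^sup>2 * s\<^sup>2) / 2))" by simp
        also have "(\<Prod>l<n. exp (- ((\<alpha> l)\<^sup>2 * s\<^sup>2) / 2)) = exp (\<Sum>l<n. - ((\<alpha> l)\<^sup>2 * s\<^sup>2) / 2)"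
          by (rule exp_sum[symmetric]) simp
        also have "(\<Sum>l<n. - ((\<alpha> l)\<^sup>2 * s\<^sup>2) / 2) = - ((\<Sum>l<n. (\<alpha> l)\<^sup>2) * s\<^sup>2) / 2"
          by (simp add: sum_distrib_right sum_divide_distrib sum_negf)
        finally show "char (distr P borel (\<lambda>z. \<Sum>l<n. \<alpha> l * z l)) s = char (normal_law (\<Sum>l<n. (\<alpha> l)\<^sup>2)) s"
          unfolding char_normal_law[OF v0] by (simp only:)
      qed
    qed
  qed
  have "is_centered_gaussian n C N"
    unfolding is_centered_gaussian_def using proj P.prob_space_distr[OF F] by (simp add: N_def)
  then show ?thesis by blast
qed

text \<open>Frequency 1 suffices, because the direction of the functional is arbitrary later. For
  positive variance this is the classical theorem read at frequency \<open>\<sigma>\<close>; for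
  zero variance the centred sums vanish almost surely.\<close>

lemma (in prob_space) clt_char:
  fixes X :: "nat \<Rightarrow> 'a \<Rightarrow> real"
  assumes ind: "indep_vars (\<lambda>_. borel) X UNIV" and law: "\<And>k. distr M borel (X k) = distr M borel Y"
    and Y: "Y \<in> borel_measurable M" "integrable M Y" "integrable M (\<lambda>\<omega>. (Y \<omega>)\<^sup>2)"
  shows "(\<lambda>k. char (distr M borel (\<lambda>\<omega>. ((\<Sum>i<k. X i \<omega>) - real k * expectation Y) / sqrt (real k))) 1)
    \<longlonglongrightarrow> char (normal_law (variance Y)) 1"
proof -
  have rv[measurable]: "random_variable borel (X i)" for i using ind unfolding indep_vars_def2 by auto
  define m where "m = expectation Y"
  have tr: "integrable M (\<lambda>\<omega>. h (X i \<omega>)) \<longleftrightarrow> integrable M (\<lambda>\<omega>. h (Y \<omega>))"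
    "expectation (\<lambda>\<omega>. h (X i \<omega>)) = expectation (\<lambda>\<omega>. h (Y \<omega>))" if "h \<in> borel_measurable borel" for h :: "real \<Rightarrow> real" and i
    using integrable_distr_eq[OF rv[of i] that] integrable_distr_eq[OF Y(1) that]
      integral_distr[OF rv[of i] that] integral_distr[OF Y(1) that] law[of i] by simp_all
  have EX: "expectation (X i) = m" for i using tr(2)[of "\<lambda>x. x" i] by (simp add: m_def)
  have IX: "integrable M (X i)" for i using tr(1)[of "\<lambda>x. x" i] Y by simp
  have IX2: "integrable M (\<lambda>\<omega>. (X i \<omega>)\<^sup>2)" for i using tr(1)[of "\<lambda>x. x\<^sup>2" i] Y by simp
  have VX: "variance (X i) = variance Y" for i
    unfolding EX m_def[symmetric] by (rule tr(2)[of "\<lambda>x. (x - m)\<^sup>2"]) simp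
  have v0: "variance Y \<ge> 0" by (rule variance_positive)
  show ?thesis
  proof (cases "variance Y = 0")
    case True
    have "AE \<omega> in M. X i \<omega> = m" for i
    proof -
      have int: "integrable M (\<lambda>\<omega>. (X i \<omega> - m)\<^sup>2)"
        using IX IX2 by (simp add: power2_diff)
      have "expectation (\<lambda>\<omega>. (X i \<omega> - m)\<^sup>2) = 0" using VX[of i] True unfolding EX by simp
      then have "AE \<omega> in M. (X i \<omega> - m)\<^sup>2 = 0"
        using integral_nonneg_eq_0_iff_AE[OF int] by simp
      then show ?thesis by eventually_elim simp
    qed
    then have AE: "AE \<omega> in M. \<forall>i. X i \<omega> = m" by (simp add: AE_all_countable)
    have "char (distr M borel (\<lambda>\<omega>. ((\<Sum>i<k. X i \<omega>) - real k * m) / sqrt (real k))) 1 = 1" for k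
    proof -
      have "char (distr M borel (\<lambda>\<omega>. ((\<Sum>i<k. X i \<omega>) - real k * m) / sqrt (real k))) 1
          = (CLINT \<omega>|M. iexp (((\<Sum>i<k. X i \<omega>) - real k * m) / sqrt (real k)))"
        unfolding char_def by (subst integral_distr) auto
      also have "\<dots> = (CLINT \<omega>|M. 1)"
        by (rule integral_cong_AE) (use AE in \<open>auto elim!: eventually_mono\<close>)
      finally show ?thesis by (simp add: prob_space)
    qed
    then show ?thesis using char_normal_law[of 0 1] True by (simp add: m_def)
  next
    case False
    define \<sigma> where "\<sigma> = sqrt (variance Y)"
    have "variance Y > 0" using False v0 by linarith
    then have \<sigma>: "\<sigma> > 0" "\<sigma>\<^sup>2 = variance Y" by (simp_all add: \<sigma>_def)
    define Z where "Z k \<omega> = (\<Sum>i<k. X i \<omega> - m) / sqrt (real k * \<sigma>\<^sup>2)" for k \<omega>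
    have Z[measurable]: "Z k \<in> borel_measurable M" for k unfolding Z_def by measurable
    have "weak_conv_m (\<lambda>k. distr M borel (Z k)) std_normal_distribution"
      unfolding Z_def
      by (rule central_limit_theorem[OF ind EX \<sigma>(1) IX2 _ law]) (simp add: VX \<sigma>(2))
    then have "(\<lambda>k. char (distr M borel (Z k)) \<sigma>) \<longlonglongrightarrow> char std_normal_distribution \<sigma>"
      by (intro levy_continuity1 real_distribution_distr real_dist_normal_dist) auto
    moreover have "char (distr M borel (Z k)) \<sigma> = char (distr M borel (\<lambda>\<omega>. ((\<Sum>i<k. X i \<omega>) - real k * m) / sqrt (real k))) 1" for k
    proof -
      have "(\<lambda>\<omega>. \<sigma> * Z k \<omega>) = (\<lambda>\<omega>. ((\<Sum>i<k. X i \<omega>) - real k * m) / sqrt (real k))"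
        using \<sigma>(1) by (auto simp: Z_def real_sqrt_mult sum_subtractf fun_eq_iff)
      then show ?thesis using char_distr_scale[OF prob_space_axioms Z, of \<sigma> k 1] by simp
    qed
    moreover have "char std_normal_distribution \<sigma> = char (normal_law (variance Y)) 1"
      unfolding char_normal_law[OF v0] char_std_normal_distribution \<sigma>(2) by simp
    ultimately show ?thesis by (simp add: m_def)
  qed
qed

section \<open>The limit theorems for singular numbers\<close>

lemma row_val_last:
  assumes "C \<in> GL n"
  shows "row_val n C = 0"
proof -
  have "length (SN (drop_rows n C)) = 0"
    using is_SN_SN[OF assms order_refl] GL_carrier[OF assms] by (auto simp: is_SN_def drop_rows_def)
  then show ?thesis using row_val_eq_sum_SN[OF assms order_refl] by simp
qed

lemma L_mat_apply:
  assumes "i < n"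
  shows "(\<Sum>j<n. L_mat n $$ (i, j) * x j) = x i - (if Suc i < n then x (Suc i) else 0)"
proof -
  have "(\<Sum>j<n. L_mat n $$ (i, j) * x j) = (\<Sum>j<n. (if j = i then x i else 0) - (if j = Suc i then x (Suc i) else 0))"
    using assms by (intro sum.cong) (auto simp: L_mat_def)
  then show ?thesis using assms by (simp add: sum_subtractf)
qed

lemma congruence_entry:
  fixes L S :: "real mat"
  assumes "L \<in> carrier_mat n n" "S \<in> carrier_mat n n" "i < n" "j < n"
  shows "(L * S * transpose_mat L) $$ (i, j) = (\<Sum>k<n. \<Sum>l<n. L $$ (i, k) * S $$ (k, l) * L $$ (j, l))"
proof -
  have "(L * S * transpose_mat L) $$ (i, j) = (\<Sum>l<n. (L * S) $$ (i, l) * transpose_mat L $$ (l, j))"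
    by (rule index_mult_mat_sum) (use assms in auto)
  also have "\<dots> = (\<Sum>l<n. (\<Sum>k<n. L $$ (i, k) * S $$ (k, l)) * L $$ (j, l))"
    using assms by (intro sum.cong refl arg_cong2[of _ _ _ _ "(*)"] index_mult_mat_sum[of _ n n _ n]) auto
  also have "\<dots> = (\<Sum>k<n. \<Sum>l<n. L $$ (i, k) * S $$ (k, l) * L $$ (j, l))"
    unfolding sum_distrib_right by (rule sum.swap)
  finally show ?thesis .
qed

lemma quadratic_form_congruence:
  fixes L S :: "real mat"
  assumes "L \<in> carrier_mat n n" "S \<in> carrier_mat n n"
  defines "s \<equiv> \<lambda>t k. \<Sum>i<n. t i * L $$ (i, k)"
  shows "(\<Sum>i<n. \<Sum>j<n. t i * (L * S * transpose_mat L) $$ (i, j) * t j) = (\<Sum>k<n. \<Sum>l<n. s t k * S $$ (k, l) * s t l)"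
proof -
  have "(\<Sum>i<n. \<Sum>j<n. t i * (L * S * transpose_mat L) $$ (i, j) * t j) =
      (\<Sum>i<n. \<Sum>j<n. \<Sum>k<n. \<Sum>l<n. (t i * L $$ (i, k)) * S $$ (k, l) * (t j * L $$ (j, l)))"
    using congruence_entry[OF assms(1,2)]
    by (intro sum.cong refl) (simp add: sum_distrib_left sum_distrib_right mult_ac)
  also have "\<dots> = (\<Sum>i<n. \<Sum>k<n. \<Sum>l<n. \<Sum>j<n. (t i * L $$ (i, k)) * S $$ (k, l) * (t j * L $$ (j, l)))"
  proof (rule sum.cong[OF refl])
    fix i
    have "(\<Sum>j<n. \<Sum>k<n. \<Sum>l<n. (t i * L $$ (i, k)) * S $$ (k, l) * (t j * L $$ (j, l)))
        = (\<Sum>k<n. \<Sum>j<n. \<Sum>l<n. (t i * L $$ (i, k)) * S $$ (k, l) * (t j * L $$ (j, l)))" by (rule sum.swap)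
    also have "\<dots> = (\<Sum>k<n. \<Sum>l<n. \<Sum>j<n. (t i * L $$ (i, k)) * S $$ (k, l) * (t j * L $$ (j, l)))"
      by (rule sum.cong[OF refl], rule sum.swap)
    finally show "(\<Sum>j<n. \<Sum>k<n. \<Sum>l<n. (t i * L $$ (i, k)) * S $$ (k, l) * (t j * L $$ (j, l)))
      = (\<Sum>k<n. \<Sum>l<n. \<Sum>j<n. (t i * L $$ (i, k)) * S $$ (k, l) * (t j * L $$ (j, l)))" .
  qed
  also have "\<dots> = (\<Sum>i<n. \<Sum>k<n. \<Sum>l<n. (t i * L $$ (i, k)) * S $$ (k, l) * s t l)"
    by (simp add: s_def sum_distrib_left)
  also have "\<dots> = (\<Sum>k<n. \<Sum>i<n. \<Sum>l<n. (t i * L $$ (i, k)) * S $$ (k, l) * s t l)" by (rule sum.swap)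
  also have "\<dots> = (\<Sum>k<n. \<Sum>l<n. \<Sum>i<n. (t i * L $$ (i, k)) * S $$ (k, l) * s t l)"
    by (rule sum.cong[OF refl], rule sum.swap)
  also have "\<dots> = (\<Sum>k<n. \<Sum>l<n. s t k * S $$ (k, l) * s t l)"
    by (simp add: s_def sum_distrib_right)
  finally show ?thesis .
qed

lemma (in prob_space) variance_linear_combination:
  fixes W :: "nat \<Rightarrow> 'a \<Rightarrow> real"
  assumes int: "\<And>i. i < n \<Longrightarrow> integrable M (W i)" and sq: "\<And>i. i < n \<Longrightarrow> integrable M (\<lambda>\<omega>. (W i \<omega>)\<^sup>2)"
  shows "variance (\<lambda>\<omega>. \<Sum>i<n. s i * W i \<omega>) = (\<Sum>k<n. \<Sum>l<n. s k * covariance M (W k) (W l) * s l)"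
    and "integrable M (\<lambda>\<omega>. (\<Sum>i<n. s i * W i \<omega>)\<^sup>2)"
proof -
  have prod: "integrable M (\<lambda>\<omega>. (W k \<omega> - a) * (W l \<omega> - b))" if "k < n" "l < n" for k l a b
  proof -
    have i: "integrable M (\<lambda>\<omega>. W k \<omega> * W l \<omega>)"
    proof (rule Bochner_Integration.integrable_bound[of _ "\<lambda>\<omega>. (W k \<omega>)\<^sup>2 + (W l \<omega>)\<^sup>2"])
      show "integrable M (\<lambda>\<omega>. (W k \<omega>)\<^sup>2 + (W l \<omega>)\<^sup>2)" using sq that by auto
      show "(\<lambda>\<omega>. W k \<omega> * W l \<omega>) \<in> borel_measurable M"
        using int that by (intro borel_measurable_times borel_measurable_integrable)
      have "\<bar>x * y\<bar> \<le> x\<^sup>2 + y\<^sup>2" for x y :: real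
      proof -
        have "2 * (\<bar>x\<bar> * \<bar>y\<bar>) \<le> x\<^sup>2 + y\<^sup>2"
          using sum_squares_bound[of "\<bar>x\<bar>" "\<bar>y\<bar>"] by (simp add: mult.assoc)
        moreover have "0 \<le> \<bar>x\<bar> * \<bar>y\<bar>" by simp
        ultimately show ?thesis unfolding abs_mult by linarith
      qed
      then show "AE \<omega> in M. norm (W k \<omega> * W l \<omega>) \<le> norm ((W k \<omega>)\<^sup>2 + (W l \<omega>)\<^sup>2)" by simp
    qed
    have "(\<lambda>\<omega>. (W k \<omega> - a) * (W l \<omega> - b)) = (\<lambda>\<omega>. W k \<omega> * W l \<omega> - b * W k \<omega> - a * W l \<omega> + a * b)"
      by (simp add: algebra_simps fun_eq_iff)
    then show ?thesis using i int that by simp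
  qed
  have EY: "expectation (\<lambda>\<omega>. \<Sum>i<n. s i * W i \<omega>) = (\<Sum>i<n. s i * expectation (W i))"
    using int by (subst Bochner_Integration.integral_sum) auto
  have "variance (\<lambda>\<omega>. \<Sum>i<n. s i * W i \<omega>) =
      expectation (\<lambda>\<omega>. \<Sum>k<n. \<Sum>l<n. s k * s l * ((W k \<omega> - expectation (W k)) * (W l \<omega> - expectation (W l))))"
  proof (rule Bochner_Integration.integral_cong[OF refl])
    fix \<omega>
    have "(\<Sum>i<n. s i * W i \<omega>) - expectation (\<lambda>\<omega>. \<Sum>i<n. s i * W i \<omega>) = (\<Sum>i<n. s i * (W i \<omega> - expectation (W i)))"
      unfolding EY by (simp add: sum_subtractf right_diff_distrib)
    then show "((\<Sum>i<n. s i * W i \<omega>) - expectation (\<lambda>\<omega>. \<Sum>i<n. s i * W i \<omega>))\<^sup>2 =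
        (\<Sum>k<n. \<Sum>l<n. s k * s l * ((W k \<omega> - expectation (W k)) * (W l \<omega> - expectation (W l))))"
      by (simp only: power2_eq_square sum_product) (simp add: mult_ac)
  qed
  also have "\<dots> = (\<Sum>k<n. expectation (\<lambda>\<omega>. \<Sum>l<n. s k * s l * ((W k \<omega> - expectation (W k)) * (W l \<omega> - expectation (W l)))))"
    using prod by (intro Bochner_Integration.integral_sum Bochner_Integration.integrable_sum integrable_mult_right) auto
  also have "\<dots> = (\<Sum>k<n. \<Sum>l<n. expectation (\<lambda>\<omega>. s k * s l * ((W k \<omega> - expectation (W k)) * (W l \<omega> - expectation (W l)))))"
    using prod by (intro sum.cong refl Bochner_Integration.integral_sum integrable_mult_right) auto
  also have "\<dots> = (\<Sum>k<n. \<Sum>l<n. s k * covariance M (W k) (W l) * s l)"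
    by (intro sum.cong refl) (simp add: covariance_def)
  finally show "variance (\<lambda>\<omega>. \<Sum>i<n. s i * W i \<omega>) = (\<Sum>k<n. \<Sum>l<n. s k * covariance M (W k) (W l) * s l)" .
  have "(\<lambda>\<omega>. (\<Sum>i<n. s i * W i \<omega>)\<^sup>2) = (\<lambda>\<omega>. \<Sum>k<n. \<Sum>l<n. s k * s l * ((W k \<omega> - 0) * (W l \<omega> - 0)))"
    by (simp add: power2_eq_square sum_product mult_ac)
  moreover have "integrable M (\<lambda>\<omega>. \<Sum>k<n. \<Sum>l<n. s k * s l * ((W k \<omega> - 0) * (W l \<omega> - 0)))"
    by (intro Bochner_Integration.integrable_sum integrable_mult_right prod) auto
  ultimately show "integrable M (\<lambda>\<omega>. (\<Sum>i<n. s i * W i \<omega>)\<^sup>2)" by simp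
qed

text \<open>Reduces the shifted cosine means required by \<open>Cramer_Wold\<close> to the
  characteristic function at 1, which \<open>clt_char\<close> supplies.\<close>

lemma integral_cos_shift:
  assumes "real_distribution D"
  shows "(\<integral>x. cos (x + b) \<partial>D) = Re (cis b * char D 1)"
proof -
  interpret real_distribution D by fact
  have int: "integrable D (\<lambda>x. iexp x)"
    by (rule integrable_const_bound[where B = 1]) (auto simp: norm_exp_i_times)
  have "cis b * char D 1 = (CLINT x|D. cis b * iexp x)"
    unfolding char_def using int by simp
  then have "Re (cis b * char D 1) = (\<integral>x. Re (cis b * iexp x) \<partial>D)"
    using integral_Re[OF integrable_mult_right[OF int, of "cis b"]] by simp
  also have "\<dots> = (\<integral>x. cos (x + b) \<partial>D)"
    by (rule Bochner_Integration.integral_cong[OF refl])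
      (simp add: cis_conv_exp exp_add[symmetric] Re_exp distrib_left[symmetric] add.commute flip: of_real_add)
  finally show ?thesis by simp
qed

lemma abs_cos_diff_le: "\<bar>cos a - cos b\<bar> \<le> \<bar>a - b\<bar>" for a b :: real
proof -
  have "\<bar>cos a - cos b\<bar> = 2 * (\<bar>sin ((a + b) / 2)\<bar> * \<bar>sin ((b - a) / 2)\<bar>)"
    unfolding cos_diff_cos by (simp add: abs_mult)
  also have "\<dots> \<le> 2 * (1 * \<bar>(b - a) / 2\<bar>)"
    by (intro mult_left_mono mult_mono abs_sin_x_le_abs_x) auto
  finally show ?thesis by simp
qed

section \<open>From the random walk of values to the singular numbers\<close>

context biinvariant_products
begin

definition corner :: "nat \<Rightarrow> 'w \<Rightarrow> real" where
  "corner i \<omega> = real_of_int (sum_list (SN (drop_rows i (A 0 \<omega>))))"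

lemma corner_eq: "\<omega> \<in> space M \<Longrightarrow> i \<le> n \<Longrightarrow> corner i \<omega> = row_val i (A 0 \<omega>)"
  using row_val_eq_sum_SN[OF A_GL] by (simp add: corner_def)

lemma corner_measurable: "i \<le> n \<Longrightarrow> corner i \<in> borel_measurable M"
  using measurable_compose[OF A_measurable borel_measurable_row_val, of i 0] corner_eq
  by (simp cong: measurable_cong)

lemma increment_law: "distr M borel (increment s k) = distr M borel (\<lambda>\<omega>. \<Sum>i<n. s i * corner i \<omega>)"
  unfolding increments_iid(2) by (rule distr_cong) (auto simp: corner_eq)

text \<open>A singular number is a difference of consecutive tail sums, and each tail sum is a value
  minus its deviation. At the last index the missing value is that of the empty truncation, which is
  0.\<close>

lemma SN_nth_eq:
  assumes \<omega>: "\<omega> \<in> space M" and i: "i < n"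
  shows "real_of_int (SN (B k \<omega>) ! i) =
    row_val i (B k \<omega>) - (if Suc i < n then row_val (Suc i) (B k \<omega>) else 0)
      - (deviation (n - i) (B k \<omega>) - deviation (n - Suc i) (B k \<omega>))"
proof -
  note BG = B_GL[OF \<omega>, of k]
  have "tail_sum (Suc (n - Suc i)) (SN (B k \<omega>)) = SN (B k \<omega>) ! i + tail_sum (n - Suc i) (SN (B k \<omega>))"
    using tail_sum_Suc[of "n - Suc i" "SN (B k \<omega>)"] SN_props(2)[OF BG] i by simp
  moreover have "Suc (n - Suc i) = n - i" "n - (n - i) = i" "n - (n - Suc i) = Suc i" using i by auto
  moreover have "row_val (Suc i) (B k \<omega>) = 0" if "\<not> Suc i < n"
  proof -
    have "Suc i = n" using i that by simp
    then show ?thesis using row_val_last[OF BG] by simp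
  qed
  ultimately show ?thesis unfolding deviation_def by auto
qed

lemma deviation_nonneg: "\<omega> \<in> space M \<Longrightarrow> q \<le> n \<Longrightarrow> 0 \<le> deviation q (B k \<omega>)"
  using tail_sum_le_row_val[OF B_GL] by (simp add: deviation_def)

text \<open>Borel-Cantelli applied to \<open>prob_deviation\<close>: almost surely the deviation is
  eventually at most a constant times the logarithm of \<open>k\<close>, which is negligible even
  against \<open>sqrt k\<close>.\<close>

lemma deviation_negligible:
  assumes q: "q \<le> n"
  shows "AE \<omega> in M. (\<lambda>k. deviation q (B k \<omega>) / sqrt (real k)) \<longlonglongrightarrow> 0"
proof -
  \<comment> \<open>Since \<open>p \<ge> 2\<close>, this choice gives
    \<open>p ^ T k \<ge> (k + 1) ^ 2\<close>, so the exceptional probabilities are summable while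
    the threshold grows only logarithmically.\<close>
  define T where "T k = nat \<lceil>2 * log 2 (real (Suc k))\<rceil>" for k
  define E where "E k = {\<omega> \<in> space M. deviation q (B (Suc k) \<omega>) > real (q * Suc (T k))}" for k
  have dm: "(\<lambda>\<omega>. deviation q (B k \<omega>)) \<in> borel_measurable M" for k
    by (rule measurable_compose[OF B_measurable deviation_measurable[OF q]])
  have E: "E k \<in> events" for k
    using dm[of "Suc k"] unfolding E_def borel_measurable_iff_greater by blast
  have p2: "real CARD('p) \<ge> 2" using CARD_gt_1[where 'p = 'p] by linarith
  have bound: "prob (E k) \<le> real q * (1 / (real (Suc k))\<^sup>2)" for k
  proof -
    have "(real (Suc k))\<^sup>2 = 2 powr (2 * log 2 (real (Suc k)))"
      by (simp add: powr_powr[symmetric] mult.commute[of 2] del: of_nat_Suc)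
    also have "\<dots> \<le> 2 powr real (T k)" unfolding T_def by (intro powr_mono) linarith+
    also have "\<dots> = 2 ^ T k" by (simp add: powr_realpow)
    also have "\<dots> \<le> real CARD('p) ^ T k" using p2 by (intro power_mono) auto
    finally have "real q / real CARD('p) ^ T k \<le> real q / (real (Suc k))\<^sup>2"
      by (intro divide_left_mono mult_pos_pos) (use p2 in auto)
    then show ?thesis using prob_deviation[OF q, where k = k and t = "T k"] unfolding E_def by simp
  qed
  have "summable (\<lambda>k. real q * (1 / (real (Suc k))\<^sup>2))"
    using summable_Suc_iff[of "\<lambda>k. 1 / (real k)\<^sup>2"] inverse_power_summable[of 2, where 'a = real]
    by (intro summable_mult) (simp add: divide_inverse power_inverse)
  then have "summable (\<lambda>k. prob (E k))"
    by (rule summable_comparison_test') (use bound in auto)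
  then have "AE \<omega> in M. \<forall>\<^sub>F k in sequentially. \<omega> \<in> space M - E k"
    using E by (intro borel_cantelli_AE1) (auto simp: emeasure_eq_measure)
  then show ?thesis using AE_space
  proof eventually_elim
    case (elim \<omega>)
    have lim: "(\<lambda>k. real q * (2 + 2 * log 2 (real (Suc k))) / sqrt (real (Suc k))) \<longlonglongrightarrow> 0"
      by real_asymp
    have "(\<lambda>k. deviation q (B (Suc k) \<omega>) / sqrt (real (Suc k))) \<longlonglongrightarrow> 0"
    proof (rule tendsto_sandwich[OF _ _ tendsto_const lim])
      show "\<forall>\<^sub>F k in sequentially. 0 \<le> deviation q (B (Suc k) \<omega>) / sqrt (real (Suc k))"
        using deviation_nonneg[OF elim(2) q] by (intro always_eventually allI divide_nonneg_nonneg) auto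
      show "\<forall>\<^sub>F k in sequentially. deviation q (B (Suc k) \<omega>) / sqrt (real (Suc k)) \<le> real q * (2 + 2 * log 2 (real (Suc k))) / sqrt (real (Suc k))"
        using elim(1)
      proof eventually_elim
        case (elim k)
        have "0 \<le> log 2 (real (Suc k))" by simp
        then have Tk: "real (Suc (T k)) \<le> 2 + 2 * log 2 (real (Suc k))" unfolding T_def by linarith
        have "deviation q (B (Suc k) \<omega>) \<le> real (q * Suc (T k))" using elim by (auto simp: E_def)
        also have "\<dots> = real q * real (Suc (T k))" by (rule of_nat_mult)
        also have "\<dots> \<le> real q * (2 + 2 * log 2 (real (Suc k)))" by (rule mult_left_mono[OF Tk]) simp
        finally show ?case by (intro divide_right_mono) auto
      qed
    qed
    then show ?case by (simp only: filterlim_sequentially_Suc[of "\<lambda>k. deviation q (B k \<omega>) / sqrt (real k)"])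
  qed
qed

lemma row_val_slln:
  assumes i: "i < n" and int: "integrable M (corner i)"
  shows "AE \<omega> in M. (\<lambda>k. row_val i (B k \<omega>) / real k) \<longlonglongrightarrow> expectation (corner i)"
proof -
  define s where "s j = (if j = i then 1 else 0 :: real)" for j
  have pick: "(\<Sum>j<n. s j * x j) = x i" for x :: "nat \<Rightarrow> real"
    using i by (simp add: s_def if_distrib[of "\<lambda>y. y * _"] cong: if_cong)
  have law: "distr M borel (increment s k) = distr M borel (corner i)" for k
    unfolding increment_law pick by simp
  have rv: "random_variable borel (increment s k)" for k using increments_iid(1) unfolding indep_vars_def2 by auto
  have Wm: "corner i \<in> borel_measurable M" using i by (intro corner_measurable) simp
  have "integrable M (increment s 0)"
    using int integrable_distr_eq[OF rv[of 0], of "\<lambda>x. x"] integrable_distr_eq[OF Wm, of "\<lambda>x. x"] law[of 0] by simp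
  then have "AE \<omega> in M. (\<lambda>k. (\<Sum>j<k. increment s j \<omega>) / real k) \<longlonglongrightarrow> expectation (increment s 0)"
    by (rule strong_law_of_large_numbers[OF increments_iid(1) law])
  moreover have "expectation (increment s 0) = expectation (corner i)"
    using integral_distr[OF rv[of 0], of "\<lambda>x. x"] integral_distr[OF Wm, of "\<lambda>x. x"] law[of 0] by simp
  ultimately show ?thesis by (simp add: sum_increment pick)
qed

lemma SN_slln:
  assumes int: "\<And>i. i < n \<Longrightarrow> integrable M (corner i)"
  shows "AE \<omega> in M. \<forall>i<n. (\<lambda>k. real_of_int (SN (B k \<omega>) ! i) / real k) \<longlonglongrightarrow>
    (if Suc i < n then expectation (corner i) - expectation (corner (Suc i)) else expectation (corner i))"
proof -
  have "AE \<omega> in M. \<forall>i\<in>{..<n}. (\<lambda>k. row_val i (B k \<omega>) / real k) \<longlonglongrightarrow> expectation (corner i)"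
    using row_val_slln int by (intro AE_finite_allI) auto
  moreover have "AE \<omega> in M. \<forall>q\<in>{..n}. (\<lambda>k. deviation q (B k \<omega>) / sqrt (real k)) \<longlonglongrightarrow> 0"
    using deviation_negligible by (intro AE_finite_allI) auto
  ultimately show ?thesis using AE_space
  proof eventually_elim
    case (elim \<omega>)
    have dev: "(\<lambda>k. deviation q (B k \<omega>) / real k) \<longlonglongrightarrow> 0" if "q \<le> n" for q
    proof -
      have "(\<lambda>k. deviation q (B k \<omega>) / sqrt (real k) * (1 / sqrt (real k))) \<longlonglongrightarrow> 0 * 0"
        by (rule tendsto_mult) (use elim(2) that in simp, real_asymp)
      moreover have "deviation q (B k \<omega>) / sqrt (real k) * (1 / sqrt (real k)) = deviation q (B k \<omega>) / real k" for k
        by simp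
      ultimately show ?thesis by simp
    qed
    show ?case
    proof (intro allI impI)
      fix i assume i: "i < n"
      have nxt: "(\<lambda>k. (if Suc i < n then row_val (Suc i) (B k \<omega>) else 0) / real k) \<longlonglongrightarrow> (if Suc i < n then expectation (corner (Suc i)) else 0)"
        using elim(1) by (cases "Suc i < n") auto
      have "(\<lambda>k. row_val i (B k \<omega>) / real k - (if Suc i < n then row_val (Suc i) (B k \<omega>) else 0) / real k
          - (deviation (n - i) (B k \<omega>) / real k - deviation (n - Suc i) (B k \<omega>) / real k))
        \<longlonglongrightarrow> expectation (corner i) - (if Suc i < n then expectation (corner (Suc i)) else 0) - (0 - 0)"
        by (intro tendsto_diff nxt dev) (use elim(1) i in auto)
      moreover have "real_of_int (SN (B k \<omega>) ! i) / real k = row_val i (B k \<omega>) / real k - (if Suc i < n then row_val (Suc i) (B k \<omega>) else 0) / real k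
          - (deviation (n - i) (B k \<omega>) / real k - deviation (n - Suc i) (B k \<omega>) / real k)" for k
        unfolding SN_nth_eq[OF elim(3) i] by (simp add: diff_divide_distrib)
      ultimately show "(\<lambda>k. real_of_int (SN (B k \<omega>) ! i) / real k) \<longlonglongrightarrow>
          (if Suc i < n then expectation (corner i) - expectation (corner (Suc i)) else expectation (corner i))"
        by (cases "Suc i < n") simp_all
    qed
  qed
qed

text \<open>A linear functional \<open>t\<close> of the normalised singular numbers is a scalar walk
  in direction \<open>s t\<close>, the row vector \<open>t\<close> times \<open>L_mat n\<close>,
  minus a weighted sum of deviations. The scalar theorem handles the walk, and
  \<open>Cramer_Wold\<close> assembles the directions.\<close>

lemma SN_clt:
  assumes int: "\<And>i. i < n \<Longrightarrow> integrable M (corner i)" and sq: "\<And>i. i < n \<Longrightarrow> integrable M (\<lambda>\<omega>. (corner i \<omega>)\<^sup>2)"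
  defines "drift \<equiv> \<lambda>i. if Suc i < n then expectation (corner i) - expectation (corner (Suc i)) else expectation (corner i)"
    and "\<Sigma> \<equiv> mat n n (\<lambda>(i, j). covariance M (corner i) (corner j))"
  shows "\<exists>N. is_centered_gaussian n (L_mat n * \<Sigma> * transpose_mat (L_mat n)) N \<and>
    weakly_converges (top_Rn n)
      (\<lambda>k. distr M (borel_Rn n) (\<lambda>\<omega>. \<lambda>i\<in>{..<n}. (real_of_int (SN (B k \<omega>) ! i) - real k * drift i) / sqrt (real k))) N"
proof -
  let ?L = "L_mat n"
  let ?C = "?L * \<Sigma> * transpose_mat ?L"
  have L: "?L \<in> carrier_mat n n" by (simp add: L_mat_def)
  have S: "\<Sigma> \<in> carrier_mat n n" by (simp add: \<Sigma>_def)
  define s where "s t k = (\<Sum>i<n. t i * ?L $$ (i, k))" for t :: "nat \<Rightarrow> real" and k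
  define Y where "Y t \<omega> = (\<Sum>i<n. s t i * corner i \<omega>)" for t \<omega>
  \<comment> \<open>Being a variance, the quadratic form is nonnegative, which provides the Gaussian
    limit; the identity also gives the variance of each of its projections.\<close>
  have quad: "(\<Sum>i<n. \<Sum>j<n. t i * ?C $$ (i, j) * t j) = variance (Y t)" for t
  proof -
    have "(\<Sum>i<n. \<Sum>j<n. t i * ?C $$ (i, j) * t j) = (\<Sum>k<n. \<Sum>l<n. s t k * \<Sigma> $$ (k, l) * s t l)"
      using quadratic_form_congruence[OF L S] by (simp add: s_def)
    also have "\<dots> = (\<Sum>k<n. \<Sum>l<n. s t k * covariance M (corner k) (corner l) * s t l)"
      by (intro sum.cong refl) (simp add: \<Sigma>_def)
    also have "\<dots> = variance (Y t)"
      unfolding Y_def by (rule variance_linear_combination(1)[OF int sq, symmetric])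
    finally show ?thesis .
  qed
  have sym: "?C $$ (i, j) = ?C $$ (j, i)" if "i < n" "j < n" for i j
  proof -
    have "\<Sigma> $$ (k, l) = \<Sigma> $$ (l, k)" if "k < n" "l < n" for k l
      using that by (simp add: \<Sigma>_def covariance_def mult.commute)
    then have "(\<Sum>k<n. \<Sum>l<n. ?L $$ (i, k) * \<Sigma> $$ (k, l) * ?L $$ (j, l)) = (\<Sum>k<n. \<Sum>l<n. ?L $$ (j, l) * \<Sigma> $$ (l, k) * ?L $$ (i, k))"
      by (intro sum.cong refl) (simp add: mult_ac)
    also have "\<dots> = (\<Sum>l<n. \<Sum>k<n. ?L $$ (j, l) * \<Sigma> $$ (l, k) * ?L $$ (i, k))" by (rule sum.swap)
    finally show ?thesis
      unfolding congruence_entry[OF L S that] congruence_entry[OF L S that(2,1)] .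
  qed
  obtain N where N: "is_centered_gaussian n ?C N"
    using ex_centered_gaussian[of n ?C] sym quad variance_positive by auto
  then have Np: "prob_space N" "sets N = sets (borel_Rn n)"
    and Nd: "\<And>t. distr N borel (\<lambda>x. \<Sum>i<n. t i * x i) = normal_law (variance (Y t))"
    unfolding is_centered_gaussian_def quad by auto
  define Z where "Z k \<omega> = (\<lambda>i\<in>{..<n}. (real_of_int (SN (B k \<omega>) ! i) - real k * drift i) / sqrt (real k))" for k \<omega>
  have vm: "(\<lambda>\<omega>. row_val i (B k \<omega>)) \<in> borel_measurable M" if "i \<le> n" for i k
    by (rule measurable_compose[OF B_measurable borel_measurable_row_val[OF that]])
  have dm: "(\<lambda>\<omega>. deviation q (B k \<omega>)) \<in> borel_measurable M" if "q \<le> n" for q k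
    by (rule measurable_compose[OF B_measurable deviation_measurable[OF that]])
  have SNm: "(\<lambda>\<omega>. real_of_int (SN (B k \<omega>) ! i)) \<in> borel_measurable M" if i: "i < n" for i k
  proof -
    have "(\<lambda>\<omega>. if Suc i < n then row_val (Suc i) (B k \<omega>) else 0) \<in> borel_measurable M"
      by (cases "Suc i < n") (simp_all add: vm)
    then have "(\<lambda>\<omega>. row_val i (B k \<omega>) - (if Suc i < n then row_val (Suc i) (B k \<omega>) else 0)
      - (deviation (n - i) (B k \<omega>) - deviation (n - Suc i) (B k \<omega>))) \<in> borel_measurable M"
      using i by (intro borel_measurable_diff vm dm) auto
    then show ?thesis using SN_nth_eq[OF _ i] by (simp cong: measurable_cong)
  qed
  have Zm: "Z k \<in> measurable M (borel_Rn n)" for k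
    unfolding Z_def using SNm by (intro measurable_restrict borel_measurable_divide borel_measurable_diff) auto
  have conv: "(\<lambda>k. \<integral>x. cos ((\<Sum>i<n. t i * x i) + b) \<partial>distr M (borel_Rn n) (Z k)) \<longlonglongrightarrow> (\<integral>x. cos ((\<Sum>i<n. t i * x i) + b) \<partial>N)" for t b
  proof -
    define u where "u k \<omega> = ((\<Sum>j<k. increment (s t) j \<omega>) - real k * expectation (Y t)) / sqrt (real k)" for k \<omega>
    define D where "D k \<omega> = (\<Sum>i<n. t i * (deviation (n - i) (B k \<omega>) / sqrt (real k) - deviation (n - Suc i) (B k \<omega>) / sqrt (real k)))" for k \<omega>
    have tm: "(\<lambda>x. \<Sum>i<n. t i * x i) \<in> borel_measurable (borel_Rn n)"
      by (intro borel_measurable_sum borel_measurable_times borel_measurable_const measurable_component_singleton) auto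
    have cm: "(\<lambda>x. cos ((\<Sum>i<n. t i * x i) + b)) \<in> borel_measurable (borel_Rn n)" using tm by measurable
    have rv: "random_variable borel (increment (s t) k)" for k using increments_iid(1) unfolding indep_vars_def2 by auto
    have um[measurable]: "u k \<in> borel_measurable M" for k
      unfolding u_def using rv by measurable
    have Dm[measurable]: "D k \<in> borel_measurable M" for k
      unfolding D_def by (intro borel_measurable_sum borel_measurable_times borel_measurable_const borel_measurable_diff borel_measurable_divide dm) auto
    \<comment> \<open>The differences between consecutive values are moved to the coefficients by
      transposing \<open>L_mat n\<close>.\<close>
    have comb: "(\<Sum>i<n. t i * (x i - (if Suc i < n then x (Suc i) else 0))) = (\<Sum>j<n. s t j * x j)" for x
    proof -
      have "(\<Sum>i<n. t i * (x i - (if Suc i < n then x (Suc i) else 0))) = (\<Sum>i<n. \<Sum>j<n. t i * ?L $$ (i, j) * x j)"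
        by (intro sum.cong refl) (simp add: L_mat_apply[symmetric] sum_distrib_left mult.assoc)
      also have "\<dots> = (\<Sum>j<n. \<Sum>i<n. t i * ?L $$ (i, j) * x j)" by (rule sum.swap)
      finally show ?thesis by (simp add: s_def sum_distrib_right)
    qed
    have EY: "expectation (Y t) = (\<Sum>i<n. t i * drift i)"
    proof -
      have "expectation (Y t) = (\<Sum>j<n. s t j * expectation (corner j))"
        unfolding Y_def using int by (subst Bochner_Integration.integral_sum) auto
      also have "\<dots> = (\<Sum>i<n. t i * drift i)"
        unfolding comb[symmetric] drift_def by (intro sum.cong refl) auto
      finally show ?thesis .
    qed
    have tZ: "(\<Sum>i<n. t i * Z k \<omega> i) = u k \<omega> - D k \<omega>" if \<omega>: "\<omega> \<in> space M" for k \<omega>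
    proof -
      have "(\<Sum>i<n. t i * Z k \<omega> i) = (\<Sum>i<n. t i * (row_val i (B k \<omega>) - (if Suc i < n then row_val (Suc i) (B k \<omega>) else 0)) / sqrt (real k)
          - t i * drift i * real k / sqrt (real k)
          - t i * (deviation (n - i) (B k \<omega>) / sqrt (real k) - deviation (n - Suc i) (B k \<omega>) / sqrt (real k)))"
        using SN_nth_eq[OF \<omega>, of _ k]
        by (intro sum.cong refl) (simp add: Z_def diff_divide_distrib right_diff_distrib mult_ac)
      also have "\<dots> = (\<Sum>i<n. t i * (row_val i (B k \<omega>) - (if Suc i < n then row_val (Suc i) (B k \<omega>) else 0))) / sqrt (real k)
          - (\<Sum>i<n. t i * drift i) * real k / sqrt (real k) - D k \<omega>"
        by (simp only: sum_subtractf D_def sum_divide_distrib[symmetric] sum_distrib_right[symmetric])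
      also have "\<dots> = u k \<omega> - D k \<omega>"
        unfolding comb[of "\<lambda>i. row_val i (B k \<omega>)"] EY[symmetric] sum_increment[symmetric] u_def by (simp add: diff_divide_distrib mult.commute)
      finally show ?thesis .
    qed
    have v0: "variance (Y t) \<ge> 0" by (rule variance_positive)
    have Ym: "Y t \<in> borel_measurable M" unfolding Y_def
      by (intro borel_measurable_sum borel_measurable_times borel_measurable_const corner_measurable) simp
    have Yi: "integrable M (Y t)" unfolding Y_def using int by (intro Bochner_Integration.integrable_sum integrable_mult_right) auto
    have Y2: "integrable M (\<lambda>\<omega>. (Y t \<omega>)\<^sup>2)" unfolding Y_def by (rule variance_linear_combination(2)[OF int sq])
    have law: "distr M borel (increment (s t) k) = distr M borel (Y t)" for k
      unfolding increment_law Y_def[abs_def] ..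
    have "(\<lambda>k. char (distr M borel (u k)) 1) \<longlonglongrightarrow> char (normal_law (variance (Y t))) 1"
      unfolding u_def using clt_char[OF increments_iid(1) law Ym Yi Y2] .
    then have "(\<lambda>k. Re (cis b * char (distr M borel (u k)) 1)) \<longlonglongrightarrow> Re (cis b * char (normal_law (variance (Y t))) 1)"
      by (intro tendsto_intros)
    then have "(\<lambda>k. \<integral>x. cos (x + b) \<partial>distr M borel (u k)) \<longlonglongrightarrow> (\<integral>x. cos (x + b) \<partial>normal_law (variance (Y t)))"
      using integral_cos_shift[OF real_distribution_distr[OF um]] integral_cos_shift[OF real_distribution_normal_law[OF v0]] by simp
    moreover have "(\<integral>x. cos (x + b) \<partial>distr M borel (u k)) = expectation (\<lambda>\<omega>. cos (u k \<omega> + b))" for k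
      by (subst integral_distr) auto
    moreover have "(\<integral>x. cos (x + b) \<partial>normal_law (variance (Y t))) = (\<integral>x. cos ((\<Sum>i<n. t i * x i) + b) \<partial>N)"
    proof -
      have tN: "(\<lambda>x. \<Sum>i<n. t i * x i) \<in> borel_measurable N" using tm by (simp cong: measurable_cong_sets add: Np(2))
      show ?thesis unfolding Nd[symmetric] by (subst integral_distr[OF tN]) auto
    qed
    ultimately have main: "(\<lambda>k. expectation (\<lambda>\<omega>. cos (u k \<omega> + b))) \<longlonglongrightarrow> (\<integral>x. cos ((\<Sum>i<n. t i * x i) + b) \<partial>N)" by simp
    \<comment> \<open>Slutsky's argument: the cosine is 1-Lipschitz and bounded and \<open>D\<close>
      tends to 0 almost surely, so dominated convergence removes it from the mean.\<close>
    have "(\<lambda>k. expectation (\<lambda>\<omega>. cos (u k \<omega> - D k \<omega> + b) - cos (u k \<omega> + b))) \<longlonglongrightarrow> expectation (\<lambda>\<omega>. 0)"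
    proof (rule integral_dominated_convergence[where w = "\<lambda>_. 2"])
      have "AE \<omega> in M. \<forall>q\<in>{..n}. (\<lambda>k. deviation q (B k \<omega>) / sqrt (real k)) \<longlonglongrightarrow> 0"
        using deviation_negligible by (intro AE_finite_allI) auto
      then show "AE \<omega> in M. (\<lambda>k. cos (u k \<omega> - D k \<omega> + b) - cos (u k \<omega> + b)) \<longlonglongrightarrow> 0"
      proof eventually_elim
        case (elim \<omega>)
        have "(\<lambda>k. D k \<omega>) \<longlonglongrightarrow> (\<Sum>i<n. t i * (0 - 0))"
          unfolding D_def by (intro tendsto_sum tendsto_mult tendsto_const tendsto_diff) (use elim in auto)
        then have "(\<lambda>k. \<bar>D k \<omega>\<bar>) \<longlonglongrightarrow> 0" by (intro tendsto_rabs_zero) simp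
        then show ?case
        proof (rule Lim_null_comparison[rotated])
          show "\<forall>\<^sub>F k in sequentially. norm (cos (u k \<omega> - D k \<omega> + b) - cos (u k \<omega> + b)) \<le> \<bar>D k \<omega>\<bar>"
            using abs_cos_diff_le[of "u k \<omega> - D k \<omega> + b" "u k \<omega> + b" for k] by simp
        qed
      qed
      show "AE \<omega> in M. norm (cos (u k \<omega> - D k \<omega> + b) - cos (u k \<omega> + b)) \<le> 2" for k
      proof (rule AE_I2)
        fix \<omega>
        have "\<bar>cos (u k \<omega> - D k \<omega> + b)\<bar> \<le> 1" "\<bar>cos (u k \<omega> + b)\<bar> \<le> 1" by (rule abs_cos_le_one)+
        then show "norm (cos (u k \<omega> - D k \<omega> + b) - cos (u k \<omega> + b)) \<le> 2" unfolding real_norm_def by linarith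
      qed
    qed auto
    from tendsto_add[OF main this]
    have lim: "(\<lambda>k. expectation (\<lambda>\<omega>. cos (u k \<omega> + b)) + expectation (\<lambda>\<omega>. cos (u k \<omega> - D k \<omega> + b) - cos (u k \<omega> + b)))
        \<longlonglongrightarrow> (\<integral>x. cos ((\<Sum>i<n. t i * x i) + b) \<partial>N)" by simp
    have ic: "integrable M (\<lambda>\<omega>. cos (h \<omega>))" if "h \<in> borel_measurable M" for h :: "'w \<Rightarrow> real"
      by (rule integrable_const_bound[where B = 1]) (use that in auto)
    have "expectation (\<lambda>\<omega>. cos (u k \<omega> + b)) + expectation (\<lambda>\<omega>. cos (u k \<omega> - D k \<omega> + b) - cos (u k \<omega> + b))
        = (\<integral>x. cos ((\<Sum>i<n. t i * x i) + b) \<partial>distr M (borel_Rn n) (Z k))" for k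
    proof -
      have "(\<integral>x. cos ((\<Sum>i<n. t i * x i) + b) \<partial>distr M (borel_Rn n) (Z k)) = expectation (\<lambda>\<omega>. cos ((\<Sum>i<n. t i * Z k \<omega> i) + b))"
        by (rule integral_distr[OF Zm cm])
      also have "\<dots> = expectation (\<lambda>\<omega>. cos (u k \<omega> - D k \<omega> + b))"
        by (rule Bochner_Integration.integral_cong[OF refl]) (simp add: tZ)
      finally show ?thesis
        using ic[of "\<lambda>\<omega>. u k \<omega> + b"] ic[of "\<lambda>\<omega>. u k \<omega> - D k \<omega> + b"] by simp
    qed
    then show ?thesis using lim by simp
  qed
  have "weakly_converges (top_Rn n) (\<lambda>k. distr M (borel_Rn n) (Z k)) N"
    by (rule Cramer_Wold) (use Np conv prob_space_distr[OF Zm] in auto)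
  then show ?thesis using N unfolding Z_def by blast
qed

end

theorem theorem1p1:
  fixes M :: "'w measure"
    and A :: "nat \<Rightarrow> 'w \<Rightarrow> 'p :: prime_card padic mat"
    and n :: nat
    and lam :: "nat \<Rightarrow> 'w \<Rightarrow> int list"
    and W :: "nat \<Rightarrow> 'w \<Rightarrow> real"
    and EW :: "nat \<Rightarrow> real"
    and drift :: "nat \<Rightarrow> real"
    and \<Sigma> :: "real mat"
  assumes "prob_space M"
    and "n \<ge> 1"
    and indep: "prob_space.indep_vars M (\<lambda>_. borel_GL n) A UNIV"
    and ident: "\<And>k. distr M (borel_GL n) (A k) = distr M (borel_GL n) (A 0)"
    and left_inv: "\<And>U. U \<in> GL_Zp n \<Longrightarrow>
      distr M (borel_GL n) (\<lambda>\<omega>. U * A 0 \<omega>) = distr M (borel_GL n) (A 0)"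
    and right_inv: "\<And>U. U \<in> GL_Zp n \<Longrightarrow>
      distr M (borel_GL n) (\<lambda>\<omega>. A 0 \<omega> * U) = distr M (borel_GL n) (A 0)"
  defines "lam \<equiv> \<lambda>k \<omega>. SN (mat_prod n (\<lambda>j. A j \<omega>) k)"
    and "W \<equiv> \<lambda>i \<omega>. real_of_int (sum_list (SN (drop_rows i (A 0 \<omega>))))"
    and "EW \<equiv> \<lambda>i. prob_space.expectation M (W i)"
    and "drift \<equiv> \<lambda>i. if Suc i < n then EW i - EW (Suc i) else EW i"
    and "\<Sigma> \<equiv> mat n n (\<lambda>(i, j). covariance M (W i) (W j))"
  shows
    "((\<forall>i<n. integrable M (W i)) \<longrightarrow>
       (AE \<omega> in M. \<forall>i<n. (\<lambda>k. real_of_int (lam k \<omega> ! i) / real k) \<longlonglongrightarrow> drift i)) \<and>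
     ((\<forall>i<n. integrable M (W i)) \<and> (\<forall>i<n. integrable M (\<lambda>\<omega>. (W i \<omega>)\<^sup>2)) \<longrightarrow>
       (\<exists>N. is_centered_gaussian n (L_mat n * \<Sigma> * transpose_mat (L_mat n)) N \<and>
          weakly_converges (top_Rn n)
            (\<lambda>k. distr M (borel_Rn n)
               (\<lambda>\<omega>. \<lambda>i\<in>{..<n}. (real_of_int (lam k \<omega> ! i) - real k * drift i) / sqrt (real k)))
            N))"
proof -
  interpret prob_space M by fact
  interpret biinvariant_products M A n
    by unfold_locales (fact indep ident left_inv)+
  have W: "W = corner"
    by (intro ext) (simp add: W_def corner_def)
  have lam: "lam k \<omega> = SN (B k \<omega>)" for k \<omega> by (simp add: lam_def B_def)
  show ?thesis
    using SN_slln SN_clt unfolding W lam drift_def EW_def \<Sigma>_def by blast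
qed

end
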